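(* The multitime correlation function is given by a quaternion determinant: $$ \rho^T_N \left(t_{1}, \xi^{N_1}_1; \dots; t_{M+1}, \xi^{N_{M+1}}_{M+1} \right) = {\rm Tdet}\, Q \left({\bf x}^{(1)}_{N_1},{\bf x}^{(2)}_{N_2},\dots, {\bf x}^{(M+1)}_{N_{M+1}} \right). $$
   Context: Setting. $N$ is an even positive integer, $T>0$, $M\ge 1$, and $0=t_0<t_1<\dots<t_M<t_{M+1}=T$. Let $p_t(x,y)=\frac{1}{\sqrt{2\pi t}}e^{-(x-y)^2/2t}$ for $t>0$, with the convention $p_0(y,x)\,dy=\delta_x(dy)$. Let ${\bf R}^N_<=\{{\bf x}\in{\bf R}^N: x_1<\dots<x_N\}$, $h_N({\bf x})=\prod_{1\le i<j\le N}(x_j-x_i)$, and $C(N,T,t)=\pi^{N/2}\big(\prod_{j=1}^N\Gamma(j/2)\big)^{-1}T^{N(N-1)/4}t^{-N(N-1)/2}$. For ${\bf x}^{(m)}_N=(x^{(m)}_1,\dots,x^{(m)}_N)$, $1\le m\le M+1$, write ${\bf x}^{(m)}_{N'}=(x^{(m)}_1,\dots,x^{(m)}_{N'})$ and $\xi^{N'}_m=\{x^{(m)}_i\}_{i=1}^{N'}$. The multitime transition density of $N$ Brownian motions started at the origin and conditioned not to collide on $[0,T]$ is $$\rho_N^T(t_1,\xi^N_1;\dots;t_{M+1},\xi^N_{M+1})=C(N,T,t_1)\,h_N({\bf x}^{(1)}_N)\,{\rm sgn}\big(h_N({\bf x}^{(M+1)}_N)\big)\prod_{i=1}^N p_{t_1}(0,x^{(1)}_i)\prod_{m=1}^M\det_{1\le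 i,j\le N}\big(p_{t_{m+1}-t_m}(x^{(m)}_i,x^{(m+1)}_j)\big),$$ and for positive integers $N_m\le N$ the $(N_1,\dots,N_{M+1})$-multitime correlation function is $$\rho_N^T(t_1,\xi^{N_1}_1;\dots;t_{M+1},\xi^{N_{M+1}}_{M+1})=\int_{\prod_m{\bf R}^{N-N_m}}\prod_{m=1}^{M+1}\frac{1}{(N-N_m)!}\prod_{i=N_m+1}^N dx^{(m)}_i\;\rho_N^T(t_1,\xi^N_1;\dots;t_{M+1},\xi^N_{M+1}).$$ Ingredients. For $1\le m,n\le M+1$, $F^{m,n}(x,y)=\int_{-\infty}^{\infty}dw\int_{-\infty}^{w}dz\,\big[p_{T-t_m}(x,z)p_{T-t_n}(y,w)-p_{T-t_m}(x,w)p_{T-t_n}(y,z)\big]$. Let $c_1=\sqrt{t_1(2T-t_1)/T}$, $z_1=\sqrt{(2T-t_1)/t_1}$, $H_j$ the Hermite polynomials, and $\alpha_{kj}=2^{-k}c_1^k\delta_{kj}$ for $k$ even, $\alpha_{kj}=2^{-k}c_1^k\{\delta_{kj}-2(k-1)\delta_{k-2,j}\}$ for $k$ odd. Define the monic polynomials $R_k(x)=z_1^{-k}\sum_{j=0}^k\alpha_{kj}H_j(x/c_1)z_1^j$, $r_j=\frac{\Gamma(j+\frac12)\Gamma(j+1)}{\pi}\big(\frac{t_1^2}{T}\big)^{2j+1/2}$, $R^{(m)}_k(x)=\int_{\bf R}dy\,R_k(y)p_{t_1}(0,y)p_{t_m-t_1}(y,x)$, and $\Phi^{(m)}_k(x)=\int_{\bf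 R}dy\,R^{(m)}_k(y)F^{m,m}(y,x)$. Set $D^{m,n}(x,y)=\sum_{k=0}^{N/2-1}\frac{1}{r_k}[R^{(m)}_{2k}(x)R^{(n)}_{2k+1}(y)-R^{(m)}_{2k+1}(x)R^{(n)}_{2k}(y)]$, $I^{m,n}(x,y)=-\sum_{k=0}^{N/2-1}\frac{1}{r_k}[\Phi^{(m)}_{2k}(x)\Phi^{(n)}_{2k+1}(y)-\Phi^{(m)}_{2k+1}(x)\Phi^{(n)}_{2k}(y)]$, $S^{m,n}(x,y)=\sum_{k=0}^{N/2-1}\frac{1}{r_k}[\Phi^{(m)}_{2k}(x)R^{(n)}_{2k+1}(y)-\Phi^{(m)}_{2k+1}(x)R^{(n)}_{2k}(y)]$, $\tilde S^{m,n}(x,y)=S^{m,n}(x,y)-p_{t_n-t_m}(x,y)1(m<n)$, $\tilde I^{m,n}(x,y)=I^{m,n}(x,y)+F^{m,n}(x,y)$. Quaternions $q=q_0+q_1e_1+q_2e_2+q_3e_3$ are represented by $2\times2$ complex matrices via $C(1)=I$, $C(e_1)=\begin{pmatrix}0&-1\\1&0\end{pmatrix}$, $C(e_2)=\begin{pmatrix}0&-\sqrt{-1}\\-\sqrt{-1}&0\end{pmatrix}$, $C(e_3)=\begin{pmatrix}\sqrt{-1}&0\\0&-\sqrt{-1}\end{pmatrix}$. Let $q^{m,n}(x,y)$ be the quaternion with $C(q^{m,n}(x,y))=\begin{pmatrix}\tilde S^{m,n}(x,y)&\tilde I^{m,n}(x,y)\\ D^{m,n}(x,y)&\tilde S^{n,m}(y,x)\end{pmatrix}$,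 and let $Q({\bf x}^{(1)}_{N_1},\dots,{\bf x}^{(M+1)}_{N_{M+1}})$ be the self-dual $\sum_m N_m\times\sum_m N_m$ quaternion matrix with blocks $\big(q^{m,n}(x^{(m)}_i,x^{(n)}_j)\big)_{1\le i\le N_m,1\le j\le N_n}$. For an $N\times N$ self-dual quaternion matrix $Q=(q_{ab})$, Dyson's quaternion determinant is ${\rm Tdet}\,Q=\sum_{\pi\in S_N}(-1)^{N-\ell(\pi)}\prod_1^{\ell(\pi)}q_{ab}q_{bc}\cdots q_{da}$, where $\ell(\pi)$ is the number of cycles $(a\to b\to\cdots\to d\to a)$ of $\pi$. *)

theory Defs
  imports "HOL-Probability.Probability"
begin

definition pk :: "real \<Rightarrow> real \<Rightarrow> real \<Rightarrow> real" where
  "pk s x y = exp (- (x - y)\<^sup>2 / (2 * s)) / sqrt (2 * pi * s)"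

text \<open>The kernel p_s(x,y) dy as a measure in y; for s = 0 it is the Dirac mass at x
  (convention p_0(y,x) dy = delta_x(dy)).\<close>
definition kern :: "real \<Rightarrow> real \<Rightarrow> real measure" where
  "kern s x = (if s = 0 then return lborel x else density lborel (\<lambda>y. ennreal (pk s x y)))"

definition Cconst :: "nat \<Rightarrow> real \<Rightarrow> real \<Rightarrow> real" where
  "Cconst N T s = pi powr (real N / 2) / (\<Prod>j\<in>{1..N}. Gamma (real j / 2))
     * T powr (real (N * (N - 1)) / 4) * s powr (- (real (N * (N - 1)) / 2))"

definition hN :: "nat \<Rightarrow> (nat \<Rightarrow> real) \<Rightarrow> real" where
  "hN N v = (\<Prod>i\<in>{1..N}. \<Prod>j\<in>{i<..N}. v j - v i)"

definition ldet :: "nat \<Rightarrow> (nat \<Rightarrow> nat \<Rightarrow> real) \<Rightarrow> real" where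
  "ldet n A = (\<Sum>p | p permutes {1..n}. of_int (sign p) * (\<Prod>i\<in>{1..n}. A i (p i)))"

definition rho_full :: "nat \<Rightarrow> real \<Rightarrow> nat \<Rightarrow> (nat \<Rightarrow> real) \<Rightarrow> (nat \<Rightarrow> nat \<Rightarrow> real) \<Rightarrow> real" where
  "rho_full N T M t x =
     Cconst N T (t 1) * hN N (x 1) * sgn (hN N (x (M + 1)))
     * (\<Prod>i\<in>{1..N}. pk (t 1) 0 (x 1 i))
     * (\<Prod>m\<in>{1..M}. ldet N (\<lambda>i j. pk (t (m + 1) - t m) (x m i) (x (m + 1) j)))"

definition free_idx :: "nat \<Rightarrow> nat \<Rightarrow> (nat \<Rightarrow> nat) \<Rightarrow> (nat \<times> nat) set" where
  "free_idx N M Ns = {(m, i). m \<in> {1..M + 1} \<and> i \<in> {Ns m<..N}}"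

definition corr :: "nat \<Rightarrow> real \<Rightarrow> nat \<Rightarrow> (nat \<Rightarrow> real) \<Rightarrow> (nat \<Rightarrow> nat) \<Rightarrow> (nat \<Rightarrow> nat \<Rightarrow> real) \<Rightarrow> real" where
  "corr N T M t Ns x =
     (\<Prod>m\<in>{1..M + 1}. 1 / fact (N - Ns m)) *
     (\<integral>y. rho_full N T M t (\<lambda>m i. if i \<le> Ns m then x m i else y (m, i))
        \<partial>(PiM (free_idx N M Ns) (\<lambda>_. lborel)))"

fun herm :: "nat \<Rightarrow> real \<Rightarrow> real" where
  "herm 0 x = 1"
| "herm (Suc 0) x = 2 * x"
| "herm (Suc (Suc n)) x = 2 * x * herm (Suc n) x - 2 * real (Suc n) * herm n x"

definition Fmn :: "real \<Rightarrow> (nat \<Rightarrow> real) \<Rightarrow> nat \<Rightarrow> nat \<Rightarrow> real \<Rightarrow> real \<Rightarrow> real" where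
  "Fmn T t m n x y =
     (\<integral>w. (\<integral>z. indicator {..<w} z \<partial>kern (T - t m) x) \<partial>kern (T - t n) y)
   - (\<integral>w. (\<integral>z. indicator {..<w} z \<partial>kern (T - t n) y) \<partial>kern (T - t m) x)"

definition c1 :: "real \<Rightarrow> real \<Rightarrow> real" where
  "c1 T s = sqrt (s * (2 * T - s) / T)"

definition z1 :: "real \<Rightarrow> real \<Rightarrow> real" where
  "z1 T s = sqrt ((2 * T - s) / s)"

definition alpha :: "real \<Rightarrow> real \<Rightarrow> nat \<Rightarrow> nat \<Rightarrow> real" where
  "alpha T s k j = (1 / 2 ^ k) * c1 T s ^ k *
     (if even k then (if k = j then 1 else 0)
      else (if k = j then 1 else 0) - 2 * (real k - 1) * (if j + 2 = k then 1 else 0))"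

definition Rpoly :: "real \<Rightarrow> real \<Rightarrow> nat \<Rightarrow> real \<Rightarrow> real" where
  "Rpoly T s k x = inverse (z1 T s ^ k) *
     (\<Sum>j\<in>{0..k}. alpha T s k j * herm j (x / c1 T s) * z1 T s ^ j)"

definition rcoef :: "real \<Rightarrow> real \<Rightarrow> nat \<Rightarrow> real" where
  "rcoef T s j = Gamma (real j + 1 / 2) * Gamma (real j + 1) / pi
     * (s\<^sup>2 / T) powr (2 * real j + 1 / 2)"

definition Rm :: "real \<Rightarrow> (nat \<Rightarrow> real) \<Rightarrow> nat \<Rightarrow> nat \<Rightarrow> real \<Rightarrow> real" where
  "Rm T t m k x = (\<integral>y. Rpoly T (t 1) k y * pk (t 1) 0 y \<partial>kern (t m - t 1) x)"

definition Phi :: "real \<Rightarrow> (nat \<Rightarrow> real) \<Rightarrow> nat \<Rightarrow> nat \<Rightarrow> real \<Rightarrow> real" where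
  "Phi T t m k x = (\<integral>y. Rm T t m k y * Fmn T t m m y x \<partial>lborel)"

definition Dk :: "nat \<Rightarrow> real \<Rightarrow> (nat \<Rightarrow> real) \<Rightarrow> nat \<Rightarrow> nat \<Rightarrow> real \<Rightarrow> real \<Rightarrow> real" where
  "Dk N T t m n x y = (\<Sum>k<N div 2. 1 / rcoef T (t 1) k *
     (Rm T t m (2*k) x * Rm T t n (2*k+1) y - Rm T t m (2*k+1) x * Rm T t n (2*k) y))"

definition Ik :: "nat \<Rightarrow> real \<Rightarrow> (nat \<Rightarrow> real) \<Rightarrow> nat \<Rightarrow> nat \<Rightarrow> real \<Rightarrow> real \<Rightarrow> real" where
  "Ik N T t m n x y = - (\<Sum>k<N div 2. 1 / rcoef T (t 1) k *
     (Phi T t m (2*k) x * Phi T t n (2*k+1) y - Phi T t m (2*k+1) x * Phi T t n (2*k) y))"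

definition Sk :: "nat \<Rightarrow> real \<Rightarrow> (nat \<Rightarrow> real) \<Rightarrow> nat \<Rightarrow> nat \<Rightarrow> real \<Rightarrow> real \<Rightarrow> real" where
  "Sk N T t m n x y = (\<Sum>k<N div 2. 1 / rcoef T (t 1) k *
     (Phi T t m (2*k) x * Rm T t n (2*k+1) y - Phi T t m (2*k+1) x * Rm T t n (2*k) y))"

definition St :: "nat \<Rightarrow> real \<Rightarrow> (nat \<Rightarrow> real) \<Rightarrow> nat \<Rightarrow> nat \<Rightarrow> real \<Rightarrow> real \<Rightarrow> real" where
  "St N T t m n x y = Sk N T t m n x y - (if m < n then pk (t n - t m) x y else 0)"

definition It :: "nat \<Rightarrow> real \<Rightarrow> (nat \<Rightarrow> real) \<Rightarrow> nat \<Rightarrow> nat \<Rightarrow> real \<Rightarrow> real \<Rightarrow> real" where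
  "It N T t m n x y = Ik N T t m n x y + Fmn T t m n x y"

text \<open>The quaternion q^(m,n)(x,y), represented by its matrix C(q).\<close>
definition qmat :: "nat \<Rightarrow> real \<Rightarrow> (nat \<Rightarrow> real) \<Rightarrow> nat \<Rightarrow> nat \<Rightarrow> real \<Rightarrow> real \<Rightarrow> real^2^2" where
  "qmat N T t m n x y = vector [vector [St N T t m n x y, It N T t m n x y],
                                vector [Dk N T t m n x y, St N T t n m y x]]"

text \<open>Scalar part q_0 of a quaternion q with matrix C(q) = A (C(e_i) are traceless).\<close>
definition qscal :: "real^2^2 \<Rightarrow> real" where
  "qscal A = trace A / 2"

definition cyc :: "('a \<Rightarrow> 'a) \<Rightarrow> 'a \<Rightarrow> 'a set" where
  "cyc p a = {(p ^^ j) a | j. True}"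

definition cycprod :: "('a \<Rightarrow> 'a \<Rightarrow> real^2^2) \<Rightarrow> ('a \<Rightarrow> 'a) \<Rightarrow> 'a \<Rightarrow> real^2^2" where
  "cycprod Q p a = foldr (\<lambda>j B. Q ((p ^^ j) a) ((p ^^ Suc j) a) ** B) [0..<card (cyc p a)] (mat 1)"

definition Tdet :: "'a set \<Rightarrow> ('a \<Rightarrow> 'a \<Rightarrow> real^2^2) \<Rightarrow> real" where
  "Tdet I Q = (\<Sum>p | p permutes I.
      (-1) ^ (card I - card (cyc p ` I)) *
      (\<Prod>c\<in>cyc p ` I. qscal (cycprod Q p (SOME a. a \<in> c))))"

definition blk_idx :: "nat \<Rightarrow> (nat \<Rightarrow> nat) \<Rightarrow> (nat \<times> nat) set" where
  "blk_idx M Ns = {(m, i). m \<in> {1..M + 1} \<and> i \<in> {1..Ns m}}"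

definition Qmat :: "nat \<Rightarrow> real \<Rightarrow> (nat \<Rightarrow> real) \<Rightarrow> (nat \<Rightarrow> nat \<Rightarrow> real)
    \<Rightarrow> nat \<times> nat \<Rightarrow> nat \<times> nat \<Rightarrow> real^2^2" where
  "Qmat N T t x a b = qmat N T t (fst a) (fst b) (x (fst a) (snd a)) (x (fst b) (snd b))"

end

theory Submission
  imports Defs "HOL-Combinatorics.Cycles"
begin

text \<open>For a self-dual quaternion matrix the quaternion determinant is the Pfaffian of twice the size
  obtained by multiplying with the standard symplectic form, and the \<open>N\<close> skew orthogonal functions
  entering \<open>S\<close>, \<open>I\<close>, \<open>D\<close> come from a Schur complement. Hence \<open>Tdet Q\<close> is, up to the constant
  \<open>\<Prod>k<N/2. - r_k\<close>, a bordered Pfaffian with two rows per point and \<open>N\<close> border rows, whose entries are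
  just \<open>F\<close>, the heat kernel, \<open>\<Phi>\<close>, \<open>R\<close> and the skew inner products. With \<open>N\<close> points at every time this
  Pfaffian is block triangular and factors into the full density. When one point at time \<open>t_m\<close> is
  integrated out, the semigroup property turns the product of its two rows into a truncated copy of
  the kernel itself, and expanding along rows gives the remaining Pfaffian time_grid \<open>N\<close> minus the number
  of remaining points at that time. Iterating yields the factorials in the correlation function.\<close>

section \<open>Pfaffians\<close>

text \<open>Two simplifications carry the analysis. The double integral \<open>Fmn\<close> is the
  mean of sgn(W - Z) for independent Gaussians W and Z, hence an error function of y - x with
  variance 2T - t_m - t_n; moving a heat kernel onto it only adds variances, and so every product of
  rows can be integrated in closed form. Moreover R_(2k+1) times the initial Gaussian is -t_1 times
  the derivative of R_(2k) times that Gaussian, so pairing it with a smoothed sign leaves a Gaussian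
  integral of Hermite polynomials; this yields the skew orthogonality and the value of r_k. The
  obstacle in comparing \<open>Tdet\<close> with a Pfaffian is that a cycle carries a product of
  matrices that do not commute, so permutations and pairings are not matched directly: one point is
  removed at a time on both sides. The factor met on integrating out a point of level m is a
  difference of two counts: borders and \<open>Up\<close> sites below level m, against
  \<open>Dn\<close> sites of level at most m. Only the borders and level m survive in it.\<close>

abbreviation "swp \<equiv> Transposition.transpose"

section \<open>Deletion of list entries and expansion of Pfaffians\<close>

definition del :: "nat \<Rightarrow> 'a list \<Rightarrow> 'a list" where
  "del j L = take j L @ drop (Suc j) L"

lemma length_del: "j < length L \<Longrightarrow> length (del j L) = length L - 1"
  by (auto simp: del_def)

lemma del_append1: "j < length L1 \<Longrightarrow> del j (L1 @ L2) = del j L1 @ L2"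
  by (auto simp: del_def)

lemma del_append2: "length L1 \<le> j \<Longrightarrow> del j (L1 @ L2) = L1 @ del (j - length L1) L2"
  by (auto simp: del_def Suc_diff_le)

lemma del_0[simp]: "del 0 (a # L) = L"
  by (auto simp: del_def)

lemma del_Suc[simp]: "del (Suc j) (a # L) = a # del j L"
  by (auto simp: del_def)

lemma nth_del: "j < length L \<Longrightarrow> k < length L - 1 \<Longrightarrow> del j L ! k = (if k < j then L ! k else L ! Suc k)"
  by (auto simp: del_def nth_append min_def)

lemma set_del: "set (del j L) \<subseteq> set L"
  by (auto simp: del_def dest: in_set_takeD in_set_dropD)

lemma map_del: "map f (del j L) = del j (map f L)"
  by (simp add: del_def take_map drop_map)

lemma del_del: "k \<le> j \<Longrightarrow> j + 1 < length L \<Longrightarrow> del j (del k L) = del k (del (Suc j) L)"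
  by (rule nth_equalityI) (auto simp: length_del nth_del)

text \<open>With \<open>sum.cong\<close> as a congruence rule the termination goals carry the bound
  \<open>j < length L\<close> that \<open>length_del\<close> asks for.\<close>

context
  notes sum.cong[fundef_cong]
begin
text \<open>Arbitrary labels replace matrix indices, so that points, borders and modified copies of
  rows can share one kernel. Only entries \<open>A a b\<close> with \<open>a\<close> before
  \<open>b\<close> in the list enter. A list of odd length gets 0, since the recursion meets the
  empty sum at a one-element list.\<close>

function pf :: "('a \<Rightarrow> 'a \<Rightarrow> real) \<Rightarrow> 'a list \<Rightarrow> real" where
  "pf A [] = 1"
| "pf A (a # L) = (\<Sum>j<length L. (-1)^j * A a (L ! j) * pf A (del j L))"
  by pat_completeness auto
termination
  by (relation "Wellfounded.measure (\<lambda>(A, L). length L)") (auto simp: length_del)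
end

declare pf.simps(2)[simp del]

lemma length_induct_list:
  assumes "\<And>L. (\<And>L'. length L' < length L \<Longrightarrow> P L') \<Longrightarrow> P L"
  shows "P (L :: 'a list)"
  using assms by (rule measure_induct_rule)

lemma pf_map: "pf A (map f L) = pf (\<lambda>a b. A (f a) (f b)) L"
proof (induction L rule: length_induct_list)
  case (1 L)
  show ?case
  proof (cases L)
    case (Cons a L')
    then show ?thesis
      by (auto intro!: sum.cong simp: pf.simps(2) map_del[symmetric] 1 length_del)
  qed auto
qed

lemma pf_cong:
  assumes "\<And>a b. a \<in> set L \<Longrightarrow> b \<in> set L \<Longrightarrow> A a b = B a b"
  shows "pf A L = pf B L"
  using assms
proof (induction L rule: length_induct_list)
  case (1 L)
  show ?case
  proof (cases L)
    case (Cons a L')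
    have "pf A (del j L') = pf B (del j L')" if "j < length L'" for j
      using 1(2) that set_del[of j L'] by (intro 1(1)) (auto simp: Cons length_del)
    then show ?thesis
      using 1(2) by (auto simp: Cons pf.simps(2))
  qed auto
qed

text \<open>A pair (j, k) names two distinct positions of a list, \<open>k\<close> being counted
  after position \<open>j\<close> has been removed. Naming the same positions in the other order is
  an involution: (j, k) becomes (k, j - 1) or (k + 1, j).\<close>

lemma sum_pairs_reindex:
  fixes f g :: "nat \<Rightarrow> nat \<Rightarrow> real"
  assumes "\<And>j k. k \<le> j \<Longrightarrow> Suc j < n \<Longrightarrow> f (Suc j) k = g k j"
    and "\<And>j k. j \<le> k \<Longrightarrow> Suc k < n \<Longrightarrow> f j k = g (Suc k) j"
  shows "(\<Sum>j<n. \<Sum>k<n-1. f j k) = (\<Sum>j<n. \<Sum>k<n-1. g j k)"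
proof -
  have "(\<Sum>p\<in>{..<n} \<times> {..<n-1}. f (fst p) (snd p)) = (\<Sum>p\<in>{..<n} \<times> {..<n-1}. g (fst p) (snd p))"
  proof (rule sum.reindex_bij_witness
       [where i="\<lambda>(j,k). if k < j then (k, j - 1) else (Suc k, j)"
          and j="\<lambda>(j,k). if k < j then (k, j - 1) else (Suc k, j)"])
    fix p assume p: "p \<in> {..<n} \<times> {..<n-1}"
    obtain j k where jk: "p = (j, k)" by (cases p)
    show "g (fst (case p of (j, k) \<Rightarrow> if k < j then (k, j - 1) else (Suc k, j)))
      (snd (case p of (j, k) \<Rightarrow> if k < j then (k, j - 1) else (Suc k, j))) = f (fst p) (snd p)"
      using assms(1)[of k "j - 1"] assms(2)[of j k] p
      by (cases "k < j") (auto simp: jk)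
  qed (auto split: if_splits)
  then show ?thesis
    by (simp add: sum.cartesian_product split_beta)
qed

text \<open>What remains once two leading rows are expanded. The extra minus sign arises because the
  second row itself occupies the first column in the expansion of the first row.\<close>

definition cof2 :: "('a \<Rightarrow> 'a \<Rightarrow> real) \<Rightarrow> 'a list \<Rightarrow> nat \<Rightarrow> nat \<Rightarrow> real" where
  "cof2 A L j k = - ((-1)^(j+k) * pf A (del k (del j L)))"

lemma pf_expand2:
  "pf A (p # q # L) = A p q * pf A L
     + (\<Sum>j<length L. \<Sum>k<length L - 1. A p (L ! j) * A q (del j L ! k) * cof2 A L j k)"
proof -
  have "pf A (p # q # L) = A p q * pf A L
    + (\<Sum>j<length L. (-1)^(Suc j) * A p (L ! j) * pf A (q # del j L))"
    unfolding pf.simps(2)[of A p] length_Cons sum.lessThan_Suc_shift by simp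
  also have "(\<Sum>j<length L. (-1)^(Suc j) * A p (L ! j) * pf A (q # del j L))
     = (\<Sum>j<length L. \<Sum>k<length L - 1. A p (L ! j) * A q (del j L ! k) * cof2 A L j k)"
  proof (intro sum.cong refl)
    fix j assume "j \<in> {..<length L}"
    then have "pf A (q # del j L)
      = (\<Sum>k<length L - 1. (-1)^k * A q (del j L ! k) * pf A (del k (del j L)))"
      by (simp add: pf.simps(2) length_del)
    then show "(-1)^(Suc j) * A p (L ! j) * pf A (q # del j L)
      = (\<Sum>k<length L - 1. A p (L ! j) * A q (del j L ! k) * cof2 A L j k)"
      by (simp add: sum_distrib_left sum_negf cof2_def power_add mult_ac)
  qed
  finally show ?thesis .
qed

section \<open>Alternation, row linearity and elimination\<close>

definition skew :: "('a \<Rightarrow> 'a \<Rightarrow> real) \<Rightarrow> bool" where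
  "skew A \<longleftrightarrow> (\<forall>a b. A a b = - A b a)"

lemma skewD: "skew A \<Longrightarrow> A a b = - A b a"
  unfolding skew_def by blast

text \<open>In the double expansion, exchanging \<open>p\<close> and \<open>q\<close> names the two
  removed columns in the opposite order, which flips the sign in \<open>cof2\<close>; the term with
  \<open>A p q\<close> changes sign by skewness.\<close>

lemma pf_swap0:
  assumes "skew A"
  shows "pf A (p # q # L) = - pf A (q # p # L)"
proof -
  define f where "f p q j k = A p (L ! j) * A q (del j L ! k) * cof2 A L j k" for p q j k
  have E: "pf A (p # q # L) = A p q * pf A L + (\<Sum>j<length L. \<Sum>k<length L - 1. f p q j k)" for p q
    unfolding f_def by (rule pf_expand2)
  have "f p q (Suc j) k = - f q p k j" if "k \<le> j" "Suc j < length L" for p q j k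
  proof -
    have "del j (del k L) = del k (del (Suc j) L)" "del (Suc j) L ! k = L ! k" "del k L ! j = L ! Suc j"
      using that by (simp_all add: del_del nth_del)
    then show ?thesis unfolding f_def cof2_def by (simp add: add.commute)
  qed
  then have "(\<Sum>j<length L. \<Sum>k<length L - 1. f p q j k)
    = (\<Sum>j<length L. \<Sum>k<length L - 1. - f q p j k)"
    by (intro sum_pairs_reindex[of _ "f p q" "\<lambda>j k. - f q p j k"]) simp_all
  then have "(\<Sum>j<length L. \<Sum>k<length L - 1. f p q j k)
    = - (\<Sum>j<length L. \<Sum>k<length L - 1. f q p j k)"
    by (simp add: sum_negf)
  moreover have "A p q * pf A L = - (A q p * pf A L)"
    by (metis skewD[OF assms] mult_minus_left)
  ultimately show ?thesis
    unfolding E[of p q] E[of q p] by linarith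
qed

text \<open>Behind a common first row \<open>c\<close>, a column other than \<open>a\<close> and
  \<open>b\<close> leaves these two adjacent and falls to the induction hypothesis. The columns
  \<open>a\<close> and \<open>b\<close> leave identical minors, but at neighbouring positions, hence
  with opposite signs.\<close>

lemma pf_swap:
  assumes A: "skew A"
  shows "pf A (L1 @ a # b # L2) = - pf A (L1 @ b # a # L2)"
proof (induction "length (L1 @ L2)" arbitrary: L1 L2 rule: less_induct)
  case less
  show ?case
  proof (cases L1)
    case Nil
    then show ?thesis using pf_swap0[OF A, of a b L2] by simp
  next
    case (Cons c K)
    define n where "n = length K"
    define M where "M = K @ a # b # L2"
    define M' where "M' = K @ b # a # L2"
    define l where "l = length M"
    have lM: "length M = l" "length M' = l" "Suc n < l"
      by (simp_all add: l_def M_def M'_def n_def)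
    define f where "f M j = (-1)^j * A c (M ! j) * pf A (del j M)" for M j
    have f1: "f M j = - f M' j" if "j < n" for j
      using less[of "del j K" L2] that
      by (auto simp: f_def M_def M'_def del_append1 n_def length_del Cons nth_append)
    have f2: "f M j = - f M' j" if "Suc (Suc n) \<le> j" "j < l" for j
    proof -
      define i where "i = j - n - 2"
      have "j = n + Suc (Suc i)" "i < length L2"
        using that by (auto simp: i_def l_def M_def n_def)
      then show ?thesis
        using less[of K "del i L2"]
        by (simp add: f_def M_def M'_def del_append2 n_def length_del Cons nth_append)
    qed
    have f3: "f M n = - f M' (Suc n)" "f M (Suc n) = - f M' n"
      by (simp_all add: f_def M_def M'_def del_append2 n_def nth_append Suc_diff_le)
    have "pf A (c # M) = (\<Sum>j<l. f M j)"
      by (simp add: f_def lM pf.simps(2))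
    also have "\<dots> = (\<Sum>j<l. - f M' j)"
    proof (rule sum.reindex_bij_witness[where i="swp n (Suc n)" and j="swp n (Suc n)"])
      fix j assume "j \<in> {..<l}"
      then consider "j < n" | "j = n" | "j = Suc n" | "Suc (Suc n) \<le> j" "j < l"
        by fastforce
      then show "- f M' (swp n (Suc n) j) = f M j"
        by cases (simp_all add: f1 f2 f3 Transposition.transpose_def)
    qed (use lM in \<open>auto simp: Transposition.transpose_def\<close>)
    also have "\<dots> = - pf A (c # M')"
      by (simp add: f_def lM sum_negf pf.simps(2))
    finally show ?thesis by (simp add: Cons M_def M'_def)
  qed
qed

lemma pf_move:
  assumes A: "skew A"
  shows "pf A (L1 @ K @ a # L2) = (-1)^length K * pf A (L1 @ a # K @ L2)"
proof (induction K arbitrary: L1)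
  case (Cons b K)
  have "pf A (L1 @ (b # K) @ a # L2) = (-1)^length K * pf A ((L1 @ [b]) @ a # K @ L2)"
    using Cons[of "L1 @ [b]"] by simp
  also have "pf A ((L1 @ [b]) @ a # K @ L2) = - pf A (L1 @ a # b # K @ L2)"
    using pf_swap[OF A, of L1 b a] by simp
  finally show ?case by simp
qed simp

lemma pf_swap_blocks:
  assumes A: "skew A"
  shows "pf A (L1 @ K @ K' @ L2) = (-1)^(length K * length K') * pf A (L1 @ K' @ K @ L2)"
proof (induction K' arbitrary: L1)
  case (Cons a K')
  have "pf A (L1 @ K @ (a # K') @ L2) = (-1)^length K * pf A ((L1 @ [a]) @ K @ K' @ L2)"
    using pf_move[OF A, of L1 K a] by simp
  then show ?case
    using Cons[of "L1 @ [a]"] by (simp add: power_add)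
qed simp

lemma pf_dup:
  assumes A: "skew A" and "\<not> distinct L"
  shows "pf A L = 0"
proof -
  obtain K1 a K2 K3 where L: "L = K1 @ [a] @ K2 @ [a] @ K3"
    using not_distinct_decomp[OF assms(2)] by blast
  have "pf A (K1 @ a # a # K2 @ K3) = 0"
    using pf_swap[OF A, of K1 a a "K2 @ K3"] by linarith
  then show ?thesis
    using pf_move[OF A, of "K1 @ [a]" K2 a K3] by (simp add: L)
qed

text \<open>Linearity in one row, the combination being expressed by further labels of the same
  kernel. There are three summands because elimination against a pivot pair adds multiples of two
  rows.\<close>

lemma pf_lin3:
  assumes A: "skew A"
    and "\<And>d. d \<in> set L1 \<union> set L2 \<Longrightarrow> A c d = A u d + \<beta> * A v d + \<gamma> * A w d"
  shows "pf A (L1 @ c # L2)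
    = pf A (L1 @ u # L2) + \<beta> * pf A (L1 @ v # L2) + \<gamma> * pf A (L1 @ w # L2)"
proof -
  have M: "pf A (L1 @ c # L2) = (-1)^length L1 * pf A (c # L1 @ L2)" for c
    using pf_move[OF A, of "[]" L1 c L2] by simp
  have "A c ((L1 @ L2) ! j) = A u ((L1 @ L2) ! j) + \<beta> * A v ((L1 @ L2) ! j) + \<gamma> * A w ((L1 @ L2) ! j)"
    if "j < length (L1 @ L2)" for j
    using that assms(2) nth_mem[OF that] by (metis set_append)
  then have "pf A (c # L1 @ L2)
    = pf A (u # L1 @ L2) + \<beta> * pf A (v # L1 @ L2) + \<gamma> * pf A (w # L1 @ L2)"
    by (simp add: pf.simps(2) sum_distrib_left sum.distrib[symmetric] del: nth_append length_append)
       (auto intro!: sum.cong simp: algebra_simps)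
  then show ?thesis by (simp only: M) (simp add: algebra_simps)
qed

text \<open>Schur complement of the block on \<open>p\<close> and \<open>q\<close>, with the inverse
  of that block written out: the pairing of \<open>c\<close> and \<open>d\<close> after both have
  been made orthogonal to \<open>p\<close> and \<open>q\<close>.\<close>

definition schur :: "('a \<Rightarrow> 'a \<Rightarrow> real) \<Rightarrow> 'a \<Rightarrow> 'a \<Rightarrow> 'a \<Rightarrow> 'a \<Rightarrow> real" where
  "schur A p q c d = A c d + (A c q * A d p - A c p * A d q) / A p q"

text \<open>In the proof \<open>Inr c\<close> stands for \<open>c\<close> made orthogonal to \<open>p\<close> and \<open>q\<close>.\<close>
lemma pf_schur:
  assumes A: "skew A" and w: "A p q \<noteq> 0"
  shows "pf A (p # q # L) = A p q * pf (schur A p q) L"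
proof -
  define A' where "A' = schur A p q"
  have A'_skew: "A' c d = - A' d c" for c d
    using skewD[OF A, of c d] by (simp add: A'_def schur_def diff_divide_distrib mult_ac)
  have pp: "A p p = 0" "A q q = 0" "A q p = - A p q"
    using skewD[OF A, of p p] skewD[OF A, of q q] skewD[OF A, of q p] by simp_all
  have A'p: "A' c p = 0" and A'q: "A' c q = 0" for c
    using w pp by (simp_all add: A'_def schur_def field_simps)
  have A'p': "A' p c = 0" and A'q': "A' q c = 0" for c
    using A'_skew[of p c] A'_skew[of q c] A'p A'q by simp_all
  \<comment> \<open>\<open>Inl\<close> labels the original rows. A mixed entry is again one of
    \<open>A'\<close>, since an orthogonalised row pairs with \<open>b\<close> exactly as it pairs
    with the orthogonalised \<open>b\<close>.\<close>
  define B where "B = case_sum (\<lambda>a. case_sum (\<lambda>b. A a b) (\<lambda>b. A' a b)) (\<lambda>a. case_sum (\<lambda>b. A' a b) (\<lambda>b. A' a b))"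
  have B: "skew B"
    unfolding skew_def
  proof (intro allI)
    fix u v show "B u v = - B v u"
      by (cases u; cases v) (simp_all add: B_def, (rule skewD[OF A] A'_skew)+)
  qed
  have rowp: "A' c d = A c d + (- A c q / A p q) * A p d + (A c p / A p q) * A q d" for c d
    using skewD[OF A, of p d] skewD[OF A, of q d]
    by (simp add: A'_def schur_def diff_divide_distrib)
  \<comment> \<open>Rows are exchanged one at a time; the multiples of the pivot rows that are added
    create repeated rows and so contribute 0.\<close>
  have step: "pf B (Inl p # Inl q # map Inr L1 @ map Inl L2) = pf B (Inl p # Inl q # map Inr (L1 @ L2))"
    for L1 L2
  proof (induction L2 arbitrary: L1)
    case (Cons c L2)
    let ?X = "Inl p # Inl q # map Inr L1"
    have "pf B (?X @ Inr c # map Inl L2) = pf B (?X @ Inl c # map Inl L2)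
       + (- A c q / A p q) * pf B (?X @ Inl p # map Inl L2) + (A c p / A p q) * pf B (?X @ Inl q # map Inl L2)"
    proof (rule pf_lin3[OF B])
      fix d
      show "B (Inr c) d = B (Inl c) d + (- A c q / A p q) * B (Inl p) d + (A c p / A p q) * B (Inl q) d"
      proof (cases d)
        case (Inl x)
        then show ?thesis by (simp add: B_def rowp)
      next
        case (Inr x)
        then show ?thesis by (simp add: B_def A'p' A'q')
      qed
    qed
    moreover have "pf B (?X @ Inl p # map Inl L2) = 0" "pf B (?X @ Inl q # map Inl L2) = 0"
      by (rule pf_dup[OF B]; simp)+
    ultimately show ?case using Cons[of "L1 @ [c]"] by simp
  qed simp
  have "pf A (p # q # L) = pf B (map Inl (p # q # L))"
    unfolding pf_map by (simp add: B_def)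
  also have "\<dots> = pf B (Inl p # Inl q # map Inr L)"
    using step[of "[]" L] by simp
  also have "\<dots> = A p q * pf B (map Inr L)"
    by (simp add: pf_expand2 B_def A'p')
  also have "pf B (map Inr L) = pf A' L"
    unfolding pf_map by (simp add: B_def)
  finally show ?thesis by (simp add: A'_def)
qed

text \<open>The coefficients of \<open>cof2\<close> with both positions counted in the full list.
  They form the Pfaffian analogue of the adjugate matrix, see \<open>cof_rel\<close>.\<close>

definition cof :: "('a \<Rightarrow> 'a \<Rightarrow> real) \<Rightarrow> 'a list \<Rightarrow> nat \<Rightarrow> nat \<Rightarrow> real" where
  "cof A L j k = (if k < j then cof2 A L j k else if j < k then cof2 A L j (k - 1) else 0)"

lemma cof_skew:
  assumes "j < length L" "k < length L"
  shows "cof A L j k = - cof A L k j"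
proof -
  have *: "cof A L j k = - cof A L k j" if "k < j" "j < length L" for j k
  proof -
    have "del (j - 1) (del k L) = del k (del j L)"
      using del_del[of k "j - 1" L] that by simp
    moreover have "(-1::real) ^ (j + k) = - ((-1) ^ (k + (j - 1)))"
      using that by (cases j) (simp_all add: add.commute)
    ultimately show ?thesis using that by (simp add: cof_def cof2_def)
  qed
  show ?thesis
    using *[of k j] *[of j k] assms by (cases j k rule: linorder_cases) (simp_all add: cof_def)
qed

lemma pf_expand_cof:
  "pf A (p # q # L) = A p q * pf A L
     + (\<Sum>j<length L. \<Sum>k<length L. A p (L ! j) * A q (L ! k) * cof A L j k)"
proof -
  have "(\<Sum>k<length L - 1. A p (L ! j) * A q (del j L ! k) * cof2 A L j k)
    = (\<Sum>k<length L. A p (L ! j) * A q (L ! k) * cof A L j k)" if "j < length L" for j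
  proof -
    have "(\<Sum>k<length L. A p (L ! j) * A q (L ! k) * cof A L j k)
      = (\<Sum>k\<in>{..<length L} - {j}. A p (L ! j) * A q (L ! k) * cof A L j k)"
      by (rule sum.mono_neutral_right) (auto simp: cof_def)
    also have "\<dots> = (\<Sum>k<length L - 1. A p (L ! j) * A q (del j L ! k) * cof2 A L j k)"
      by (rule sum.reindex_bij_witness[where i="\<lambda>k. if k < j then k else Suc k"
            and j="\<lambda>k. if k < j then k else k - 1"])
         (use that in \<open>auto simp: cof_def nth_del split: if_splits\<close>)
    finally show ?thesis by simp
  qed
  then show ?thesis unfolding pf_expand2 by simp
qed

lemma cof_map: "j < length L \<Longrightarrow> k < length L \<Longrightarrow> cof A (map f L) j k = cof (\<lambda>a b. A (f a) (f b)) L j k"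
  by (auto simp: cof_def cof2_def map_del[symmetric] pf_map)

lemma cof_cong:
  assumes "\<And>a b. a \<in> set L \<Longrightarrow> b \<in> set L \<Longrightarrow> A a b = B a b"
  shows "cof A L j k = cof B L j k"
proof -
  have "pf A (del k (del j L)) = pf B (del k (del j L))" for j k
    by (rule pf_cong) (use assms set_del in \<open>blast dest: subsetD[OF set_del]\<close>)
  then show ?thesis by (simp add: cof_def cof2_def)
qed

text \<open>Bordering with a copy of row \<open>i\<close> and a unit row gives a Pfaffian with a repeated row, which vanishes.\<close>
lemma cof_rel:
  assumes A: "skew A" and i: "i < length L" and b: "b < length L"
  shows "(\<Sum>c<length L. A (L ! i) (L ! c) * cof A L c b) = (if i = b then pf A L else 0)"
proof -
  define n where "n = length L"
  \<comment> \<open>The matrix lives on positions, so that \<open>L\<close> may repeat labels, and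
    \<open>n\<close> is a fresh index for the unit row, whose only nonzero entry is in column
    \<open>b\<close>.\<close>
  define B :: "nat \<Rightarrow> nat \<Rightarrow> real" where
    "B u v = (if u < n \<and> v < n then A (L ! u) (L ! v)
       else if u = n \<and> v = b then 1 else if u = b \<and> v = n then - 1 else 0)" for u v
  have B: "skew B"
    unfolding skew_def
  proof (intro allI)
    fix u v show "B u v = - B v u"
      using b skewD[OF A, of "L ! u" "L ! v"] by (auto simp: n_def B_def)
  qed
  have L: "L = map ((!) L) [0..<n]" by (simp add: n_def map_nth)
  have pfB: "pf B [0..<n] = pf A L"
  proof -
    have "pf A L = pf (\<lambda>a b. A (L ! a) (L ! b)) [0..<n]"
      using pf_map[of A "(!) L" "[0..<n]"] L by simp
    also have "\<dots> = pf B [0..<n]" by (rule pf_cong) (auto simp: B_def)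
    finally show ?thesis ..
  qed
  have cofB: "cof B [0..<n] c d = cof A L c d" if "c < n" "d < n" for c d
  proof -
    have "cof A L c d = cof (\<lambda>a b. A (L ! a) (L ! b)) [0..<n] c d"
      using cof_map[of c "[0..<n]" d A "(!) L"] L that by simp
    also have "\<dots> = cof B [0..<n] c d" by (rule cof_cong) (auto simp: B_def)
    finally show ?thesis ..
  qed
  have "0 = pf B (i # n # [0..<n])"
    by (rule pf_dup[OF B, symmetric]) (use i in \<open>auto simp: n_def\<close>)
  also have "\<dots> = B i n * pf B [0..<n] + (\<Sum>c<n. \<Sum>d<n. B i c * B n d * cof B [0..<n] c d)"
    by (simp add: pf_expand_cof)
  also have "(\<Sum>c<n. \<Sum>d<n. B i c * B n d * cof B [0..<n] c d) = (\<Sum>c<n. A (L ! i) (L ! c) * cof A L c b)"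
  proof (intro sum.cong refl)
    fix c assume c: "c \<in> {..<n}"
    have "(\<Sum>d<n. B i c * B n d * cof B [0..<n] c d) = (\<Sum>d<n. if d = b then B i c * cof B [0..<n] c b else 0)"
      by (rule sum.cong) (auto simp: B_def)
    then show "(\<Sum>d<n. B i c * B n d * cof B [0..<n] c d) = A (L ! i) (L ! c) * cof A L c b"
      using b c i by (simp add: n_def[symmetric] cofB) (simp add: B_def n_def)
  qed
  finally have "(\<Sum>c<n. A (L ! i) (L ! c) * cof A L c b) = - (B i n * pf A L)"
    by (simp add: pfB)
  moreover have "B i n = (if i = b then - 1 else 0)"
    using i by (simp add: B_def n_def)
  ultimately show ?thesis by (simp add: n_def)
qed

text \<open>Where \<open>A\<close> is nonzero, the mask \<open>P c \<and> Q b\<close> is the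
  indicator of \<open>Q b\<close> minus that of \<open>\<not> P c\<close>. Each indicator fixes one
  index, and summing out the other by \<open>cof_rel\<close> gives the Pfaffian up to sign, so only
  two cardinalities remain.\<close>

lemma sum_restricted_cof:
  assumes A: "skew A"
    and Z: "\<And>c b. c < length L \<Longrightarrow> b < length L \<Longrightarrow> \<not> P c \<Longrightarrow> \<not> Q b \<Longrightarrow> A (L ! c) (L ! b) = 0"
  shows "(\<Sum>c<length L. \<Sum>b<length L. (if P c \<and> Q b then - A (L ! c) (L ! b) else 0) * cof A L c b)
    = (real (card {b. b < length L \<and> Q b}) - real (card {c. c < length L \<and> \<not> P c})) * pf A L"
proof -
  define n where "n = length L"
  define g where "g c b = A (L ! c) (L ! b) * cof A L c b" for c b
  have g_col: "(\<Sum>c<n. g c b) = - pf A L" if "b < n" for b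
  proof -
    have "(\<Sum>c<n. g c b) = - (\<Sum>c<n. A (L ! b) (L ! c) * cof A L c b)"
      unfolding g_def sum_negf[symmetric] by (intro sum.cong refl) (metis skewD[OF A] mult_minus_left)
    then show ?thesis using cof_rel[OF A, of b L b] that by (simp add: n_def)
  qed
  have g_sym: "g c b = g b c" if "c < n" "b < n" for c b
    unfolding g_def using cof_skew[of c L b A] skewD[OF A, of "L ! c" "L ! b"] that by (simp add: n_def)
  have "(\<Sum>c<n. \<Sum>b<n. (if P c \<and> Q b then - A (L ! c) (L ! b) else 0) * cof A L c b)
    = (\<Sum>c<n. \<Sum>b<n. (if \<not> P c then g c b else 0) - (if Q b then g c b else 0))"
    by (intro sum.cong refl) (use Z in \<open>auto simp: g_def n_def\<close>)
  also have "\<dots> = (\<Sum>c<n. \<Sum>b<n. if \<not> P c then g c b else 0) - (\<Sum>b<n. \<Sum>c<n. if Q b then g c b else 0)"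
    by (simp only: sum_subtractf) (subst (2) sum.swap, rule refl)
  also have "(\<Sum>c<n. \<Sum>b<n. if \<not> P c then g c b else 0) = (\<Sum>c<n. if \<not> P c then - pf A L else 0)"
  proof (intro sum.cong refl)
    fix c assume c: "c \<in> {..<n}"
    have "(\<Sum>b<n. g c b) = (\<Sum>b<n. g b c)"
      by (rule sum.cong) (use c g_sym in auto)
    then show "(\<Sum>b<n. if \<not> P c then g c b else 0) = (if \<not> P c then - pf A L else 0)"
      using g_col[of c] c by simp
  qed
  also have "(\<Sum>b<n. \<Sum>c<n. if Q b then g c b else 0) = (\<Sum>b<n. if Q b then - pf A L else 0)"
    by (intro sum.cong refl) (simp add: g_col)
  also have "(\<Sum>c<n. if \<not> P c then - pf A L else 0) = real (card {c. c < n \<and> \<not> P c}) * (- pf A L)"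
    by (simp add: sum.If_cases lessThan_def Collect_conj_eq Int_commute)
  also have "(\<Sum>b<n. if Q b then - pf A L else 0) = real (card {c. c < n \<and> Q c}) * (- pf A L)"
    by (simp add: sum.If_cases lessThan_def Collect_conj_eq Int_commute)
  finally show ?thesis by (simp add: n_def algebra_simps)
qed

section \<open>Determinants\<close>

text \<open>The minors keep the last column in the place of the deleted one, so no position-dependent sign occurs.\<close>
lemma ldet_Suc:
  "ldet (Suc n) A = A (Suc n) (Suc n) * ldet n A
     - (\<Sum>j = 1..n. A (Suc n) j * ldet n (\<lambda>i k. if k = j then A i (Suc n) else A i k))"
proof -
  define f where "f p = real_of_int (sign p) * (\<Prod>i = 1..Suc n. A i (p i))" for p
  have ins: "{1..Suc n} = insert (Suc n) {1..n}" by auto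
  have *: "(\<Sum>q | q permutes {1..n}. f (swp (Suc n) b \<circ> q))
     = (if b = Suc n then A (Suc n) (Suc n) * ldet n A
    else - (A (Suc n) b * ldet n (\<lambda>i k. if k = b then A i (Suc n) else A i k)))"
    if b: "b \<in> insert (Suc n) {1..n}" for b
  proof -
    have "f (swp (Suc n) b \<circ> q)
      = (if b = Suc n then 1 else - 1) * A (Suc n) b *
      (of_int (sign q) * (\<Prod>i = 1..n. (\<lambda>i k. if k = b then A i (Suc n) else A i k) i (q i)))"
      if q: "q permutes {1..n}" for q
    proof -
      have "permutation q" using q permutation_permutes by blast
      then have 1: "sign (swp (Suc n) b \<circ> q) = (if b = Suc n then 1 else - 1) * sign q"
        by (subst sign_compose) (auto simp: sign_swap_id permutation_swap_id)
      have qn: "q (Suc n) = Suc n" using q by (auto simp: permutes_def)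
      have "(\<Prod>i = 1..n. A i ((swp (Suc n) b \<circ> q) i))
        = (\<Prod>i = 1..n. (\<lambda>i k. if k = b then A i (Suc n) else A i k) i (q i))"
      proof (intro prod.cong refl)
        fix i assume "i \<in> {1..n}"
        then have "q i \<in> {1..n}" using permutes_in_image[OF q] by blast
        then have "q i \<noteq> Suc n" by auto
        then show "A i ((swp (Suc n) b \<circ> q) i) = (\<lambda>i k. if k = b then A i (Suc n) else A i k) i (q i)"
          by (auto simp: Transposition.transpose_def)
      qed
      then show ?thesis unfolding f_def 1 ins by (simp add: qn)
    qed
    then have "(\<Sum>q | q permutes {1..n}. f (swp (Suc n) b \<circ> q))
       = (if b = Suc n then 1 else - 1) * A (Suc n) b * ldet n (\<lambda>i k. if k = b then A i (Suc n) else A i k)"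
      unfolding ldet_def by (simp add: sum_distrib_left)
    also have "ldet n (\<lambda>i k. if k = b then A i (Suc n) else A i k) = ldet n A" if "b = Suc n"
      unfolding ldet_def using that
      by (intro sum.cong refl arg_cong2[of _ _ _ _ "(*)"] prod.cong) auto
    ultimately show ?thesis by auto
  qed
  have "ldet (Suc n) A = (\<Sum>p | p permutes {1..Suc n}. f p)"
    by (simp add: ldet_def f_def)
  also have "\<dots> = (\<Sum>b\<in>insert (Suc n) {1..n}. \<Sum>q | q permutes {1..n}. f (swp (Suc n) b \<circ> q))"
    unfolding ins by (rule sum_over_permutations_insert) auto
  also have "\<dots> = (\<Sum>b\<in>insert (Suc n) {1..n}. if b = Suc n then A (Suc n) (Suc n) * ldet n A
    else - (A (Suc n) b * ldet n (\<lambda>i k. if k = b then A i (Suc n) else A i k)))"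
    by (rule sum.cong[OF refl *])
  also have "\<dots> = A (Suc n) (Suc n) * ldet n A
     + (\<Sum>b = 1..n. - (A (Suc n) b * ldet n (\<lambda>i k. if k = b then A i (Suc n) else A i k)))"
    by (subst sum.insert) (auto intro!: sum.cong)
  finally show ?thesis by (simp add: sum_negf)
qed

lemma ldet_0[simp]: "ldet 0 A = 1"
  by (simp add: ldet_def)

lemma ldet_cong:
  assumes "\<And>i j. i \<in> {1..n} \<Longrightarrow> j \<in> {1..n} \<Longrightarrow> A i j = B i j"
  shows "ldet n A = ldet n B"
  unfolding ldet_def
proof (intro sum.cong refl arg_cong2[of _ _ _ _ "(*)"] prod.cong)
  fix p i assume "p \<in> {p. p permutes {1..n}}" "i \<in> {1..n}"
  then show "A i (p i) = B i (p i)"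
    using permutes_in_image[of p "{1..n}" i] assms by blast
qed

lemma ldet_dup_row:
  assumes rs: "r \<in> {1..n}" "s \<in> {1..n}" "r \<noteq> s" and eq: "\<And>j. A r j = A s j"
  shows "ldet n A = 0"
proof -
  let ?t = "swp r s"
  have t: "?t permutes {1..n}" using rs by (simp add: permutes_swap_id)
  have "ldet n A = (\<Sum>p | p permutes {1..n}. of_int (sign (p \<circ> ?t)) * (\<Prod>i = 1..n. A i ((p \<circ> ?t) i)))"
    unfolding ldet_def by (rule sum_permutations_compose_right[OF t])
  also have "\<dots> = (\<Sum>p | p permutes {1..n}. - (of_int (sign p) * (\<Prod>i = 1..n. A i (p i))))"
  proof (intro sum.cong refl)
    fix p assume "p \<in> {p. p permutes {1..n}}"
    then have "permutation p" using permutation_permutes by blast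
    then have 1: "sign (p \<circ> ?t) = - sign p"
      by (subst sign_compose) (use rs in \<open>auto simp: sign_swap_id permutation_swap_id\<close>)
    have "(\<Prod>i = 1..n. A i ((p \<circ> ?t) i)) = (\<Prod>i = 1..n. A (?t i) (p (?t i)))"
      by (rule prod.cong) (auto simp: Transposition.transpose_def eq)
    also have "\<dots> = (\<Prod>i = 1..n. A i (p i))"
      using prod.permute[OF t, of "\<lambda>i. A i (p i)"] by (simp add: o_def)
    finally show "of_int (sign (p \<circ> ?t)) * (\<Prod>i = 1..n. A i ((p \<circ> ?t) i))
      = - (of_int (sign p) * (\<Prod>i = 1..n. A i (p i)))"
      by (simp add: 1)
  qed
  also have "\<dots> = - ldet n A" by (simp add: ldet_def sum_negf)
  finally show ?thesis by linarith
qed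

lemma hN_Suc: "hN (Suc n) x = hN n x * (\<Prod>i = 1..n. x (Suc n) - x i)"
proof -
  have "hN (Suc n) x = (\<Prod>i = 1..n. \<Prod>j\<in>{i<..Suc n}. x j - x i)"
    by (simp add: hN_def)
  also have "\<dots> = (\<Prod>i = 1..n. (\<Prod>j\<in>{i<..n}. x j - x i) * (x (Suc n) - x i))"
  proof (intro prod.cong refl)
    fix i assume "i \<in> {1..n}"
    then have "{i<..Suc n} = insert (Suc n) {i<..n}" by auto
    then show "(\<Prod>j\<in>{i<..Suc n}. x j - x i) = (\<Prod>j\<in>{i<..n}. x j - x i) * (x (Suc n) - x i)"
      by simp
  qed
  finally show ?thesis by (simp add: hN_def prod.distrib)
qed

text \<open>As a function \<open>P\<close> of the last point, the determinant is a polynomial with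
  top coefficient \<open>hN n x\<close> in degree n that vanishes at the n earlier points. If these
  are distinct, this determines it; if not, both sides are 0.\<close>

lemma ldet_monic_polys:
  fixes q :: "nat \<Rightarrow> real poly"
  assumes deg: "\<And>k. degree (q k) = k" and monic: "\<And>k. coeff (q k) k = 1"
  shows "ldet n (\<lambda>i j. poly (q (j - 1)) (x i)) = hN n x"
proof (induction n arbitrary: x)
  case 0
  then show ?case by (simp add: hN_def)
next
  case (Suc n)
  define c where "c j = ldet n (\<lambda>i k. if k = j then poly (q n) (x i) else poly (q (k - 1)) (x i))" for j
  define P where "P = smult (hN n x) (q n) - (\<Sum>j = 1..n. smult (c j) (q (j - 1)))"
  have det: "ldet (Suc n) (\<lambda>i j. poly (q (j - 1)) (if i = Suc n then z else x i)) = poly P z" for z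
  proof -
    have "ldet n (\<lambda>i j. poly (q (j - 1)) (if i = Suc n then z else x i)) = hN n x"
      unfolding Suc[symmetric] by (rule ldet_cong) auto
    moreover have "ldet n (\<lambda>i k. if k = j then poly (q (Suc n - 1)) (if i = Suc n then z else x i)
       else poly (q (k - 1)) (if i = Suc n then z else x i)) = c j" for j
      unfolding c_def by (rule ldet_cong) auto
    ultimately show ?thesis
      unfolding ldet_Suc by (simp add: P_def poly_sum mult_ac)
  qed
  have root: "poly P (x i) = 0" if "i \<in> {1..n}" for i
    unfolding det[symmetric] by (rule ldet_dup_row[of i _ "Suc n"]) (use that in auto)
  have detS: "ldet (Suc n) (\<lambda>i j. poly (q (j - 1)) (x i)) = poly P (x (Suc n))"
    unfolding det[symmetric] by (rule ldet_cong) auto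
  show ?case
  proof (cases "inj_on x {1..n}")
    case False
    then obtain i k where ik: "i \<in> {1..n}" "k \<in> {1..n}" "i < k" "x i = x k"
      unfolding inj_on_def by (metis linorder_neqE_nat)
    have "ldet (Suc n) (\<lambda>i j. poly (q (j - 1)) (x i)) = 0"
      by (rule ldet_dup_row[of i _ k]) (use ik in auto)
    moreover have "hN n x = 0"
      using ik unfolding hN_def by (intro prod_zero bexI[of _ i] prod_zero bexI[of _ k]) auto
    ultimately show ?thesis by (simp add: hN_Suc)
  next
    case True
    define V where "V = (\<Prod>i = 1..n. [:- x i, 1:])"
    have V: "degree V = n" "coeff V n = 1"
    proof -
      show "degree V = n" unfolding V_def by (subst degree_prod_eq_sum_degree) auto
      moreover have "lead_coeff V = 1" unfolding V_def by (simp add: lead_coeff_prod)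
      ultimately show "coeff V n = 1" by simp
    qed
    \<comment> \<open>The top coefficients cancel, so a nonzero \<open>D\<close> would have degree
      below n but n distinct roots.\<close>
    define D where "D = P - smult (hN n x) V"
    have cD: "coeff D k = 0" if "n \<le> k" for k
    proof -
      have "coeff (q (j - 1)) k = 0" if "j \<in> {1..n}" for j
        using that \<open>n \<le> k\<close> by (intro coeff_eq_0) (auto simp: deg)
      moreover have "coeff (q n) k = coeff V k"
        using \<open>n \<le> k\<close> V deg monic by (cases "k = n") (auto intro!: coeff_eq_0 simp: coeff_eq_0)
      ultimately show ?thesis by (simp add: D_def P_def coeff_sum)
    qed
    have Droot: "poly D (x i) = 0" if "i \<in> {1..n}" for i
      using root[OF that] that by (auto simp: D_def V_def poly_prod)
    have "D = 0"
    proof (rule ccontr)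
      assume "D \<noteq> 0"
      then have "degree D < n"
        using cD by (metis leading_coeff_0_iff not_le)
      moreover have "card (x ` {1..n}) \<le> card {z. poly D z = 0}"
        using \<open>D \<noteq> 0\<close> Droot by (intro card_mono poly_roots_finite) auto
      moreover have "card {z. poly D z = 0} \<le> degree D"
        using \<open>D \<noteq> 0\<close> by (rule card_poly_roots_bound)
      ultimately show False using True by (simp add: card_image)
    qed
    then have "poly P (x (Suc n)) = hN n x * poly V (x (Suc n))"
      by (simp add: D_def)
    then show ?thesis unfolding detS hN_Suc by (simp add: V_def poly_prod)
  qed
qed

lemma ldet_transpose: "ldet n (\<lambda>i j. A j i) = ldet n A"
proof -
  have "ldet n (\<lambda>i j. A j i) = (\<Sum>p | p permutes {1..n}. of_int (sign (inv p)) * (\<Prod>i = 1..n. A (inv p i) i))"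
    unfolding ldet_def
    by (rule sum.reindex_bij_witness[where i=inv and j=inv])
       (auto simp: permutes_inv permutes_inv_inv sign_inverse permutation_permutes intro: exI[of _ "{1..n}"])
  also have "\<dots> = (\<Sum>p | p permutes {1..n}. of_int (sign p) * (\<Prod>i = 1..n. A i (p i)))"
  proof (intro sum.cong refl)
    fix p assume "p \<in> {p. p permutes {1..n}}"
    then have p: "p permutes {1..n}" by simp
    then have "permutation p" using permutation_permutes by blast
    moreover have "(\<Prod>i = 1..n. A (inv p i) i) = (\<Prod>i = 1..n. A i (p i))"
      using prod.permute[OF p, of "\<lambda>i. A (inv p i) i"] by (simp add: o_def permutes_inverses(2)[OF p])
    ultimately show "of_int (sign (inv p)) * (\<Prod>i = 1..n. A (inv p i) i)
      = of_int (sign p) * (\<Prod>i = 1..n. A i (p i))"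
      by (simp add: sign_inverse)
  qed
  finally show ?thesis by (simp add: ldet_def)
qed

lemma ldet_scale_rows: "ldet n (\<lambda>i j. A i j * c i) = ldet n A * (\<Prod>i = 1..n. c i)"
  by (simp add: ldet_def prod.distrib sum_distrib_right mult.assoc)

section \<open>Explicit Pfaffians: signs, borders, block triangular shape\<close>

lemma pf_scale: "even (length L) \<Longrightarrow> pf (\<lambda>a b. c * A a b) L = c ^ (length L div 2) * pf A L"
proof (induction L rule: length_induct_list)
  case (1 L)
  show ?case
  proof (cases L)
    case (Cons a L')
    have "pf (\<lambda>a b. c * A a b) (del j L') = c ^ (length L' div 2) * pf A (del j L')" if "j < length L'" for j
    proof -
      have "length (del j L') div 2 = length L' div 2"
        using that 1(2) by (auto simp: length_del Cons elim!: oddE)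
      then show ?thesis using 1(1)[of "del j L'"] that 1(2) by (simp add: length_del Cons)
    qed
    moreover have "length L div 2 = Suc (length L' div 2)"
      using 1(2) by (auto simp: Cons elim!: oddE)
    ultimately show ?thesis
      by (simp add: Cons pf.simps(2) sum_distrib_left mult_ac)
  qed simp
qed

text \<open>The row expansion is an alternating sum of an odd number of ones.\<close>

lemma pf_ones:
  assumes "sorted_wrt (\<lambda>a b. A a b = 1) L" "even (length L)"
  shows "pf A L = 1"
  using assms
proof (induction L rule: length_induct_list)
  case (1 L)
  show ?case
  proof (cases L)
    case (Cons a L')
    have "A a (L' ! j) * pf A (del j L') = 1" if "j < length L'" for j
    proof -
      have "sorted_wrt (\<lambda>a b. A a b = 1) (take j L' @ drop j L')"
        using 1(2) by (simp add: Cons)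
      then have "sorted_wrt (\<lambda>a b. A a b = 1) (del j L')"
        using Cons_nth_drop_Suc[OF that, symmetric]
        by (simp add: del_def sorted_wrt_append)
      then have "pf A (del j L') = 1"
        using 1(3) that by (intro 1(1)) (auto simp: Cons length_del)
      then show ?thesis using 1(2) that by (simp add: Cons)
    qed
    then have "pf A L = (\<Sum>j<length L'. (-1)^j)"
      by (simp add: Cons pf.simps(2) mult.assoc)
    moreover have "(\<Sum>j<Suc (2 * m). (-1::real)^j) = 1" for m
      by (induction m) simp_all
    moreover obtain m where "length L' = Suc (2 * m)"
      using 1(3) by (auto simp: Cons elim!: oddE)
    ultimately show ?thesis by metis
  qed simp
qed

text \<open>Insertion sort read backwards: adjacent exchanges lead from the sorted list to any
  list.\<close>

lemma sort_induct:
  assumes sorted: "\<And>L :: 'a :: linorder list. sorted L \<Longrightarrow> P L"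
    and swap: "\<And>K a b L. P (K @ a # b # L) \<Longrightarrow> P (K @ b # a # L)"
  shows "P L"
proof -
  have ins: "P (K @ insort a M) \<Longrightarrow> P (K @ a # M)" for K a M
  proof (induction M arbitrary: K)
    case (Cons b M)
    then show ?case using Cons.IH[of "K @ [b]"] swap[of K b a M] by (auto split: if_splits)
  qed simp
  have "P (K @ sort L) \<Longrightarrow> P (K @ L)" for K L
  proof (induction L arbitrary: K)
    case (Cons a L)
    then show ?case using Cons.IH[of "K @ [a]"] ins[of K a "sort L"] by simp
  qed simp
  from this[of "[]" L] show ?thesis using sorted by simp
qed

text \<open>Sign of the Vandermonde product of the listed values, compare \<open>lsgn_hN\<close>; it
  is 0 as soon as a value repeats.\<close>

fun lsgn :: "real list \<Rightarrow> real" where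
  "lsgn [] = 1"
| "lsgn (a # L) = (\<Prod>b\<leftarrow>L. sgn (b - a)) * lsgn L"

lemma lsgn_swap: "lsgn (K @ a # b # L) = - lsgn (K @ b # a # L)"
proof (induction K)
  case Nil
  have "sgn (b - a) = - sgn (a - b)" by (metis minus_diff_eq sgn_minus)
  then show ?case by simp
qed simp

lemma lsgn_snoc: "lsgn (L @ [a]) = lsgn L * (\<Prod>b\<leftarrow>L. sgn (a - b))"
  by (induction L) auto

lemma lsgn_hN: "lsgn (map x [1..<Suc n]) = sgn (hN n x)"
proof (induction n)
  case 0
  then show ?case by (simp add: hN_def)
next
  case (Suc n)
  have "(\<Prod>b\<leftarrow>map x [1..<Suc n]. sgn (x (Suc n) - b)) = (\<Prod>i = 1..n. sgn (x (Suc n) - x i))"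
    by (simp add: prod.distinct_set_conv_list[symmetric] atLeastLessThanSuc_atLeastAtMost o_def del: upt_Suc)
  moreover have "(\<Prod>i = 1..m. sgn (x (Suc n) - x i)) = sgn (\<Prod>i = 1..m. x (Suc n) - x i)" for m
    by (induction m) (simp_all add: sgn_mult)
  ultimately show ?case
    using Suc lsgn_snoc[of "map x [1..<Suc n]" "x (Suc n)"]
    by (simp add: hN_Suc sgn_mult)
qed

text \<open>Both sides change sign under adjacent exchanges and vanish when a value repeats; on a
  strictly increasing list all entries are 1.\<close>

lemma pf_sgn:
  assumes "even (length L)"
  shows "pf (\<lambda>a b. sgn (b - a)) L = lsgn L"
proof -
  define A where "A a b = sgn (b - a)" for a b :: real
  have A: "skew A" unfolding skew_def A_def by (metis minus_diff_eq sgn_minus)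
  have "even (length L) \<longrightarrow> pf A L = lsgn L"
  proof (rule sort_induct[where P="\<lambda>L. even (length L) \<longrightarrow> pf A L = lsgn L"])
    fix L :: "real list" assume L: "sorted L"
    show "even (length L) \<longrightarrow> pf A L = lsgn L"
    proof (cases "distinct L")
      case True
      with L have s: "sorted_wrt (<) L" by (simp add: strict_sorted_iff)
      have "lsgn L = 1" using s
      proof (induction L)
        case (Cons a L)
        have "\<forall>b\<in>set L. a < b \<Longrightarrow> (\<Prod>b\<leftarrow>L. sgn (b - a)) = 1"
          by (induction L) auto
        then show ?case using Cons by simp
      qed simp
      moreover have "sorted_wrt (\<lambda>a b. A a b = 1) L"
        by (rule sorted_wrt_mono_rel[OF _ s]) (auto simp: A_def)
      then have "even (length L) \<longrightarrow> pf A L = 1"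
        using pf_ones by blast
      ultimately show ?thesis by simp
    next
      case False
      then obtain K1 a K2 K3 where L: "L = K1 @ [a] @ K2 @ [a] @ K3"
        using not_distinct_decomp by blast
      have "lsgn (K1 @ a # K2 @ a # K3) = 0"
        by (induction K1) auto
      then show ?thesis using pf_dup[OF A False] L by simp
    qed
  next
    fix K L and a b :: real
    assume *: "even (length (K @ a # b # L)) \<longrightarrow> pf A (K @ a # b # L) = lsgn (K @ a # b # L)"
    show "even (length (K @ b # a # L)) \<longrightarrow> pf A (K @ b # a # L) = lsgn (K @ b # a # L)"
      using * pf_swap[OF A, of K a b L] lsgn_swap[of K a b L] by (simp del: lsgn.simps)
  qed
  moreover have "(\<lambda>a b. sgn (b - a)) = A"
    by (intro ext) (simp add: A_def)
  ultimately show ?thesis using assms by simp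
qed

text \<open>Pairs of borders are eliminated one after another by \<open>pf_schur\<close>. As they
  are mutually orthogonal, eliminating one pair leaves the columns of the others unchanged, so the
  corrections simply add up.\<close>

lemma pf_borders:
  fixes p q :: "nat \<Rightarrow> 'a"
  assumes "skew A" and "\<And>k. k < n \<Longrightarrow> A (p k) (q k) \<noteq> 0"
    and "\<And>j k. j < n \<Longrightarrow> k < n \<Longrightarrow> A (p j) (p k) = 0"
    and "\<And>j k. j < n \<Longrightarrow> k < n \<Longrightarrow> A (q j) (q k) = 0"
    and "\<And>j k. j < n \<Longrightarrow> k < n \<Longrightarrow> j \<noteq> k \<Longrightarrow> A (p j) (q k) = 0"
  shows "pf A (concat (map (\<lambda>k. [p k, q k]) [0..<n]) @ L)
    = (\<Prod>k<n. A (p k) (q k))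
    * pf (\<lambda>c d. A c d + (\<Sum>k<n. (A c (q k) * A d (p k) - A c (p k) * A d (q k)) / A (p k) (q k))) L"
  using assms
proof (induction n arbitrary: A L)
  case (Suc n)
  note skewA = skewD[OF Suc.prems(1)]
  define A1 where "A1 = schur A (p n) (q n)"
  have qp: "A (q j) (p k) = 0" if "j < Suc n" "k < Suc n" "j \<noteq> k" for j k
    using skewA[of "q j" "p k"] Suc.prems(5)[of k j] that by simp
  have A1: "skew A1"
    unfolding skew_def
  proof (intro allI)
    fix c d show "A1 c d = - A1 d c"
      using skewA[of c d] by (simp add: A1_def schur_def diff_divide_distrib mult_ac)
  qed
  have A1p: "A1 c (p k) = A c (p k)" "A1 c (q k) = A c (q k)" if "k < n" for c k
    using that Suc.prems(3,4,5) qp by (simp_all add: A1_def schur_def)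
  have "pf A (concat (map (\<lambda>k. [p k, q k]) [0..<Suc n]) @ L)
    = pf A ([p n, q n] @ concat (map (\<lambda>k. [p k, q k]) [0..<n]) @ L)"
    using pf_swap_blocks[OF Suc.prems(1), of "[]" "concat (map (\<lambda>k. [p k, q k]) [0..<n])" "[p n, q n]" L]
    by simp
  also have "\<dots> = A (p n) (q n) * pf A1 (concat (map (\<lambda>k. [p k, q k]) [0..<n]) @ L)"
    using pf_schur[OF Suc.prems(1), of "p n" "q n"] Suc.prems(2)[of n] by (simp add: A1_def)
  also have "pf A1 (concat (map (\<lambda>k. [p k, q k]) [0..<n]) @ L) = (\<Prod>k<n. A1 (p k) (q k))
    * pf (\<lambda>c d. A1 c d + (\<Sum>k<n. (A1 c (q k) * A1 d (p k) - A1 c (p k) * A1 d (q k)) / A1 (p k) (q k))) L"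
    by (rule Suc.IH[OF A1]) (use Suc.prems in \<open>simp_all add: A1p\<close>)
  also have "(\<lambda>c d. A1 c d + (\<Sum>k<n. (A1 c (q k) * A1 d (p k) - A1 c (p k) * A1 d (q k)) / A1 (p k) (q k)))
    = (\<lambda>c d. A c d + (\<Sum>k<Suc n. (A c (q k) * A d (p k) - A c (p k) * A d (q k)) / A (p k) (q k)))"
    by (intro ext) (simp add: A1p, simp add: A1_def schur_def)
  also have "(\<Prod>k<n. A1 (p k) (q k)) = (\<Prod>k<n. A (p k) (q k))"
    by (simp add: A1p)
  finally show ?case by (simp add: mult_ac)
qed simp

text \<open>A row \<open>dn x\<close> meets nonzero entries only in \<open>W\<close>. Expanding the
  last such row removes one entry of \<open>W\<close> together with that row, which is the recursion
  of \<open>ldet_Suc\<close>; the rows \<open>up x\<close> are left behind and play the part of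
  \<open>W\<close> for the next block.\<close>

lemma pf_triangular:
  fixes up dn :: "'b \<Rightarrow> 'a"
  assumes A: "skew A" and len: "length W = length xs"
    and dd: "\<And>x y. x \<in> set xs \<Longrightarrow> y \<in> set xs \<Longrightarrow> A (dn x) (dn y) = 0"
    and du: "\<And>x y. x \<in> set xs \<Longrightarrow> y \<in> set xs \<Longrightarrow> A (dn x) (up y) = 0"
    and dL: "\<And>x d. x \<in> set xs \<Longrightarrow> d \<in> set L \<Longrightarrow> A (dn x) d = 0"
  shows "pf A (W @ concat (map (\<lambda>x. [up x, dn x]) xs) @ L)
    = ldet (length xs) (\<lambda>i j. A (dn (xs ! (i - 1))) (W ! (j - 1))) * pf A (map up xs @ L)"
  using len dd du dL
proof (induction xs arbitrary: W L rule: rev_induct)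
  case (snoc x xs)
  define n where "n = length xs"
  define prs where "prs = concat (map (\<lambda>x. [up x, dn x]) xs)"
  have lprs: "length prs = 2 * n" by (simp add: prs_def n_def length_concat o_def sum_list_triv)
  obtain V w where W: "W = V @ [w]" and V: "length V = n"
    using snoc.prems(1) by (cases W rule: rev_cases) (auto simp: n_def)
  define D where "D V = ldet n (\<lambda>i j. A (dn (xs ! (i - 1))) (V ! (j - 1)))" for V
  define R where "R = pf A (map up (xs @ [x]) @ L)"
  have IH: "pf A (V @ prs @ up x # L) = D V * R" if "length V = n" for V
  proof -
    have "pf A (V @ concat (map (\<lambda>x. [up x, dn x]) xs) @ (up x # L))
      = ldet (length xs) (\<lambda>i j. A (dn (xs ! (i - 1))) (V ! (j - 1))) * pf A (map up xs @ (up x # L))"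
      by (rule snoc.IH) (use snoc.prems(2,3,4) that n_def in auto)
    then show ?thesis by (simp add: prs_def D_def R_def n_def)
  qed
  have "pf A (W @ concat (map (\<lambda>x. [up x, dn x]) (xs @ [x])) @ L) = pf A (W @ prs @ [up x] @ dn x # L)"
    by (simp add: prs_def)
  \<comment> \<open>The row passes n + 1 entries of \<open>W\<close>, 2n paired rows and
    \<open>up x\<close>, which leaves the sign (-1)^n.\<close>
  also have "\<dots> = (-1)^n * pf A (dn x # W @ prs @ up x # L)"
    using pf_move[OF A, of "[]" "W @ prs @ [up x]" "dn x" L] by (simp add: lprs W V power_add power_mult)
  also have "pf A (dn x # W @ prs @ up x # L)
    = (\<Sum>j<Suc n. (-1)^j * A (dn x) (W ! j) * pf A (del j W @ prs @ up x # L))"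
  proof -
    let ?R = "W @ prs @ up x # L"
    have Z: "A (dn x) (?R ! j) = 0" if j: "j \<in> {..<length ?R} - {..<Suc n}" for j
    proof -
      have "?R ! j = (prs @ up x # L) ! (j - Suc n)"
        using j by (simp add: nth_append W V)
      moreover have "j - Suc n < length (prs @ up x # L)" using j by (auto simp: W V)
      ultimately have "?R ! j \<in> set (prs @ up x # L)" by (metis nth_mem)
      then show ?thesis using snoc.prems(2,3,4) by (auto simp: prs_def)
    qed
    have "pf A (dn x # ?R) = (\<Sum>j<length ?R. (-1)^j * A (dn x) (?R ! j) * pf A (del j ?R))"
      by (simp add: pf.simps(2))
    also have "\<dots> = (\<Sum>j<Suc n. (-1)^j * A (dn x) (?R ! j) * pf A (del j ?R))"
      by (rule sum.mono_neutral_right) (use Z in \<open>auto simp: W V\<close>)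
    also have "\<dots> = (\<Sum>j<Suc n. (-1)^j * A (dn x) (W ! j) * pf A (del j W @ prs @ up x # L))"
    proof (intro sum.cong refl)
      fix j assume "j \<in> {..<Suc n}"
      then have j: "j < length W" by (simp add: W V)
      show "(-1)^j * A (dn x) (?R ! j) * pf A (del j ?R)
        = (-1)^j * A (dn x) (W ! j) * pf A (del j W @ prs @ up x # L)"
        unfolding del_append1[OF j] using j by (simp add: nth_append)
    qed
    finally show ?thesis .
  qed
  also have "\<dots> = (\<Sum>j<n. (-1)^j * A (dn x) (V ! j) * ((-1)^(n - 1 - j) * (D (V[j := w]) * R)))
    + (-1)^n * A (dn x) w * (D V * R)"
  proof -
    \<comment> \<open>The last entry \<open>w\<close> is moved into the gap at position j. This
      matches the minors of \<open>ldet_Suc\<close>, where the last column replaces the deleted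
      one.\<close>
    have "pf A (del j W @ prs @ up x # L) = (-1)^(n - 1 - j) * (D (V[j := w]) * R)" if j: "j < n" for j
    proof -
      have "del j W = take j V @ drop (Suc j) V @ [w]"
        using j by (simp add: W V del_append1) (simp add: del_def)
      moreover have "V[j := w] = take j V @ w # drop (Suc j) V"
        using j V by (simp add: upd_conv_take_nth_drop)
      moreover have "length (V[j := w]) = n" by (simp add: V)
      ultimately show ?thesis
        using pf_move[OF A, of "take j V" "drop (Suc j) V" w "prs @ up x # L"] IH[of "V[j := w]"] V
        by simp
    qed
    moreover have "del n W = V" by (simp add: W V del_def)
    ultimately show ?thesis
      using IH[OF V] by (simp add: W V nth_append)
  qed
  also have "(-1)^n * \<dots> = (A (dn x) w * D V - (\<Sum>j<n. A (dn x) (V ! j) * D (V[j := w]))) * R"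
  proof -
    have "(-1)^n * ((-1)^j * A (dn x) (V ! j) * ((-1)^(n - 1 - j) * (D (V[j := w]) * R)))
      = - (A (dn x) (V ! j) * D (V[j := w]) * R)" if "j < n" for j
    proof -
      have "(-1::real)^n * ((-1)^j * (-1)^(n - 1 - j)) = (-1)^(2 * n - 1)"
        using that by (simp flip: power_add)
      also have "\<dots> = - 1" using that by (intro power_minus1_odd[of "n - 1", THEN trans[rotated]]) auto
      finally have e: "(-1::real)^n * ((-1)^j * (-1)^(n - 1 - j)) = - 1" .
      have "(-1)^n * ((-1)^j * A (dn x) (V ! j) * ((-1)^(n - 1 - j) * (D (V[j := w]) * R)))
        = ((-1)^n * ((-1)^j * (-1)^(n - 1 - j))) * (A (dn x) (V ! j) * D (V[j := w]) * R)"
        by (simp only: mult_ac)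
      then show ?thesis unfolding e by simp
    qed
    moreover have "(-1::real)^n * (-1)^n = 1" by (simp flip: power_add)
    ultimately show ?thesis
      by (simp add: distrib_left sum_distrib_left sum_distrib_right sum_negf left_diff_distrib)
  qed
  also have "A (dn x) w * D V - (\<Sum>j<n. A (dn x) (V ! j) * D (V[j := w]))
    = ldet (Suc n) (\<lambda>i j. A (dn ((xs @ [x]) ! (i - 1))) (W ! (j - 1)))"
  proof -
    have a: "ldet n (\<lambda>i j. A (dn ((xs @ [x]) ! (i - 1))) (W ! (j - 1))) = D V"
      unfolding D_def by (rule ldet_cong) (auto simp: W V n_def nth_append)
    have b: "ldet n (\<lambda>i k. if k = j then A (dn ((xs @ [x]) ! (i - 1))) (W ! (Suc n - 1))
      else A (dn ((xs @ [x]) ! (i - 1))) (W ! (k - 1))) = D (V[j - 1 := w])" if "j \<in> {1..n}" for j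
      unfolding D_def by (rule ldet_cong) (use that in \<open>auto simp: W V n_def nth_append nth_list_update\<close>)
    have "(\<Sum>j = 1..n. A (dn x) (W ! (j - 1)) * D (V[j - 1 := w])) = (\<Sum>j<n. A (dn x) (V ! j) * D (V[j := w]))"
      by (rule sum.reindex_bij_witness[where i=Suc and j="\<lambda>j. j - 1"]) (auto simp: W V nth_append)
    then show ?thesis
      unfolding ldet_Suc a using b V by (simp add: W n_def nth_append)
  qed
  finally show ?case by (simp add: R_def n_def)
qed simp

section \<open>Quaternion determinants as Pfaffians\<close>

text \<open>Ordered product along a path through the list that ends at \<open>z\<close>; a closed
  cycle has its first entry as \<open>z\<close>. With lists in place of iterates of a permutation,
  inserting a point into a cycle is a list operation.\<close>

fun pathprod :: "('a \<Rightarrow> 'a \<Rightarrow> real^2^2) \<Rightarrow> 'a list \<Rightarrow> 'a \<Rightarrow> real^2^2" where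
  "pathprod Q [] z = mat 1"
| "pathprod Q [b] z = Q b z"
| "pathprod Q (b # c # r) z = Q b c ** pathprod Q (c # r) z"

lemma pathprod_Cons: "pathprod Q (a # r) z = Q a (hd (r @ [z])) ** pathprod Q r z"
  by (cases r) simp_all

lemma pathprod_append:
  "u \<noteq> [] \<Longrightarrow> v \<noteq> [] \<Longrightarrow> pathprod Q (u @ v) z = pathprod Q u (hd v) ** pathprod Q v z"
proof (induction u)
  case (Cons a u)
  then show ?case
    by (cases "u = []") (cases v, simp_all add: pathprod_Cons matrix_mul_assoc)
qed simp

lemma pathprod_cong:
  "(\<And>y z. y \<in> set cs \<Longrightarrow> Q y z = Q' y z) \<Longrightarrow> pathprod Q cs w = pathprod Q' cs w"
  by (induction cs) (simp_all add: pathprod_Cons)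

section \<open>Cycles of a permutation as lists\<close>

definition is_cyc :: "('a \<Rightarrow> 'a) \<Rightarrow> 'a list \<Rightarrow> bool" where
  "is_cyc p cs \<longleftrightarrow> distinct cs \<and> map p cs = rotate1 cs"

lemma is_cyc_funpow:
  assumes "is_cyc p (a # r)"
  shows "(p ^^ j) a = (a # r) ! (j mod length (a # r))"
proof (induction j)
  case (Suc j)
  let ?n = "length (a # r)"
  have j: "j mod ?n < ?n" by simp
  have "(p ^^ Suc j) a = p ((a # r) ! (j mod ?n))" using Suc by simp
  also have "\<dots> = map p (a # r) ! (j mod ?n)" by (rule nth_map[OF j, symmetric])
  also have "\<dots> = (a # r) ! (Suc (j mod ?n) mod ?n)"
    using assms nth_rotate1[OF j] unfolding is_cyc_def by (simp only:)
  finally show ?case by (simp only: mod_Suc_eq)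
qed simp

lemma is_cyc_cyc:
  assumes "is_cyc p (a # r)"
  shows "cyc p a = set (a # r)"
proof -
  let ?n = "length (a # r)"
  have "cyc p a = (\<lambda>i. (a # r) ! i) ` range (\<lambda>j. j mod ?n)"
    unfolding cyc_def is_cyc_funpow[OF assms] by blast
  also have "range (\<lambda>j. j mod ?n) = {..<?n}"
  proof (intro equalityI subsetI)
    fix i assume "i \<in> {..<?n}"
    then have "i = i mod ?n" by simp
    then show "i \<in> range (\<lambda>j. j mod ?n)" by blast
  qed auto
  also have "(\<lambda>i. (a # r) ! i) ` {..<?n} = set (a # r)"
    unfolding set_conv_nth by blast
  finally show ?thesis .
qed

lemma foldr_pathprod:
  "i < m \<Longrightarrow> foldr (\<lambda>j B. Q (f j) (f (Suc j)) ** B) [i..<m] (mat 1) = pathprod Q (map f [i..<m]) (f m)"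
proof (induction "m - i" arbitrary: i)
  case (Suc k)
  show ?case
  proof (cases "Suc i < m")
    case True
    then show ?thesis using Suc(1)[of "Suc i"] Suc(2)
      by (simp add: upt_conv_Cons pathprod_Cons del: upt_Suc)
  next
    case False
    with Suc have "m = Suc i" by simp
    then show ?thesis by simp
  qed
qed simp

lemma cycprod_pathprod:
  assumes "is_cyc p (a # r)"
  shows "cycprod Q p a = pathprod Q (a # r) a"
proof -
  let ?n = "length (a # r)"
  have "card (cyc p a) = ?n"
    unfolding is_cyc_cyc[OF assms] using assms by (simp only: is_cyc_def distinct_card)
  then have "cycprod Q p a = pathprod Q (map (\<lambda>j. (p ^^ j) a) [0..<?n]) ((p ^^ ?n) a)"
    unfolding cycprod_def using foldr_pathprod[of 0 ?n Q "\<lambda>j. (p ^^ j) a"] by (simp del: upt_Suc)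
  also have "map (\<lambda>j. (p ^^ j) a) [0..<?n] = a # r"
    unfolding is_cyc_funpow[OF assms] by (rule nth_equalityI) (simp_all del: upt_Suc length_Cons)
  also have "(p ^^ ?n) a = a"
    unfolding is_cyc_funpow[OF assms] by simp
  finally show ?thesis .
qed

lemma is_cyc_ex:
  assumes "permutation p"
  obtains r where "is_cyc p (a # r)"
proof -
  define n where "n = least_power p a"
  have n: "(p ^^ n) a = a" "n > 0"
    using least_power_of_permutation[OF assms] by (simp_all add: n_def)
  have d: "distinct (support p a)" by (rule cycle_of_permutation[OF assms])
  have s: "support p a = map (\<lambda>i. (p ^^ i) a) [0..<n]" by (simp add: n_def)
  have s': "support p a = a # map (\<lambda>i. (p ^^ i) a) [1..<n]"
    unfolding s using n(2) by (simp add: upt_conv_Cons)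
  have "map p (support p a) = map (\<lambda>i. (p ^^ i) a) [1..<Suc n]"
    unfolding s map_map by (simp add: o_def map_Suc_upt[symmetric] del: upt_Suc)
  also have "\<dots> = rotate1 (support p a)"
    unfolding s' using n by simp
  finally show ?thesis using that d unfolding is_cyc_def s' by blast
qed

lemma is_cyc_rotate: "is_cyc p (u @ v) \<Longrightarrow> is_cyc p (v @ u)"
proof -
  assume *: "is_cyc p (u @ v)"
  have "v @ u = rotate (length u) (u @ v)" by (simp add: rotate_append)
  moreover have "map p (rotate (length u) (u @ v)) = rotate1 (rotate (length u) (u @ v))"
    using * by (simp add: is_cyc_def rotate_map[symmetric] rotate1_rotate_swap del: map_append)
  ultimately show ?thesis using * unfolding is_cyc_def by auto
qed

text \<open>The scalar part is half a trace, hence unchanged when the factors of a cycle are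
  rotated. So the representative picked by \<open>SOME\<close> in \<open>Tdet\<close> does not
  affect the value.\<close>

lemma is_cyc_rebase:
  assumes "is_cyc p (a # r)" "b \<in> set (a # r)"
  obtains s where "is_cyc p (b # s)" "set (b # s) = set (a # r)"
    "\<And>Q. qscal (pathprod Q (b # s) b) = qscal (pathprod Q (a # r) a)"
proof -
  obtain u v where uv: "a # r = u @ b # v" using split_list[OF assms(2)] by blast
  show ?thesis
  proof (cases u)
    case Nil
    then show ?thesis using that[of v] uv assms(1) by auto
  next
    case (Cons a' u')
    then have a': "a' = a" using uv by simp
    have "is_cyc p (b # v @ u)"
      using is_cyc_rotate[of p u "b # v"] assms(1) uv by simp
    moreover have "set (b # v @ u) = set (a # r)" unfolding uv by auto
    moreover have "qscal (pathprod Q (b # v @ u) b) = qscal (pathprod Q (a # r) a)" for Q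
    proof -
      have "pathprod Q (b # v @ u) b = pathprod Q (b # v) a ** pathprod Q u b"
        using pathprod_append[of "b # v" u Q b] Cons a' by simp
      moreover have "pathprod Q (a # r) a = pathprod Q u b ** pathprod Q (b # v) a"
        unfolding uv using pathprod_append[of u "b # v" Q a] Cons by simp
      ultimately show ?thesis
        unfolding qscal_def using trace_mul_sym[of "pathprod Q (b # v) a" "pathprod Q u b"] by simp
    qed
    ultimately show ?thesis by (rule that)
  qed
qed

definition cycw :: "('a \<Rightarrow> 'a \<Rightarrow> real^2^2) \<Rightarrow> ('a \<Rightarrow> 'a) \<Rightarrow> 'a set \<Rightarrow> real" where
  "cycw Q p c = qscal (cycprod Q p (SOME a. a \<in> c))"

lemma cycw_pathprod:
  assumes "is_cyc p (a # r)"
  shows "cycw Q p (set (a # r)) = qscal (pathprod Q (a # r) a)"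
proof -
  have mem: "(SOME b. b \<in> set (a # r)) \<in> set (a # r)" by (rule someI[of _ a]) simp
  obtain s where s: "is_cyc p ((SOME b. b \<in> set (a # r)) # s)"
    "\<And>Q. qscal (pathprod Q ((SOME b. b \<in> set (a # r)) # s) (SOME b. b \<in> set (a # r))) = qscal (pathprod Q (a # r) a)"
    by (rule is_cyc_rebase[OF assms mem]) (rule that)
  show ?thesis unfolding cycw_def cycprod_pathprod[OF s(1)] by (rule s(2))
qed

lemma cyc_rebase:
  assumes "permutation p" "b \<in> cyc p a"
  shows "cyc p b = cyc p a"
proof -
  obtain r where r: "is_cyc p (a # r)" using is_cyc_ex[OF assms(1)] by blast
  then obtain s where "is_cyc p (b # s)" "set (b # s) = set (a # r)"
    using is_cyc_rebase[OF r] assms(2) is_cyc_cyc[OF r] by metis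
  then show ?thesis using is_cyc_cyc[OF r] is_cyc_cyc by metis
qed

lemma self_in_cyc: "a \<in> cyc p a"
  unfolding cyc_def by (auto intro!: exI[of _ "0::nat"])

lemma cyc_subset: "p permutes I \<Longrightarrow> a \<in> I \<Longrightarrow> cyc p a \<subseteq> I"
  unfolding cyc_def using permutes_in_funpow_image[of p I a] by auto

lemma is_cyc_congI:
  assumes "is_cyc q cs" "\<And>y. y \<in> set cs \<Longrightarrow> p y = q y"
  shows "is_cyc p cs"
  using assms unfolding is_cyc_def by (metis map_cong)

section \<open>Insertion of a point and linearity in rows\<close>

definition permw :: "'a set \<Rightarrow> ('a \<Rightarrow> 'a \<Rightarrow> real^2^2) \<Rightarrow> ('a \<Rightarrow> 'a) \<Rightarrow> real" where
  "permw I Q p = (-1) ^ (card I - card (cyc p ` I)) * (\<Prod>c\<in>cyc p ` I. cycw Q p c)"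

lemma Tdet_permw: "Tdet I Q = (\<Sum>p | p permutes I. permw I Q p)"
  by (simp add: Tdet_def permw_def cycw_def)

lemma cycw_other:
  assumes "permutation q" "\<And>y. y \<in> cyc q b \<Longrightarrow> p y = q y"
    and "\<And>y z. y \<in> cyc q b \<Longrightarrow> Q y z = Q' y z"
  shows "cyc p b = cyc q b" "cycw Q p (cyc q b) = cycw Q' q (cyc q b)"
proof -
  obtain s where s: "is_cyc q (b # s)" using is_cyc_ex[OF assms(1)] by blast
  note cs = is_cyc_cyc[OF s]
  have s': "is_cyc p (b # s)"
    by (rule is_cyc_congI[OF s]) (use assms(2) cs in auto)
  show "cyc p b = cyc q b" using is_cyc_cyc[OF s'] cs by simp
  show "cycw Q p (cyc q b) = cycw Q' q (cyc q b)"
    unfolding cs cycw_pathprod[OF s] cycw_pathprod[OF s']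
    by (subst pathprod_cong[of _ Q Q']) (use assms(3) cs in auto)
qed

text \<open>A new fixed point adds one index and one cycle, so the sign exponent stays the
  same.\<close>

lemma permw_fixpoint:
  assumes I: "finite I" "x \<notin> I" and q: "q permutes I"
  shows "permw (insert x I) Q q = qscal (Q x x) * permw I Q q"
proof -
  have qx: "q x = x" using q I(2) by (simp add: permutes_not_in)
  have x: "is_cyc q [x]" by (simp add: is_cyc_def qx)
  have cx: "cyc q x = {x}" using is_cyc_cyc[OF x] by simp
  have notin: "{x} \<notin> cyc q ` I" using self_in_cyc I(2) cyc_subset[OF q] by fastforce
  have "card (insert x I) - card (cyc q ` insert x I) = card I - card (cyc q ` I)"
    using I notin by (simp add: cx)
  moreover have "cycw Q q {x} = qscal (Q x x)" using cycw_pathprod[OF x, of Q] by simp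
  ultimately show ?thesis
    unfolding permw_def using I notin by (simp add: cx)
qed

text \<open>The composite permutation visits \<open>x\<close> between \<open>a\<close> and
  \<open>q a\<close>. Number of cycles and all other cycle weights are kept while the index set
  grows by one, hence the minus sign; in the cycle of \<open>a\<close> the two factors through
  \<open>x\<close> are absorbed into row \<open>a\<close>.\<close>

lemma permw_insert:
  fixes Q :: "'a \<Rightarrow> 'a \<Rightarrow> real^2^2"
  assumes I: "finite I" "x \<notin> I" and q: "q permutes I" and a: "a \<in> I"
  shows "permw (insert x I) Q (swp x (q a) \<circ> q)
    = - permw I (Q(a := (\<lambda>b. Q a x ** Q x b))) q"
proof -
  define p where "p = swp x (q a) \<circ> q"
  define Q' where "Q' = Q(a := (\<lambda>b. Q a x ** Q x b))"
  have perm: "permutation q" using q I(1) permutation_permutes by blast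
  have qI: "q y \<in> I" if "y \<in> I" for y using permutes_in_image[OF q] that by blast
  have qx: "q x = x" using q I(2) by (simp add: permutes_not_in)
  have injq: "q y = q z \<Longrightarrow> y = z" for y z using permutes_inj[OF q] by (simp add: inj_def)
  have pa: "p a = x" and px: "p x = q a" by (simp_all add: p_def qx)
  have po: "p y = q y" if "y \<in> I" "y \<noteq> a" for y
    using qI[OF that(1)] injq[of y a] I(2) that by (auto simp: p_def Transposition.transpose_def)
  obtain r where r: "is_cyc q (a # r)" using is_cyc_ex[OF perm] by blast
  define c0 where "c0 = cyc q a"
  have c0: "c0 = set (a # r)" using is_cyc_cyc[OF r] by (simp add: c0_def)
  have c0I: "c0 \<subseteq> I" unfolding c0_def by (rule cyc_subset[OF q a])
  have ar: "a \<notin> set r" "distinct r" "q a # map q r = r @ [a]" using r by (auto simp: is_cyc_def)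
  have "map p r = map q r" by (rule map_cong) (use c0 c0I po ar in auto)
  then have "q a # map p r = r @ [a]" using ar by (simp only:)
  then have r': "is_cyc p (a # x # r)"
    using ar(1,2) I(2) c0 c0I a by (auto simp: is_cyc_def pa px)
  have cp0: "cyc p y = insert x c0" if "y \<in> insert x c0" for y
  proof -
    have y: "y \<in> set (a # x # r)" using that c0 by auto
    obtain s where "is_cyc p (y # s)" "set (y # s) = set (a # x # r)"
      by (rule is_cyc_rebase[OF r' y])
    then have "cyc p y = set (a # x # r)" using is_cyc_cyc by metis
    then show ?thesis using c0 by auto
  qed
  have other: "cyc p b = cyc q b" "cycw Q p (cyc q b) = cycw Q' q (cyc q b)" "cyc q b \<noteq> c0"
    if "b \<in> I" "b \<notin> c0" for b
  proof -
    have "a \<notin> cyc q b" using cyc_rebase[OF perm, of a b] that(2) self_in_cyc[of b q] by (auto simp: c0_def)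
    then have "p y = q y" "Q y z = Q' y z" if "y \<in> cyc q b" for y z
      using that cyc_subset[OF q \<open>b \<in> I\<close>] po[of y] by (auto simp: Q'_def)
    then show "cyc p b = cyc q b" "cycw Q p (cyc q b) = cycw Q' q (cyc q b)"
      using cycw_other[OF perm, of b p Q Q'] by blast+
    show "cyc q b \<noteq> c0" using that(2) self_in_cyc[of b q] by auto
  qed
  define C where "C = cyc q ` I - {c0}"
  have C1: "cyc q ` I = insert c0 C" using a by (auto simp: C_def c0_def)
  have C2: "cyc p ` insert x I = insert (insert x c0) C"
  proof -
    have "cyc p ` insert x I = insert (insert x c0) (cyc p ` (I - c0))"
      using cp0 a self_in_cyc[of a q] c0I by (auto simp: c0_def)
    also have "cyc p ` (I - c0) = cyc q ` (I - c0)" using other(1) by auto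
    also have "cyc q ` (I - c0) = C"
      using other(3) cyc_rebase[OF perm] by (auto simp: C_def c0_def)
    finally show ?thesis .
  qed
  have fC: "finite C" "c0 \<notin> C" "insert x c0 \<notin> C"
    using I cyc_subset[OF q] by (auto simp: C_def)
  have "(\<Prod>c\<in>C. cycw Q p c) = (\<Prod>c\<in>C. cycw Q' q c)"
  proof (rule prod.cong[OF refl])
    fix c assume "c \<in> C"
    then obtain b where b: "b \<in> I" "c = cyc q b" "c \<noteq> c0" by (auto simp: C_def)
    then have "b \<notin> c0" using cyc_rebase[OF perm, of b a] by (auto simp: c0_def)
    then show "cycw Q p c = cycw Q' q c" using other(2) b by simp
  qed
  moreover have "cycw Q p (insert x c0) = cycw Q' q c0"
  proof -
    have "cycw Q p (insert x c0) = qscal (pathprod Q (a # x # r) a)"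
      using cycw_pathprod[OF r', of Q] c0 by (simp add: insert_commute)
    also have "pathprod Q (a # x # r) a = pathprod Q' (a # r) a"
    proof -
      have "pathprod Q r a = pathprod Q' r a" by (rule pathprod_cong) (use ar(1) in \<open>auto simp: Q'_def\<close>)
      then show ?thesis
        by (simp add: pathprod_Cons matrix_mul_assoc) (simp add: Q'_def)
    qed
    also have "qscal \<dots> = cycw Q' q c0" using cycw_pathprod[OF r, of Q'] c0 by simp
    finally show ?thesis .
  qed
  ultimately have w: "(\<Prod>c\<in>insert (insert x c0) C. cycw Q p c) = (\<Prod>c\<in>insert c0 C. cycw Q' q c)"
    using fC by simp
  \<comment> \<open>The sign exponent is a truncated difference; it grows by one because there are
    at most as many cycles as points.\<close>
  have "card (insert c0 C) \<le> card I"
    unfolding C1[symmetric] by (rule card_image_le[OF I(1)])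
  moreover have "card (insert x I) = Suc (card I)" using I by simp
  ultimately have s: "card (insert x I) - card (insert (insert x c0) C) = Suc (card I - card (insert c0 C))"
    using fC by simp
  show ?thesis
    unfolding permw_def p_def[symmetric] Q'_def[symmetric] C1 C2 w s by simp
qed

text \<open>Removing \<open>x\<close> from its cycle contracts the two factors adjacent to \<open>x\<close> into one.\<close>
lemma Tdet_insert:
  assumes I: "finite I" "x \<notin> I"
  shows "Tdet (insert x I) Q
    = qscal (Q x x) * Tdet I Q - (\<Sum>a\<in>I. Tdet I (Q(a := (\<lambda>b. Q a x ** Q x b))))"
proof -
  let ?f = "permw (insert x I) Q"
  have "Tdet (insert x I) Q
    = (\<Sum>b\<in>insert x I. \<Sum>q | q permutes I. ?f (swp x b \<circ> q))"
    unfolding Tdet_permw by (rule sum_over_permutations_insert[OF I])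
  also have "\<dots> = (\<Sum>q | q permutes I. ?f q) + (\<Sum>b\<in>I. \<Sum>q | q permutes I. ?f (swp x b \<circ> q))"
    using I by simp
  also have "(\<Sum>q | q permutes I. ?f q) = qscal (Q x x) * Tdet I Q"
    unfolding Tdet_permw sum_distrib_left by (intro sum.cong refl permw_fixpoint[OF I]) simp
  also have "(\<Sum>b\<in>I. \<Sum>q | q permutes I. ?f (swp x b \<circ> q))
    = (\<Sum>q | q permutes I. \<Sum>b\<in>I. ?f (swp x b \<circ> q))"
    by (rule sum.swap)
  also have "\<dots> = (\<Sum>q | q permutes I. \<Sum>a\<in>I. - permw I (Q(a := (\<lambda>b. Q a x ** Q x b))) q)"
  proof (rule sum.cong[OF refl])
    fix q assume "q \<in> {q. q permutes I}"
    then have q: "q permutes I" by simp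
    have "(\<Sum>b\<in>I. ?f (swp x b \<circ> q)) = (\<Sum>a\<in>I. ?f (swp x (q a) \<circ> q))"
      using sum.permute[OF q, of "\<lambda>b. ?f (swp x b \<circ> q)"] by (simp add: o_def)
    also have "\<dots> = (\<Sum>a\<in>I. - permw I (Q(a := (\<lambda>b. Q a x ** Q x b))) q)"
      by (intro sum.cong refl permw_insert[OF I q])
    finally show "(\<Sum>b\<in>I. ?f (swp x b \<circ> q))
      = (\<Sum>a\<in>I. - permw I (Q(a := (\<lambda>b. Q a x ** Q x b))) q)" .
  qed
  also have "\<dots> = - (\<Sum>a\<in>I. Tdet I (Q(a := (\<lambda>b. Q a x ** Q x b))))"
    unfolding Tdet_permw by (subst sum.swap) (simp add: sum_negf)
  finally show ?thesis by simp
qed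

lemma qscal_add_scaleR: "qscal (A + e *\<^sub>R B) = qscal A + e * qscal B"
  by (simp add: qscal_def trace_def sum.distrib sum_distrib_left add_divide_distrib)

text \<open>Exactly one factor of the whole cycle expansion comes from row \<open>a\<close>: the
  step leaving \<open>a\<close> in its own cycle.\<close>

lemma permw_row_linear:
  assumes I: "finite I" and p: "p permutes I" and a: "a \<in> I"
  shows "permw I (Q(a := (\<lambda>b. u b + e *\<^sub>R v b))) p
    = permw I (Q(a := u)) p + e * permw I (Q(a := v)) p"
proof -
  have perm: "permutation p" using p I permutation_permutes by blast
  obtain r where r: "is_cyc p (a # r)" using is_cyc_ex[OF perm] by blast
  note c0 = is_cyc_cyc[OF r]
  have ar: "a \<notin> set r" using r by (auto simp: is_cyc_def)
  define C where "C = cyc p ` I - {cyc p a}"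
  have C: "cyc p ` I = insert (cyc p a) C" "finite C" "cyc p a \<notin> C"
    using a I by (auto simp: C_def)
  have split: "(\<Prod>c\<in>cyc p ` I. cycw (Q(a := w)) p c)
    = qscal (w (hd (r @ [a])) ** pathprod Q r a) * (\<Prod>c\<in>C. cycw Q p c)" for w
  proof -
    have "(\<Prod>c\<in>C. cycw (Q(a := w)) p c) = (\<Prod>c\<in>C. cycw Q p c)"
    proof (rule prod.cong[OF refl])
      fix c assume "c \<in> C"
      then obtain b where b: "b \<in> I" "c = cyc p b" "c \<noteq> cyc p a" by (auto simp: C_def)
      then have "a \<notin> cyc p b" using cyc_rebase[OF perm, of a b] by auto
      then show "cycw (Q(a := w)) p c = cycw Q p c"
        unfolding b(2) by (intro cycw_other(2)[OF perm]) auto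
    qed
    moreover have "cycw (Q(a := w)) p (cyc p a) = qscal (w (hd (r @ [a])) ** pathprod Q r a)"
    proof -
      have "pathprod (Q(a := w)) r a = pathprod Q r a"
        by (rule pathprod_cong) (use ar in auto)
      then show ?thesis unfolding c0 cycw_pathprod[OF r] by (simp add: pathprod_Cons)
    qed
    ultimately show ?thesis using C by simp
  qed
  have "(u b + e *\<^sub>R v b) ** M = u b ** M + e *\<^sub>R (v b ** M)" for b and M :: "real^2^2"
    by (simp add: vec_eq_iff matrix_matrix_mult_def sum.distrib sum_distrib_left algebra_simps)
  then show ?thesis
    unfolding permw_def split by (simp add: qscal_add_scaleR algebra_simps)
qed

lemma Tdet_row_linear:
  assumes "finite I" "a \<in> I"
  shows "Tdet I (Q(a := (\<lambda>b. u b + e *\<^sub>R v b))) = Tdet I (Q(a := u)) + e * Tdet I (Q(a := v))"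
  unfolding Tdet_permw sum_distrib_left sum.distrib[symmetric]
  by (intro sum.cong refl permw_row_linear) (use assms in auto)

lemma Tdet_cong:
  assumes I: "finite I" and eq: "\<And>a b. a \<in> I \<Longrightarrow> Q a b = Q' a b"
  shows "Tdet I Q = Tdet I Q'"
  unfolding Tdet_permw
proof (intro sum.cong refl)
  fix p assume "p \<in> {p. p permutes I}"
  then have p: "p permutes I" by simp
  then have perm: "permutation p" using I permutation_permutes by blast
  have "cycw Q p c = cycw Q' p c" if c: "c \<in> cyc p ` I" for c
  proof -
    obtain b where b: "b \<in> I" "c = cyc p b" using c by blast
    show ?thesis
      unfolding b(2) by (rule cycw_other(2)[OF perm]) (use eq cyc_subset[OF p b(1)] in auto)
  qed
  then show "permw I Q p = permw I Q' p" unfolding permw_def by simp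
qed

text \<open>Product rule for a multilinear function of the rows. Perturbing only the rows in
  \<open>S\<close> makes an induction on \<open>S\<close> possible.\<close>

lemma Tdet_DERIV:
  assumes I: "finite I" and S: "S \<subseteq> I"
  shows "((\<lambda>e. Tdet I (\<lambda>a b. if a \<in> S then Q a b + e *\<^sub>R E a b else Q a b))
     has_real_derivative (\<Sum>a\<in>S. Tdet I (Q(a := E a)))) (at 0)"
  using finite_subset[OF S I] S
proof (induction S arbitrary: Q rule: finite_induct)
  case (insert a S)
  define F where "F Q e = Tdet I (\<lambda>a b. if a \<in> S then Q a b + e *\<^sub>R E a b else Q a b)" for Q :: "'a \<Rightarrow> 'a \<Rightarrow> real^2^2" and e
  have a: "a \<in> I" "a \<notin> S" using insert by auto
  have IH: "(F Q has_real_derivative (\<Sum>a\<in>S. Tdet I (Q(a := E a)))) (at 0)" for Q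
    unfolding F_def using insert.IH insert.prems by blast
  \<comment> \<open>Linearity in row \<open>a\<close> separates the new perturbation; its term
    already carries the factor \<open>e\<close>, so at 0 only its value counts.\<close>
  have eq: "Tdet I (\<lambda>c b. if c \<in> insert a S then Q c b + e *\<^sub>R E c b else Q c b)
    = F Q e + e * F (Q(a := E a)) e" for e
  proof -
    define R where "R = (\<lambda>c b. if c \<in> S then Q c b + e *\<^sub>R E c b else Q c b)"
    have "(\<lambda>c b. if c \<in> insert a S then Q c b + e *\<^sub>R E c b else Q c b) = R(a := (\<lambda>b. Q a b + e *\<^sub>R E a b))"
      using a by (auto simp: R_def fun_eq_iff)
    moreover have "R(a := Q a) = R" using a by (auto simp: R_def fun_eq_iff)
    moreover have "F (Q(a := E a)) e = Tdet I (R(a := E a))"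
      unfolding F_def by (rule arg_cong[of _ _ "Tdet I"]) (use a in \<open>auto simp: R_def fun_eq_iff\<close>)
    ultimately show ?thesis
      using Tdet_row_linear[OF I a(1), of R "Q a" e "E a"] by (simp add: F_def R_def[symmetric])
  qed
  have "((\<lambda>e. F Q e + e * F (Q(a := E a)) e) has_real_derivative
    (\<Sum>c\<in>S. Tdet I (Q(c := E c))) + (1 * F (Q(a := E a)) 0 + (\<Sum>c\<in>S. Tdet I ((Q(a := E a))(c := E c))) * 0)) (at 0)"
    by (intro DERIV_add IH DERIV_mult DERIV_ident)
  moreover have "F (Q(a := E a)) 0 = Tdet I (Q(a := E a))"
    unfolding F_def by (rule arg_cong[of _ _ "Tdet I"]) (auto simp: fun_eq_iff)
  ultimately have "((\<lambda>e. F Q e + e * F (Q(a := E a)) e) has_real_derivative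
    (\<Sum>c\<in>insert a S. Tdet I (Q(c := E c)))) (at 0)"
    using insert.hyps by (simp add: add.commute)
  then show ?case by (simp only: eq)
qed simp

text \<open>The block C(q) times the symplectic matrix with rows (0, 1) and (-1, 0), where
  \<open>False\<close> marks the first and \<open>True\<close> the second coordinate of a point.
  Self-duality of \<open>Q\<close> is skewness of this kernel.\<close>

definition qkern :: "('a \<Rightarrow> 'a \<Rightarrow> real^2^2) \<Rightarrow> 'a \<times> bool \<Rightarrow> 'a \<times> bool \<Rightarrow> real" where
  "qkern Q c d = (let q = Q (fst c) (fst d) in
     if snd c then (if snd d then q $ 2 $ 1 else - (q $ 2 $ 2))
     else (if snd d then q $ 1 $ 1 else - (q $ 1 $ 2)))"

definition dbl :: "'a list \<Rightarrow> ('a \<times> bool) list" where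
  "dbl L = concat (map (\<lambda>a. [(a, False), (a, True)]) L)"

lemma fst_dbl: "c \<in> set (dbl L) \<Longrightarrow> fst c \<in> set L"
  by (auto simp: dbl_def)

text \<open>A product of two blocks through \<open>x\<close> is, in terms of the kernel, a sum over
  the two coordinates of \<open>x\<close> with the symplectic sign between them; skewness turns rows
  of \<open>x\<close> into columns.\<close>

lemma qkern_rank2:
  fixes Q :: "'a \<Rightarrow> 'a \<Rightarrow> real^2^2"
  assumes sk: "skew (qkern Q)"
  shows "qkern (\<lambda>a b. Q a b + e *\<^sub>R (Q a x ** Q x b)) c d
    = qkern Q c d + e * (qkern Q c (x, False) * qkern Q d (x, True) - qkern Q c (x, True) * qkern Q d (x, False))"
proof -
  have F: "qkern Q d (x, False) = - qkern Q (x, False) d" "qkern Q d (x, True) = - qkern Q (x, True) d"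
    by (rule skewD[OF sk])+
  show ?thesis
    unfolding F by (simp add: qkern_def Let_def matrix_matrix_mult_def sum_2 algebra_simps)
qed

text \<open>The sum over contractions in \<open>Tdet_insert\<close> is the derivative of \<open>Tdet\<close> along \<open>E a b = Q a x ** Q x b\<close>,
  which is self-dual again; on the Pfaffian side this is a rank two perturbation, given by a Schur complement.\<close>
theorem Tdet_eq_pf:
  fixes Q :: "'a \<Rightarrow> 'a \<Rightarrow> real^2^2"
  assumes "skew (qkern Q)" "distinct L"
  shows "Tdet (set L) Q = pf (qkern Q) (dbl L)"
  using assms
proof (induction L arbitrary: Q)
  case Nil
  then show ?case by (simp add: Tdet_def dbl_def)
next
  case (Cons x L)
  let ?A = "qkern Q"
  define p where "p = (x, False)"
  define q where "q = (x, True)"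
  define n where "n = length (dbl L)"
  define K where "K = (\<Sum>j<n. \<Sum>k<n. ?A p (dbl L ! j) * ?A q (dbl L ! k) * cof ?A (dbl L) j k)"
  define E where "E a b = Q a x ** Q x b" for a b
  define Qe where "Qe e a b = Q a b + e *\<^sub>R E a b" for e a b
  note sk = skewD[OF Cons.prems(1)]
  have x: "x \<notin> set L" "distinct L" using Cons.prems by auto
  have pq: "p \<notin> set (dbl L)" "q \<notin> set (dbl L)" "p \<noteq> q"
    using x(1) fst_dbl[of _ L] by (auto simp: p_def q_def)
  have rank2: "qkern (Qe e) c d = ?A c d + e * (?A c p * ?A d q - ?A c q * ?A d p)" for e c d
    unfolding Qe_def E_def p_def q_def by (rule qkern_rank2[OF Cons.prems(1)])
  have skQe: "skew (qkern (Qe e))" for e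
    unfolding skew_def
  proof (intro allI)
    fix c d show "qkern (Qe e) c d = - qkern (Qe e) d c"
      unfolding rank2 using sk[of c d] by (simp add: algebra_simps)
  qed
  \<comment> \<open>The determinant of the perturbed matrix is exactly affine in \<open>e\<close>,
    so its derivative at 0 is the slope \<open>- K\<close>. The induction hypothesis applies at
    every \<open>e\<close> because the perturbation stays skew.\<close>
  have T: "Tdet (set L) (Qe e) = pf ?A (dbl L) - e * K" for e
  proof (cases "e = 0")
    case True
    then show ?thesis using Cons.IH[OF Cons.prems(1) x(2)] by (simp add: Qe_def[abs_def])
  next
    case False
    \<comment> \<open>Overwriting the pivot entry by \<open>w = - 1 / e\<close> makes the Schur
      complement on \<open>p\<close> and \<open>q\<close> coincide with the perturbation of size
      \<open>e\<close>, while the expansion along these two rows is affine in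
      \<open>w\<close>.\<close>
    define w where "w = - 1 / e"
    define Aw where "Aw c d = (if c = p \<and> d = q then w else if c = q \<and> d = p then - w else ?A c d)" for c d
    have w: "w \<noteq> 0" "1 / w = - e" using False by (simp_all add: w_def)
    have skAw: "skew Aw"
      unfolding skew_def
    proof (intro allI)
      fix c d show "Aw c d = - Aw d c"
        using sk[of c d] pq(3) by (auto simp: Aw_def)
    qed
    have Awpq: "Aw p q = w" by (simp add: Aw_def)
    have Aw: "Aw c d = ?A c d" if "c \<in> set (dbl L) \<or> d \<in> set (dbl L)" for c d
      using that pq by (auto simp: Aw_def)
    have "pf Aw (p # q # dbl L) = w * pf Aw (dbl L)
      + (\<Sum>j<n. \<Sum>k<n. Aw p (dbl L ! j) * Aw q (dbl L ! k) * cof Aw (dbl L) j k)"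
      unfolding pf_expand_cof Awpq n_def ..
    also have "pf Aw (dbl L) = pf ?A (dbl L)" by (rule pf_cong) (simp add: Aw)
    also have "cof Aw (dbl L) = cof ?A (dbl L)" by (intro ext cof_cong) (simp add: Aw)
    also have "(\<Sum>j<n. \<Sum>k<n. Aw p (dbl L ! j) * Aw q (dbl L ! k) * cof ?A (dbl L) j k) = K"
      unfolding K_def by (intro sum.cong refl) (simp add: Aw n_def)
    finally have 1: "pf Aw (p # q # dbl L) = w * pf ?A (dbl L) + K" .
    have "pf Aw (p # q # dbl L) = w * pf (schur Aw p q) (dbl L)"
      using pf_schur[OF skAw, of p q "dbl L"] w Awpq by simp
    also have "pf (schur Aw p q) (dbl L) = pf (qkern (Qe e)) (dbl L)"
    proof (rule pf_cong)
      fix c d assume "c \<in> set (dbl L)" "d \<in> set (dbl L)"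
      then have "schur Aw p q c d = ?A c d + (1 / w) * (?A c q * ?A d p - ?A c p * ?A d q)"
        by (simp add: schur_def Aw Awpq)
      then show "schur Aw p q c d = qkern (Qe e) c d"
        unfolding w rank2 by (simp add: algebra_simps)
    qed
    also have "\<dots> = Tdet (set L) (Qe e)"
      using Cons.IH[OF skQe x(2)] by simp
    finally have "w * Tdet (set L) (Qe e) = w * (pf ?A (dbl L) + (1 / w) * K)"
      using 1 w(1) by (simp add: distrib_left)
    then show ?thesis unfolding w(2) using w(1) by simp
  qed
  have "((\<lambda>e. Tdet (set L) (\<lambda>a b. if a \<in> set L then Q a b + e *\<^sub>R E a b else Q a b))
     has_real_derivative (\<Sum>a\<in>set L. Tdet (set L) (Q(a := E a)))) (at 0)"
    by (rule Tdet_DERIV) auto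
  also have "(\<lambda>e. Tdet (set L) (\<lambda>a b. if a \<in> set L then Q a b + e *\<^sub>R E a b else Q a b))
    = (\<lambda>e. Tdet (set L) (Qe e))"
    by (intro ext Tdet_cong) (simp_all add: Qe_def)
  finally have "((\<lambda>e. pf ?A (dbl L) - e * K) has_real_derivative (\<Sum>a\<in>set L. Tdet (set L) (Q(a := E a)))) (at 0)"
    unfolding T .
  moreover have "((\<lambda>e. pf ?A (dbl L) - e * K) has_real_derivative - K) (at 0)"
    by (auto intro!: derivative_eq_intros)
  ultimately have D: "(\<Sum>a\<in>set L. Tdet (set L) (Q(a := E a))) = - K"
    by (rule DERIV_unique)
  have E': "E a = (\<lambda>b. Q a x ** Q x b)" for a by (simp add: E_def fun_eq_iff)
  have "Tdet (set (x # L)) Q = qscal (Q x x) * Tdet (set L) Q + K"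
    using Tdet_insert[of "set L" x Q] x(1) D unfolding E' by simp
  also have "qscal (Q x x) = ?A p q"
    using sk[of p q] by (simp add: qscal_def trace_def sum_2 p_def q_def qkern_def)
  also have "Tdet (set L) Q = pf ?A (dbl L)" using Cons.IH[OF Cons.prems(1) x(2)] .
  also have "?A p q * pf ?A (dbl L) + K = pf ?A (dbl (x # L))"
    using pf_expand_cof[of ?A p q "dbl L"] by (simp add: K_def n_def dbl_def p_def q_def)
  finally show ?case .
qed

section \<open>Heat kernels\<close>

lemmas lint_cong = Bochner_Integration.integral_cong

lemma pk_sym: "pk s x y = pk s y x"
  by (simp add: pk_def power2_commute)

lemma pk_normal: "s > 0 \<Longrightarrow> pk s x y = normal_density x (sqrt s) y"
  by (simp add: pk_def normal_density_def power2_commute)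

lemma pk_normal_fun: "s > 0 \<Longrightarrow> pk s x = normal_density x (sqrt s)"
  by (intro ext pk_normal)

lemma pk_nonneg: "s > 0 \<Longrightarrow> 0 \<le> pk s x y"
  by (simp add: pk_def)

lemma pk_shift: "pk s (x - c) y = pk s x (y + c)"
  by (simp add: pk_def algebra_simps)

lemma pk_minus: "pk s (- x) (- y) = pk s x y"
  by (simp add: pk_def power2_commute)

lemma borel_measurable_pk[measurable (raw)]:
  "f \<in> borel_measurable M \<Longrightarrow> g \<in> borel_measurable M \<Longrightarrow> (\<lambda>w. pk s (f w) (g w)) \<in> borel_measurable M"
  unfolding pk_def by simp

lemma integrable_pk: "s > 0 \<Longrightarrow> integrable lborel (pk s x)"
  using integrable_normal_density[of "sqrt s" x] by (simp add: pk_normal_fun)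

lemma integral_pk: "s > 0 \<Longrightarrow> (LBINT y. pk s x y) = 1"
  by (simp add: pk_normal)

lemma pk_bounded: "s > 0 \<Longrightarrow> pk s x y \<le> 1 / sqrt (2 * pi * s)"
  by (simp add: pk_def divide_right_mono)

text \<open>Completing the square in \<open>y\<close>. The second factor is the law of a Brownian
  bridge from \<open>x\<close> to \<open>z\<close> seen at time \<open>a\<close>; integrating it out
  gives the semigroup property, and with Hermite polynomials it is a conditional
  expectation.\<close>

lemma pk_prod:
  assumes a: "a > 0" and b: "b > 0"
  shows "pk a x y * pk b y z = pk (a + b) x z * pk (a * b / (a + b)) ((b * x + a * z) / (a + b)) y"
proof -
  define s where "s = a + b"
  have s: "s > 0" using a b by (simp add: s_def)
  have "(x - y)\<^sup>2 / (2 * a) + (y - z)\<^sup>2 / (2 * b)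
    = (x - z)\<^sup>2 / (2 * s) + ((b * x + a * z) / s - y)\<^sup>2 / (2 * (a * b / s))"
  proof -
    have sq: "((b * x + a * z) / s - y)\<^sup>2 = (b * x + a * z - s * y)\<^sup>2 / s\<^sup>2"
      using s by (simp add: power2_eq_square field_simps)
    have "((b * x + a * z) / s - y)\<^sup>2 / (2 * (a * b / s)) = (b * x + a * z - s * y)\<^sup>2 / (2 * a * b * s)"
    proof -
      have "X / s\<^sup>2 / (2 * (a * b / s)) = X / (2 * a * b * s)" for X
        using a b s by (simp add: power2_eq_square)
      then show ?thesis unfolding sq .
    qed
    moreover have "(x - y)\<^sup>2 / (2 * a) + (y - z)\<^sup>2 / (2 * b) = (b * s * (x - y)\<^sup>2 + a * s * (y - z)\<^sup>2) / (2 * a * b * s)"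
      using a b s by (simp add: field_simps)
    moreover have "(x - z)\<^sup>2 / (2 * s) = (a * b * (x - z)\<^sup>2) / (2 * a * b * s)"
      using a b s by (simp add: field_simps)
    moreover have "b * s * (x - y)\<^sup>2 + a * s * (y - z)\<^sup>2 = a * b * (x - z)\<^sup>2 + (b * x + a * z - s * y)\<^sup>2"
      unfolding s_def by (simp add: power2_eq_square algebra_simps)
    ultimately show ?thesis by (simp add: add_divide_distrib)
  qed
  then have "exp (- (x - y)\<^sup>2 / (2 * a)) * exp (- (y - z)\<^sup>2 / (2 * b))
    = exp (- (x - z)\<^sup>2 / (2 * s)) * exp (- ((b * x + a * z) / s - y)\<^sup>2 / (2 * (a * b / s)))"
    by (simp flip: exp_add)
  moreover have "sqrt (2 * pi * a) * sqrt (2 * pi * b) = sqrt (2 * pi * s) * sqrt (2 * pi * (a * b / s))"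
    using s by (simp flip: real_sqrt_mult)
  ultimately show ?thesis
    unfolding pk_def s_def[symmetric] times_divide_times_eq by simp
qed

lemma chapman_kolmogorov:
  assumes "a > 0" "b > 0"
  shows "integrable lborel (\<lambda>y. pk a x y * pk b y z)" "(LBINT y. pk a x y * pk b y z) = pk (a + b) x z"
proof -
  have p: "a * b / (a + b) > 0" using assms by simp
  show "integrable lborel (\<lambda>y. pk a x y * pk b y z)"
    unfolding pk_prod[OF assms] by (intro integrable_mult_right integrable_pk p)
  show "(LBINT y. pk a x y * pk b y z) = pk (a + b) x z"
    unfolding pk_prod[OF assms] by (simp add: integral_pk[OF p])
qed

section \<open>Heat kernels as measures and the smoothed sign\<close>

lemma sets_kern[measurable_cong, simp]: "sets (kern s x) = sets borel"
  by (simp add: kern_def)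

lemma space_kern[simp]: "space (kern s x) = UNIV"
  using sets_eq_imp_space_eq[OF sets_kern] by simp

lemma prob_space_kern:
  assumes "s \<ge> 0"
  shows "prob_space (kern s x)"
proof (cases "s = 0")
  case True
  then show ?thesis by (simp add: kern_def prob_space_return)
next
  case False
  with assms have "s > 0" by simp
  then show ?thesis
    using prob_space_normal_density[of "sqrt s" x] by (simp add: kern_def pk_normal_fun)
qed

lemma integral_kern_0:
  "f \<in> borel_measurable borel \<Longrightarrow> (\<integral>y. f y \<partial>kern 0 x) = (f x :: real)"
  by (simp add: kern_def integral_return)

lemma integral_kern_pos:
  assumes "s > 0" and f: "f \<in> borel_measurable borel"
  shows "(\<integral>y. f y \<partial>kern s x) = (LBINT y. pk s x y * f y :: real)"
  unfolding kern_def using assms by (simp add: integral_density pk_nonneg)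

text \<open>Mean sign of a Gaussian with mean \<open>u\<close> and variance \<open>s\<close>, that
  is erf(u / sqrt(2 s)), and the plain sign at variance 0.\<close>

definition esgn :: "real \<Rightarrow> real \<Rightarrow> real" where
  "esgn s u = (\<integral>v. sgn v \<partial>kern s u)"

lemma esgn_0: "esgn 0 u = sgn u"
  by (simp add: esgn_def integral_kern_0)

lemma esgn_pos: "s > 0 \<Longrightarrow> esgn s u = (LBINT v. pk s u v * sgn v)"
  by (simp add: esgn_def integral_kern_pos)

lemma borel_measurable_esgn[measurable (raw)]:
  assumes "s \<ge> 0" "f \<in> borel_measurable M"
  shows "(\<lambda>w. esgn s (f w)) \<in> borel_measurable M"
proof -
  have "esgn s \<in> borel_measurable borel"
  proof (cases "s = 0")
    case True
    then show ?thesis by (simp add: esgn_0[abs_def])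
  next
    case False
    with assms have s: "s > 0" by simp
    show ?thesis unfolding esgn_pos[OF s, abs_def] by measurable
  qed
  then show ?thesis using assms(2) by measurable
qed

lemma measurable_esgn: "s \<ge> 0 \<Longrightarrow> esgn s \<in> borel_measurable borel"
  by measurable

lemma esgn_bounded:
  assumes "s \<ge> 0"
  shows "\<bar>esgn s u\<bar> \<le> 1"
proof -
  interpret prob_space "kern s u" by (rule prob_space_kern[OF assms])
  have int: "integrable (kern s u) (\<lambda>v. sgn v :: real)"
    by (rule integrable_const_bound[where B=1]) (auto simp: sgn_if)
  have "\<bar>esgn s u\<bar> \<le> (\<integral>v. \<bar>sgn v\<bar> \<partial>kern s u)"
    unfolding esgn_def by (rule integral_abs_bound)
  also have "\<dots> \<le> (\<integral>v. 1 \<partial>kern s u)"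
    using int by (intro integral_mono integrable_abs) (auto simp: sgn_if)
  finally show ?thesis using prob_space by simp
qed

lemma lborel_integral_minus: "(LBINT x. f (- x)) = (LBINT x. f x :: real)"
  for f :: "real \<Rightarrow> real"
  using lborel_integral_real_affine[of "-1" f 0] by simp

lemma lborel_integral_shift: "(LBINT x. f (x + c)) = (LBINT x. f x :: real)"
  for f :: "real \<Rightarrow> real"
  using lborel_integral_real_affine[of 1 f c] by (simp add: add.commute)

lemma esgn_minus:
  assumes "s \<ge> 0"
  shows "esgn s (- u) = - esgn s u"
proof (cases "s = 0")
  case True
  then show ?thesis by (simp add: esgn_0 sgn_minus)
next
  case False
  with assms have s: "s > 0" by simp
  have "esgn s (- u) = (LBINT v. pk s (- u) (- v) * sgn (- v))"
    unfolding esgn_pos[OF s] using lborel_integral_minus[of "\<lambda>v. pk s (- u) v * sgn v"] by simp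
  then show ?thesis unfolding pk_minus esgn_pos[OF s] by (simp add: sgn_minus)
qed

lemma integrable_bounded_mult:
  fixes f g :: "'a \<Rightarrow> real"
  assumes "integrable M f" "g \<in> borel_measurable M" "\<And>x. \<bar>g x\<bar> \<le> B"
  shows "integrable M (\<lambda>x. g x * f x)" "integrable M (\<lambda>x. f x * g x)"
proof -
  have "\<bar>g x * f x\<bar> \<le> \<bar>B * f x\<bar>" for x
    using assms(3)[of x] by (auto simp: abs_mult intro!: mult_right_mono)
  then show "integrable M (\<lambda>x. g x * f x)"
    by (intro Bochner_Integration.integrable_bound[OF integrable_mult_right[OF assms(1), of B]])
       (use assms in auto)
  then show "integrable M (\<lambda>x. f x * g x)" by (simp add: mult.commute)
qed

text \<open>Tonelli for an integrable function times a kernel whose L1 norms are uniformly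
  bounded.\<close>

lemma integrable_pair_mult:
  fixes f :: "real \<Rightarrow> real" and g :: "real \<Rightarrow> real \<Rightarrow> real"
  assumes f: "integrable lborel f" and g[measurable]: "case_prod g \<in> borel_measurable (borel \<Otimes>\<^sub>M borel)"
    and gi: "\<And>x. integrable lborel (g x)" and B: "\<And>x. (LBINT y. \<bar>g x y\<bar>) \<le> B"
  shows "integrable (lborel \<Otimes>\<^sub>M lborel) (\<lambda>(x, y). f x * g x y)"
proof -
  have [measurable]: "f \<in> borel_measurable borel" using f by auto
  show ?thesis
  proof (rule lborel_pair.Fubini_integrable)
    show "(\<lambda>(x, y). f x * g x y) \<in> borel_measurable (lborel \<Otimes>\<^sub>M lborel)" by measurable
    have "\<bar>\<integral>y. \<bar>g x y\<bar> \<partial>lborel\<bar> \<le> B" for x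
      using B[of x] by (simp add: abs_of_nonneg)
    then have "integrable lborel (\<lambda>x. \<bar>f x\<bar> * (LBINT y. \<bar>g x y\<bar>))"
      by (intro integrable_bounded_mult(2)[where B=B] integrable_abs f) measurable
    then show "integrable lborel (\<lambda>x. \<integral>y. norm (case (x, y) of (x, y) \<Rightarrow> f x * g x y) \<partial>lborel)"
      by (simp add: abs_mult)
    show "AE x in lborel. integrable lborel (\<lambda>y. case (x, y) of (x, y) \<Rightarrow> f x * g x y)"
      using gi by simp
  qed
qed

lemma integrable_pair_bounded_mult:
  fixes f :: "real \<Rightarrow> real" and h k :: "real \<Rightarrow> real \<Rightarrow> real"
  assumes f: "integrable lborel f" and [measurable]: "case_prod h \<in> borel_measurable (borel \<Otimes>\<^sub>M borel)"
    "case_prod k \<in> borel_measurable (borel \<Otimes>\<^sub>M borel)"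
    and hB: "\<And>x y. \<bar>h x y\<bar> \<le> B"
    and k: "\<And>x. integrable lborel (k x)" and kC: "\<And>x. (LBINT y. \<bar>k x y\<bar>) \<le> C"
  shows "integrable (lborel \<Otimes>\<^sub>M lborel) (\<lambda>(x, y). f x * (h x y * k x y))"
proof (rule integrable_pair_mult[OF f, where B="B * C"])
  show int: "integrable lborel (\<lambda>y. h x y * k x y)" for x
    by (rule integrable_bounded_mult(1)[OF k _ hB]) measurable
  show "(LBINT y. \<bar>h x y * k x y\<bar>) \<le> B * C" for x
  proof -
    have "(LBINT y. \<bar>h x y * k x y\<bar>) \<le> (LBINT y. B * \<bar>k x y\<bar>)"
      using hB by (intro integral_mono integrable_abs int integrable_mult_right k) (auto simp: abs_mult mult_right_mono)
    also have "\<dots> \<le> B * C"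
      using kC[of x] order_trans[OF abs_ge_zero hB] by (simp add: mult_left_mono)
    finally show ?thesis .
  qed
qed measurable

lemma integral_abs_pk: "s > 0 \<Longrightarrow> (LBINT y. \<bar>pk s x y\<bar>) = 1"
  by (simp add: pk_nonneg integral_pk)

text \<open>A further independent Gaussian displacement adds its variance.\<close>

lemma esgn_heat:
  assumes r: "r > 0" and s: "s \<ge> 0"
  shows "(LBINT x. esgn s (x - y) * pk r z x) = esgn (s + r) (z - y)"
proof (cases "s = 0")
  case True
  have "(LBINT x. sgn (x - y) * pk r z x) = (LBINT x. sgn (x + y - y) * pk r z (x + y))"
    using lborel_integral_shift[of "\<lambda>x. sgn (x - y) * pk r z x" y] by simp
  then show ?thesis
    unfolding True esgn_0 using r by (simp add: esgn_pos pk_shift mult.commute)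
next
  case False
  with s have s: "s > 0" by simp
  have int: "integrable (lborel \<Otimes>\<^sub>M lborel) (\<lambda>(x, v). pk r z x * (sgn v * pk s (x - y) v))"
    by (rule integrable_pair_bounded_mult[where B=1 and C=1])
       (use s r in \<open>auto simp: integral_abs_pk sgn_if intro: integrable_pk\<close>)
  have "(LBINT x. esgn s (x - y) * pk r z x)
    = (LBINT x. (LBINT v. pk r z x * (sgn v * pk s (x - y) v)))"
    by (simp add: esgn_pos[OF s] mult.commute)
  also have "\<dots> = (LBINT v. (LBINT x. pk r z x * (sgn v * pk s (x - y) v)))"
    using lborel_pair.Fubini_integral[OF int] by simp
  also have "\<dots> = (LBINT v. sgn v * (LBINT x. pk r z x * pk s x (v + y)))"
    by (simp add: pk_shift mult_ac flip: integral_mult_right_zero)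
  also have "\<dots> = (LBINT v. sgn v * pk (r + s) (z - y) v)"
    by (simp add: chapman_kolmogorov(2)[OF r s] pk_shift)
  also have "\<dots> = esgn (s + r) (z - y)"
    using r s by (simp add: esgn_pos mult.commute add.commute)
  finally show ?thesis .
qed

lemma esgn_kern:
  assumes "r \<ge> 0" "s \<ge> 0"
  shows "(\<integral>x. esgn s (x - y) \<partial>kern r z) = esgn (s + r) (z - y)"
proof (cases "r = 0")
  case True
  then show ?thesis using assms by (simp add: integral_kern_0)
next
  case False
  then show ?thesis using assms esgn_heat[of r s y z] by (simp add: integral_kern_pos mult.commute)
qed

text \<open>With independent Z and W drawn from the kernels started at \<open>x\<close> and
  \<open>y\<close>, the two double integrals are the probabilities of Z < W and of W < Z. Their
  difference is the mean of sgn(W - Z), and the variances T - t m and T - t n add.\<close>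

lemma Fmn_esgn:
  assumes m: "t m \<le> T" and n: "t n \<le> T"
  shows "Fmn T t m n x y = esgn (2 * T - t m - t n) (y - x)"
proof -
  define a where "a = T - t m"
  define b where "b = T - t n"
  have ab: "a \<ge> 0" "b \<ge> 0" using m n by (simp_all add: a_def b_def)
  interpret A: prob_space "kern a x" by (rule prob_space_kern[OF ab(1)])
  interpret B: prob_space "kern b y" by (rule prob_space_kern[OF ab(2)])
  interpret P: pair_prob_space "kern b y" "kern a x" ..
  have i1: "integrable (kern a x) (\<lambda>z. indicator {..<w} z :: real)" for w
    by (rule A.integrable_const_bound[where B=1]) (auto simp: indicator_def)
  have i2: "integrable (kern a x) (\<lambda>z. indicator {..<z} w :: real)" for w
  proof (rule A.integrable_const_bound[where B=1])
    have "(\<lambda>z. indicator {..<z} w :: real) = indicator {w<..}" by (auto simp: indicator_def fun_eq_iff)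
    then show "(\<lambda>z. indicator {..<z} w :: real) \<in> borel_measurable (kern a x)" by simp
  qed (auto simp: indicator_def)
  have meas: "(\<lambda>(w :: real, z). indicator {..<z} w :: real) \<in> borel_measurable (borel \<Otimes>\<^sub>M borel)"
             "(\<lambda>(w :: real, z). indicator {..<w} z :: real) \<in> borel_measurable (borel \<Otimes>\<^sub>M borel)"
  proof -
    have "(\<lambda>(w :: real, z). indicator {..<z} w :: real) = (\<lambda>p. if fst p < snd p then 1 else 0)"
      by (auto simp: indicator_def fun_eq_iff)
    moreover have "(\<lambda>(w :: real, z). indicator {..<w} z :: real) = (\<lambda>p. if snd p < fst p then 1 else 0)"
      by (auto simp: indicator_def fun_eq_iff)
    moreover have "(\<lambda>p. if fst p < snd p then 1 else 0 :: real) \<in> borel_measurable ((borel :: real measure) \<Otimes>\<^sub>M borel)"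
      by measurable
    moreover have "(\<lambda>p. if snd p < fst p then 1 else 0 :: real) \<in> borel_measurable (borel \<Otimes>\<^sub>M (borel :: real measure))"
      by measurable
    ultimately show "(\<lambda>(w :: real, z). indicator {..<z} w :: real) \<in> borel_measurable (borel \<Otimes>\<^sub>M borel)"
             "(\<lambda>(w :: real, z). indicator {..<w} z :: real) \<in> borel_measurable (borel \<Otimes>\<^sub>M borel)"
      by (simp_all only:)
  qed
  have int2: "integrable (kern b y \<Otimes>\<^sub>M kern a x) (\<lambda>(w, z). indicator {..<z} w :: real)"
    by (rule P.integrable_const_bound[where B=1]) (auto simp: indicator_def meas cong: measurable_cong_sets)
  have int1: "integrable (kern b y \<Otimes>\<^sub>M kern a x) (\<lambda>(w, z). indicator {..<w} z :: real)"
    by (rule P.integrable_const_bound[where B=1]) (auto simp: indicator_def meas cong: measurable_cong_sets)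
  have "(\<integral>w. (\<integral>z. indicator {..<w} z \<partial>kern b y) \<partial>kern a x)
    = (\<integral>w. (\<integral>z. indicator {..<z} w \<partial>kern a x) \<partial>kern b y :: real)"
    using P.Fubini_integral[OF int2] by simp
  then have "Fmn T t m n x y = (\<integral>w. (\<integral>z. indicator {..<w} z \<partial>kern a x) \<partial>kern b y)
    - (\<integral>w. (\<integral>z. indicator {..<z} w \<partial>kern a x) \<partial>kern b y)"
    by (simp add: Fmn_def a_def b_def)
  also have "\<dots> = (\<integral>w. (\<integral>z. indicator {..<w} z \<partial>kern a x) - (\<integral>z. indicator {..<z} w \<partial>kern a x) \<partial>kern b y)"
    using P.integrable_fst[OF int1] P.integrable_fst[OF int2] by simp
  also have "\<dots> = (\<integral>w. - esgn a (x - w) \<partial>kern b y)"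
  proof (intro lint_cong refl)
    fix w
    have "(\<integral>z. indicator {..<w} z \<partial>kern a x) - (\<integral>z. indicator {..<z} w \<partial>kern a x)
      = (\<integral>z. indicator {..<w} z - indicator {..<z} w \<partial>kern a x :: real)"
      using i1 i2 by simp
    \<comment> \<open>The difference of the indicators is a sign; read as the variance 0 case, it
      lets \<open>esgn_kern\<close> absorb the two averages in turn.\<close>
    also have "\<dots> = (\<integral>z. - esgn 0 (z - w) \<partial>kern a x)"
      by (intro lint_cong refl) (auto simp: esgn_0 indicator_def sgn_if)
    also have "\<dots> = - esgn a (x - w)"
      using esgn_kern[of a 0 w x] esgn_kern[of a 0 x w] ab by simp
    finally show "(\<integral>z. indicator {..<w} z \<partial>kern a x) - (\<integral>z. indicator {..<z} w \<partial>kern a x) = - esgn a (x - w)" .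
  qed
  also have "\<dots> = (\<integral>w. esgn a (w - x) \<partial>kern b y)"
    using esgn_minus[OF ab(1)] by (metis (no_types, opaque_lifting) minus_diff_eq)
  also have "\<dots> = esgn (a + b) (y - x)"
    by (rule esgn_kern[OF ab(2,1)])
  also have "a + b = 2 * T - t m - t n" by (simp add: a_def b_def)
  finally show ?thesis .
qed

lemma integrable_kern:
  fixes f :: "real \<Rightarrow> real"
  assumes "r \<ge> 0" and f: "integrable lborel f"
  shows "integrable lborel (\<lambda>x. \<integral>u. f u \<partial>kern r x)"
proof -
  have fm[measurable]: "f \<in> borel_measurable borel" using f by auto
  show ?thesis
  proof (cases "r = 0")
    case True
    then show ?thesis using f by (simp add: integral_kern_0[OF fm])
  next
    case False
    with assms have r: "r > 0" by simp
    have "integrable (lborel \<Otimes>\<^sub>M lborel) (\<lambda>(u, x). f u * pk r u x)"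
      by (rule integrable_pair_mult[OF f, where B=1])
         (use r in \<open>auto intro: integrable_pk simp: pk_nonneg integral_pk\<close>)
    then have "integrable lborel (\<lambda>x. \<integral>u. f u * pk r u x \<partial>lborel)"
      using lborel_pair.integrable_snd by force
    moreover have "(LBINT u. f u * pk r u x) = (\<integral>u. f u \<partial>kern r x)" for x
      using r by (simp add: integral_kern_pos pk_sym[of r x] mult.commute)
    ultimately show ?thesis by simp
  qed
qed

text \<open>Symmetry of the heat kernel: smoothing is moved from an integrable factor to a bounded
  one, with the Dirac case r = 0 included.\<close>

lemma kern_dual:
  fixes f g :: "real \<Rightarrow> real"
  assumes "r \<ge> 0" and f: "integrable lborel f" and g[measurable]: "g \<in> borel_measurable borel"
    and B: "\<And>x. \<bar>g x\<bar> \<le> B"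
  shows "(LBINT x. g x * (\<integral>u. f u \<partial>kern r x)) = (LBINT u. f u * (\<integral>x. g x \<partial>kern r u))"
proof -
  have fm[measurable]: "f \<in> borel_measurable borel" using f by auto
  show ?thesis
  proof (cases "r = 0")
    case True
    then show ?thesis by (simp add: integral_kern_0[OF fm] integral_kern_0[OF g] mult.commute)
  next
    case False
    with assms have r: "r > 0" by simp
    have int: "integrable (lborel \<Otimes>\<^sub>M lborel) (\<lambda>(u, x). f u * (g x * pk r u x))"
      by (rule integrable_pair_bounded_mult[OF f, where C=1])
         (use r B in \<open>auto simp: integral_abs_pk intro: integrable_pk\<close>)
    have "(LBINT x. g x * (\<integral>u. f u \<partial>kern r x)) = (LBINT x. (LBINT u. f u * (g x * pk r u x)))"
      using r by (simp add: integral_kern_pos pk_sym[of r _ "_ :: real"] mult_ac flip: integral_mult_right_zero)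
    also have "\<dots> = (LBINT u. (LBINT x. f u * (g x * pk r u x)))"
      using lborel_pair.Fubini_integral[OF int] by simp
    also have "\<dots> = (LBINT u. f u * (\<integral>x. g x \<partial>kern r u))"
      using r by (simp add: integral_kern_pos mult.commute)
    finally show ?thesis .
  qed
qed

section \<open>Gaussian integration by parts and Hermite polynomials\<close>

lemma integrable_poly_pk:
  assumes v: "v > 0"
  shows "integrable lborel (\<lambda>y. poly p y * pk v \<mu> y)"
proof -
  define q where "q = pcompose p [:\<mu>, 1:]"
  have q: "poly p y = poly q (y - \<mu>)" for y by (simp add: q_def poly_pcompose)
  have s: "sqrt v > 0" using v by simp
  have "integrable lborel (\<lambda>y. \<Sum>k\<le>degree q. coeff q k * (pk v \<mu> y * (y - \<mu>) ^ k))"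
    unfolding pk_normal[OF v]
    by (intro Bochner_Integration.integrable_sum integrable_mult_right integrable_normal_moment s)
  moreover have "poly p y * pk v \<mu> y = (\<Sum>k\<le>degree q. coeff q k * (pk v \<mu> y * (y - \<mu>) ^ k))" for y
    unfolding q poly_altdef[of q] sum_distrib_right by (rule sum.cong) (simp_all add: mult_ac)
  ultimately show ?thesis by simp
qed

lemma tendsto_poly_pk_top:
  assumes v: "v > 0"
  shows "((\<lambda>y. poly p y * pk v \<mu> y) \<longlongrightarrow> 0) at_top"
proof -
  have mono: "((\<lambda>y. y ^ k * pk v \<mu> y) \<longlongrightarrow> 0) at_top" for k
  proof (rule Lim_null_comparison)
    \<comment> \<open>The constant comes from (y - \<mu> - v)^2 being nonnegative, which bounds the
      density by \<open>C * exp (- y)\<close>.\<close>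
    define C where "C = exp (\<mu> + v / 2) / sqrt (2 * pi * v)"
    show "\<forall>\<^sub>F y in at_top. norm (y ^ k * pk v \<mu> y) \<le> C * (y ^ k / exp y)"
    proof (rule eventually_mono[OF eventually_ge_at_top[of 0]])
      fix y :: real assume y: "0 \<le> y"
      have "0 \<le> (y - \<mu> - v)\<^sup>2 / (2 * v)" using v by simp
      also have "(y - \<mu> - v)\<^sup>2 / (2 * v) = (\<mu> - y)\<^sup>2 / (2 * v) - (y - \<mu>) + v / 2"
        using v by (simp add: power2_eq_square field_simps)
      finally have "- (\<mu> - y)\<^sup>2 / (2 * v) \<le> (\<mu> + v / 2) - y" by simp
      then have "exp (- (\<mu> - y)\<^sup>2 / (2 * v)) \<le> exp (\<mu> + v / 2) / exp y"
        by (simp flip: exp_diff)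
      then have "pk v \<mu> y \<le> C / exp y"
        unfolding pk_def C_def using v by (simp add: divide_simps)
      then have "y ^ k * pk v \<mu> y \<le> y ^ k * (C / exp y)"
        using y by (intro mult_left_mono) auto
      then show "norm (y ^ k * pk v \<mu> y) \<le> C * (y ^ k / exp y)"
        using y v by (simp add: pk_nonneg abs_mult mult_ac)
    qed
    show "((\<lambda>y. C * (y ^ k / exp y)) \<longlongrightarrow> 0) at_top"
      using tendsto_mult_right_zero[OF tendsto_power_div_exp_0] by blast
  qed
  have "((\<lambda>y. \<Sum>k\<le>degree p. coeff p k * (y ^ k * pk v \<mu> y)) \<longlongrightarrow> 0) at_top"
    by (intro tendsto_null_sum tendsto_mult_right_zero mono)
  moreover have "poly p y * pk v \<mu> y = (\<Sum>k\<le>degree p. coeff p k * (y ^ k * pk v \<mu> y))" for y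
    unfolding poly_altdef[of p] sum_distrib_right by (rule sum.cong) (simp_all add: mult_ac)
  ultimately show ?thesis by simp
qed

lemma tendsto_poly_pk_bot:
  assumes v: "v > 0"
  shows "((\<lambda>y. poly p y * pk v \<mu> y) \<longlongrightarrow> 0) at_bot"
proof -
  have "poly p (- y) * pk v \<mu> (- y) = poly (pcompose p [:0, -1:]) y * pk v (- \<mu>) y" for y
    using pk_minus[of v "- \<mu>" y] by (simp add: poly_pcompose)
  then show ?thesis
    unfolding filterlim_at_bot_mirror using tendsto_poly_pk_top[OF v] by simp
qed

text \<open>The polynomial factor of the derivative of \<open>p\<close> times the Gaussian density,
  see \<open>DERIV_poly_pk\<close>.\<close>

definition gpoly :: "real \<Rightarrow> real \<Rightarrow> real poly \<Rightarrow> real poly" where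
  "gpoly v \<mu> p = pderiv p - smult (1 / v) ([:- \<mu>, 1:] * p)"

lemma DERIV_poly_pk:
  assumes v: "v > 0"
  shows "((\<lambda>y. poly p y * pk v \<mu> y) has_real_derivative poly (gpoly v \<mu> p) y * pk v \<mu> y) (at y)"
proof -
  have "((\<lambda>y. exp (- (\<mu> - y)\<^sup>2 / (2 * v))) has_real_derivative
    exp (- (\<mu> - y)\<^sup>2 / (2 * v)) * (- (y - \<mu>) / v)) (at y)"
    by (rule derivative_eq_intros refl | use v in \<open>simp; fail\<close>)+ (use v in \<open>simp add: field_simps\<close>)
  from DERIV_cdivide[OF this, of "sqrt (2 * pi * v)"]
  have "((\<lambda>y. pk v \<mu> y) has_real_derivative pk v \<mu> y * (- (y - \<mu>) / v)) (at y)"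
    by (simp add: pk_def mult.commute[of v])
  from DERIV_mult[OF poly_DERIV this] show ?thesis
    unfolding gpoly_def by (rule DERIV_cong) (use v in \<open>simp add: field_simps\<close>)
qed

lemma integral_halflines:
  assumes v: "v > 0"
  shows "(LBINT u. indicator {c<..} u * (poly (gpoly v \<mu> p) u * pk v \<mu> u)) = - (poly p c * pk v \<mu> c)"
    and "(LBINT u. indicator {..<c} u * (poly (gpoly v \<mu> p) u * pk v \<mu> u)) = poly p c * pk v \<mu> c"
proof -
  let ?f = "\<lambda>u. poly (gpoly v \<mu> p) u * pk v \<mu> u" and ?F = "\<lambda>u. poly p u * pk v \<mu> u"
  have D: "(?F has_vector_derivative ?f x) (at x)" for x
    using DERIV_poly_pk[OF v] by (simp add: has_real_derivative_iff_has_vector_derivative)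
  have C: "isCont ?f x" for x
    unfolding pk_def using v by (intro continuous_intros) auto
  have I: "set_integrable lborel S ?f" if "S \<in> sets borel" for S
    using integrable_mult_indicator[OF _ integrable_poly_pk[OF v]] that
    unfolding set_integrable_def by simp
  have F: "(?F \<longlongrightarrow> ?F c) (at c within S)" for S
  proof -
    have "isCont ?F c" unfolding pk_def using v by (intro continuous_intros) auto
    then show ?thesis unfolding isCont_def by (rule tendsto_within_subset) simp
  qed
  have "(LBINT u=ereal c..\<infinity>. ?f u) = 0 - ?F c"
    by (rule interval_integral_FTC_integrable[OF _ D C I])
       (auto simp: ereal_tendsto_simps1 intro: F tendsto_poly_pk_top[OF v])
  then show "(LBINT u. indicator {c<..} u * ?f u) = - ?F c"
    by (simp add: interval_lebesgue_integral_def set_lebesgue_integral_def)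
  have "(LBINT u=-\<infinity>..ereal c. ?f u) = ?F c - 0"
    by (rule interval_integral_FTC_integrable[OF _ D C I])
       (auto simp: ereal_tendsto_simps1 intro: F tendsto_poly_pk_bot[OF v])
  then show "(LBINT u. indicator {..<c} u * ?f u) = ?F c"
    by (simp add: interval_lebesgue_integral_def set_lebesgue_integral_def)
qed

text \<open>Integration by parts: the sign jumps by 2 at \<open>c\<close>, so pairing it with a
  derivative evaluates the primitive there.\<close>

lemma integral_sgn_gpoly:
  assumes v: "v > 0"
  shows "(LBINT u. sgn (u - c) * (poly (gpoly v \<mu> p) u * pk v \<mu> u)) = - 2 * (poly p c * pk v \<mu> c)"
    and "(LBINT u. poly (gpoly v \<mu> p) u * pk v \<mu> u) = 0"
proof -
  let ?f = "\<lambda>u. poly (gpoly v \<mu> p) u * pk v \<mu> u"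
  have [measurable]: "(\<lambda>u. poly (gpoly v \<mu> p) u) \<in> borel_measurable borel"
    by (intro borel_measurable_continuous_onI continuous_intros)
  have I: "integrable lborel (\<lambda>u. indicator S u * ?f u)" if "S \<in> sets borel" for S :: "real set"
    using integrable_mult_indicator[OF _ integrable_poly_pk[OF v]] that by simp
  have "(LBINT u. sgn (u - c) * ?f u) = (LBINT u. indicator {c<..} u * ?f u - indicator {..<c} u * ?f u)"
    by (intro lint_cong) (auto simp: sgn_if indicator_def)
  also have "\<dots> = - (poly p c * pk v \<mu> c) - poly p c * pk v \<mu> c"
    using I integral_halflines[OF v] by simp
  finally show "(LBINT u. sgn (u - c) * ?f u) = - 2 * (poly p c * pk v \<mu> c)" by simp
  have "(LBINT u. ?f u) = (LBINT u. indicator {c<..} u * ?f u + indicator {..<c} u * ?f u)"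
    by (rule integral_cong_AE) (auto intro!: AE_I'[of "{c}"] simp: indicator_def)
  also have "\<dots> = - (poly p c * pk v \<mu> c) + poly p c * pk v \<mu> c"
    using I integral_halflines[OF v] by simp
  finally show "(LBINT u. ?f u) = 0" by simp
qed

lemma gaussian_stein:
  assumes v: "v > 0"
  shows "(LBINT y. poly ([:- \<mu>, 1:] * p) y * pk v \<mu> y) = v * (LBINT y. poly (pderiv p) y * pk v \<mu> y)"
proof -
  have "0 = (LBINT y. poly (pderiv p) y * pk v \<mu> y - (1 / v) * (poly ([:- \<mu>, 1:] * p) y * pk v \<mu> y))"
    using integral_sgn_gpoly(2)[OF v, of \<mu> p] by (simp add: gpoly_def algebra_simps)
  also have "\<dots> = (LBINT y. poly (pderiv p) y * pk v \<mu> y) - (1 / v) * (LBINT y. poly ([:- \<mu>, 1:] * p) y * pk v \<mu> y)"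
    by (subst Bochner_Integration.integral_diff)
       (intro integrable_mult_right integrable_poly_pk[OF v] | simp)+
  finally show ?thesis using v by (simp add: field_simps)
qed

text \<open>Monic Hermite polynomials orthogonal for the Gaussian of variance \<open>V\<close>,
  generated by the raising operator; \<open>hpoly_herm\<close> relates them to
  \<open>herm\<close>.\<close>

primrec hpoly :: "real \<Rightarrow> nat \<Rightarrow> real poly" where
  "hpoly V 0 = 1"
| "hpoly V (Suc n) = [:0, 1:] * hpoly V n - smult V (pderiv (hpoly V n))"

lemma pderiv_hpoly: "pderiv (hpoly V n) = smult (real n) (hpoly V (n - 1))"
proof (induction n)
  case (Suc n)
  have "pderiv (hpoly V (Suc n)) = hpoly V n + [:0, 1:] * pderiv (hpoly V n) - smult V (pderiv (pderiv (hpoly V n)))"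
    by (simp add: pderiv_mult pderiv_diff pderiv_smult pderiv_pCons)
  also have "\<dots> = hpoly V n + smult (real n) ([:0, 1:] * hpoly V (n - 1) - smult V (pderiv (hpoly V (n - 1))))"
    unfolding Suc by (simp add: pderiv_smult smult_diff_right mult.commute)
  also have "\<dots> = hpoly V n + smult (real n) (hpoly V n)"
    by (cases n) simp_all
  finally show ?case by (simp add: algebra_simps smult_add_left)
qed (simp add: pderiv_1)

lemma hpoly_monic: "degree (hpoly V n) = n \<and> coeff (hpoly V n) n = 1"
proof (induction n)
  case (Suc n)
  have d: "degree (pderiv (hpoly V n)) < Suc n"
    using Suc by (simp add: degree_pderiv)
  have "coeff (hpoly V (Suc n)) (Suc n) = 1"
    using Suc d by (simp add: coeff_pCons coeff_eq_0)
  moreover have "degree (hpoly V (Suc n)) \<le> Suc n"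
    unfolding hpoly.simps using Suc d
    by (intro degree_diff_le) (auto intro: order_trans[OF degree_pCons_le] order_trans[OF degree_smult_le])
  ultimately show ?case
    by (metis le_antisym le_degree one_neq_zero)
qed simp

lemma hpoly_herm:
  assumes "c \<noteq> 0"
  shows "poly (hpoly (c\<^sup>2 / 2) n) x = (c / 2) ^ n * herm n (x / c)"
proof (induction n rule: induct_nat_012)
  case (ge2 n)
  have "poly (hpoly (c\<^sup>2 / 2) (Suc (Suc n))) x
    = x * poly (hpoly (c\<^sup>2 / 2) (Suc n)) x - (c\<^sup>2 / 2) * real (Suc n) * poly (hpoly (c\<^sup>2 / 2) n) x"
    unfolding hpoly.simps(2)[of _ "Suc n"] pderiv_hpoly by simp
  also have "\<dots> = (c / 2) ^ Suc (Suc n) * herm (Suc (Suc n)) (x / c)"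
  proof -
    have "x * ((c / 2) ^ Suc n * A) - (c\<^sup>2 / 2) * real (Suc n) * ((c / 2) ^ n * B)
      = (c / 2) ^ Suc (Suc n) * (2 * (x / c) * A - 2 * real (Suc n) * B)" for A B
      using assms by (simp add: power2_eq_square field_simps)
    then show ?thesis unfolding ge2 herm.simps(3) .
  qed
  finally show ?case .
qed (use assms in \<open>simp_all add: pderiv_1\<close>)

text \<open>Hermite polynomials are eigenfunctions of the Ornstein-Uhlenbeck semigroup: for jointly
  Gaussian variables of variance \<open>V\<close> and correlation \<open>\<rho>\<close>, the
  conditional law given \<open>x\<close> has mean \<open>\<rho> * x\<close> and variance
  \<open>V * (1 - \<rho>\<^sup>2)\<close>.\<close>

lemma hpoly_conditional:
  assumes v: "v > 0" and V: "v = V * (1 - \<rho>\<^sup>2)"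
  shows "(LBINT y. poly (hpoly V n) y * pk v (\<rho> * x) y) = \<rho> ^ n * poly (hpoly V n) x"
proof (induction n rule: less_induct)
  case (less n)
  show ?case
  proof (cases n)
    case 0
    then show ?thesis by (simp add: integral_pk[OF v])
  next
    case (Suc m)
    let ?I = "\<lambda>p. \<integral>y. poly p y * pk v (\<rho> * x) y \<partial>lborel"
    have i: "integrable lborel (\<lambda>y. poly p y * pk v (\<rho> * x) y)" for p
      by (rule integrable_poly_pk[OF v])
    have "?I (hpoly V n) = (LBINT y. poly ([:- (\<rho> * x), 1:] * hpoly V m) y * pk v (\<rho> * x) y
      + (\<rho> * x) * (poly (hpoly V m) y * pk v (\<rho> * x) y) - V * (poly (pderiv (hpoly V m)) y * pk v (\<rho> * x) y))"
      by (intro lint_cong) (simp_all add: Suc algebra_simps)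
    also have "\<dots> = ?I ([:- (\<rho> * x), 1:] * hpoly V m) + (\<rho> * x) * ?I (hpoly V m) - V * ?I (pderiv (hpoly V m))"
      using i[of "[:- (\<rho> * x), 1:] * hpoly V m"] i[of "hpoly V m"] i[of "pderiv (hpoly V m)"]
      by (simp del: poly_mult)
    also have "\<dots> = (\<rho> * x) * ?I (hpoly V m) + (v - V) * ?I (pderiv (hpoly V m))"
      unfolding gaussian_stein[OF v] by (simp add: algebra_simps)
    also have "?I (pderiv (hpoly V m)) = real m * ?I (hpoly V (m - 1))"
      unfolding pderiv_hpoly by (simp add: mult.assoc)
    also have "real m * ?I (hpoly V (m - 1)) = real m * (\<rho> ^ (m - 1) * poly (hpoly V (m - 1)) x)"
      using less[of "m - 1"] Suc by (cases m) simp_all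
    also have "?I (hpoly V m) = \<rho> ^ m * poly (hpoly V m) x"
      using less[of m] Suc by simp
    also have "(\<rho> * x) * (\<rho> ^ m * poly (hpoly V m) x) + (v - V) * (real m * (\<rho> ^ (m - 1) * poly (hpoly V (m - 1)) x))
      = \<rho> ^ n * poly (hpoly V n) x"
      unfolding Suc hpoly.simps pderiv_hpoly V
      by (cases m) (simp_all add: power2_eq_square algebra_simps)
    finally show ?thesis .
  qed
qed

lemma hpoly_orthogonal:
  assumes V: "V > 0"
  shows "(LBINT y. poly (hpoly V m * hpoly V n) y * pk V 0 y) = (if m = n then V ^ n * fact n else 0)"
proof -
  let ?I = "\<lambda>p. \<integral>y. poly p y * pk V 0 y \<partial>lborel"
  have i: "integrable lborel (\<lambda>y. poly p y * pk V 0 y)" for p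
    by (rule integrable_poly_pk[OF V])
  \<comment> \<open>By Stein's identity the raising operator is adjoint to \<open>V\<close> times
    differentiation.\<close>
  have rec: "?I (p * hpoly V (Suc n)) = V * ?I (pderiv p * hpoly V n)" for p n
  proof -
    have lin: "(LBINT y. poly a y * pk V 0 y - V * (poly b y * pk V 0 y)) = ?I a - V * ?I b" for a b
      using i[of a] i[of b] by simp
    have "?I (p * hpoly V (Suc n)) = (LBINT y. poly ([:- 0, 1:] * (p * hpoly V n)) y * pk V 0 y
      - V * (poly (p * pderiv (hpoly V n)) y * pk V 0 y))"
      by (intro lint_cong) (simp_all add: algebra_simps)
    also have "\<dots> = V * ?I (pderiv (p * hpoly V n)) - V * ?I (p * pderiv (hpoly V n))"
      unfolding lin gaussian_stein[OF V] ..
    also have "?I (pderiv (p * hpoly V n)) = ?I (p * pderiv (hpoly V n)) + ?I (pderiv p * hpoly V n)"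
      using i[of "p * pderiv (hpoly V n)"] i[of "pderiv p * hpoly V n"]
      by (simp add: pderiv_mult distrib_right mult.commute[of _ "pderiv p"] del: poly_mult)
    finally show ?thesis by (simp add: algebra_simps)
  qed
  show ?thesis
  proof (induction n arbitrary: m)
    case 0
    show ?case
    proof (cases m)
      case (Suc k)
      then show ?thesis using rec[of 1 k] by (simp add: pderiv_1)
    qed (simp add: integral_pk[OF V])
  next
    case (Suc n)
    have "?I (hpoly V m * hpoly V (Suc n)) = V * (real m * ?I (hpoly V (m - 1) * hpoly V n))"
      unfolding rec pderiv_hpoly by (simp add: mult.assoc)
    then show ?case using Suc[of "m - 1"] by (cases m) auto
  qed
qed

section \<open>Integral identities for the matrix kernel\<close>

text \<open>A form of \<open>Rpoly\<close> adapted to integration by parts: an odd polynomial times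
  the Gaussian of variance \<open>s\<close> is \<open>- s\<close> times the derivative of the
  preceding even one times that Gaussian. The variance \<open>V\<close> satisfies 1/V = 1/s + 1/(2T
  - s).\<close>

definition R_poly :: "real \<Rightarrow> real \<Rightarrow> nat \<Rightarrow> real poly" where
  "R_poly T s k = (let V = s * (2 * T - s) / (2 * T) in
     if even k then hpoly V k else smult (- s) (gpoly s 0 (hpoly V (k - 1))))"

lemma R_poly_even: "even k \<Longrightarrow> R_poly T s k = hpoly (s * (2 * T - s) / (2 * T)) k"
  by (simp add: R_poly_def)

lemma poly_R_poly_odd:
  assumes "s > 0" "odd k"
  shows "poly (R_poly T s k) y = y * poly (hpoly (s * (2 * T - s) / (2 * T)) (k - 1)) y
    - s * (real (k - 1) * poly (hpoly (s * (2 * T - s) / (2 * T)) (k - 1 - 1)) y)"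
proof -
  have "poly (smult (- s) (gpoly s 0 h)) y = y * poly h y - s * poly (pderiv h) y" for h
    using assms by (simp add: gpoly_def algebra_simps)
  then show ?thesis
    using assms unfolding R_poly_def Let_def by (simp only: if_False pderiv_hpoly poly_smult)
qed

lemma R_poly_monic:
  assumes "s > 0"
  shows "degree (R_poly T s k) = k \<and> coeff (R_poly T s k) k = 1"
proof (cases "even k")
  case True
  then show ?thesis using hpoly_monic by (simp add: R_poly_def Let_def)
next
  case False
  then obtain m where k: "k = Suc m" by (cases k) auto
  define h where "h = hpoly (s * (2 * T - s) / (2 * T)) m"
  have h: "degree h = m" "coeff h m = 1" using hpoly_monic by (simp_all add: h_def)
  have R: "R_poly T s k = pCons 0 h - smult s (pderiv h)"
    using False assms by (simp add: R_poly_def Let_def k gpoly_def h_def[symmetric] smult_diff_right)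
  have d: "degree (pderiv h) < Suc m" using h by (simp add: degree_pderiv)
  have "coeff (R_poly T s k) k = 1"
    unfolding R using h d by (simp add: k coeff_eq_0)
  moreover have "degree (R_poly T s k) \<le> k"
    unfolding R using h d k
    by (intro degree_diff_le) (auto intro: order_trans[OF degree_pCons_le] order_trans[OF degree_smult_le])
  ultimately show ?thesis
    by (metis le_antisym le_degree one_neq_zero)
qed

text \<open>The squares of \<open>c1\<close> and \<open>z1\<close> are 2V and (2T - s)/s. For even
  degree only a rescaled Hermite polynomial remains; for odd degree the second term of
  \<open>alpha\<close> turns x h - V h' into x h - s h', because V + V / z1^2 = s.\<close>

lemma Rpoly_eq:
  assumes s: "0 < s" "s < T"
  shows "Rpoly T s k x = poly (R_poly T s k) x"
proof -
  define c where "c = c1 T s"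
  define z where "z = z1 T s"
  define V where "V = s * (2 * T - s) / (2 * T)"
  have c2: "c\<^sup>2 = s * (2 * T - s) / T" and c: "c \<noteq> 0" using s by (auto simp: c_def c1_def)
  have z2: "z\<^sup>2 = (2 * T - s) / s" and z: "z \<noteq> 0" using s by (auto simp: z_def z1_def)
  have V: "V = c\<^sup>2 / 2" by (simp add: V_def c2)
  have H: "poly (hpoly V n) x = (c / 2) ^ n * herm n (x / c)" for n
    unfolding V by (rule hpoly_herm[OF c])
  show ?thesis
  proof (cases "even k")
    case True
    have "(\<Sum>j\<in>{0..k}. alpha T s k j * herm j (x / c) * z ^ j)
      = (\<Sum>j\<in>{0..k}. if k = j then (c / 2) ^ k * herm k (x / c) * z ^ k else 0)"
      using True by (intro sum.cong refl) (simp add: alpha_def c_def power_divide)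
    then show ?thesis
      using True z unfolding Rpoly_def c_def[symmetric] z_def[symmetric]
      by (simp add: R_poly_def Let_def V_def[symmetric] H)
  next
    case False
    then obtain m where k: "k = Suc m" "even m" by (cases k) auto
    define X where "X j = herm j (x / c) * z ^ j" for j
    have "(\<Sum>j\<in>{0..k}. alpha T s k j * herm j (x / c) * z ^ j)
      = (\<Sum>j\<in>{0..k}. (c / 2) ^ k * (if k = j then X k else 0)
      - (c / 2) ^ k * (2 * real m) * (if j + 2 = k then X (k - 2) else 0))"
      using False by (intro sum.cong refl) (auto simp: alpha_def c_def X_def power_divide k algebra_simps)
    also have "\<dots> = (c / 2) ^ k * X k - (c / 2) ^ k * (2 * real m) * X (k - 2)"
    \<comment> \<open>For \<open>k = 1\<close> the truncated index \<open>k - 2\<close> is 0, which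
      is harmless because the factor \<open>real m\<close> vanishes.\<close>
    proof (cases "m = 0")
      case False
      then have e: "(j + 2 = k) = (j = k - 2)" for j using k by (cases m) auto
      show ?thesis unfolding sum_subtractf sum_distrib_left[symmetric] e by (simp add: k)
    qed (simp add: k sum_subtractf flip: sum_distrib_left)
    finally have "Rpoly T s k x = inverse (z ^ k) * ((c / 2) ^ k * X k - (c / 2) ^ k * (2 * real m) * X (k - 2))"
      unfolding Rpoly_def c_def[symmetric] z_def[symmetric] by simp
    also have "\<dots> = (c / 2) ^ k * herm k (x / c) - real m * (V / z\<^sup>2) * ((c / 2) ^ (m - 1) * herm (m - 1) (x / c))"
    proof (cases "m = 0")
      case True
      then show ?thesis using z by (simp add: X_def k)
    next
      case False
      then obtain i where m: "m = Suc i" by (cases m) auto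
      show ?thesis using z c unfolding k m X_def V
        by (simp add: field_simps power2_eq_square)
    qed
    also have "\<dots> = poly (hpoly V k) x - real m * (V / z\<^sup>2) * poly (hpoly V (m - 1)) x"
      by (simp only: H)
    also have "\<dots> = x * poly (hpoly V m) x - (V + V / z\<^sup>2) * (real m * poly (hpoly V (m - 1)) x)"
      unfolding k hpoly.simps pderiv_hpoly by (simp add: algebra_simps)
    also have "V + V / z\<^sup>2 = s"
      unfolding z2 V_def using s by (simp add: field_simps)
    also have "x * poly (hpoly V m) x - s * (real m * poly (hpoly V (m - 1)) x) = poly (R_poly T s k) x"
      using poly_R_poly_odd[OF s(1) False, of T x] k by (simp add: V_def)
    finally show ?thesis .
  qed
qed

lemma poly_hpoly_minus: "poly (hpoly V n) (- x) = (-1) ^ n * poly (hpoly V n) x"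
proof (induction n rule: less_induct)
  case (less n)
  show ?case
  proof (cases n)
    case (Suc m)
    then have 1: "poly (hpoly V m) (- x) = (-1) ^ m * poly (hpoly V m) x"
      and 2: "poly (hpoly V (m - 1)) (- x) = (-1) ^ (m - 1) * poly (hpoly V (m - 1)) x"
      using less by auto
    have "poly (pderiv (hpoly V m)) (- x) = - ((-1) ^ m * poly (pderiv (hpoly V m)) x)"
      unfolding pderiv_hpoly using 2 by (cases m) (simp_all del: hpoly.simps)
    then show ?thesis
      unfolding Suc hpoly.simps by (simp add: 1 algebra_simps)
  qed simp
qed

lemma poly_R_poly_minus: "s > 0 \<Longrightarrow> poly (R_poly T s k) (- x) = (-1) ^ k * poly (R_poly T s k) x"
proof (cases k)
  case (Suc m)
  assume s: "s > 0"
  define V where "V = s * (2 * T - s) / (2 * T)"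
  show ?thesis
  proof (cases "even k")
    case False
    then have R: "poly (R_poly T s k) y = y * poly (hpoly V m) y - s * (real m * poly (hpoly V (m - 1)) y)" for y
      using poly_R_poly_odd[OF s False, of T y] Suc by (simp add: V_def)
    show ?thesis unfolding R poly_hpoly_minus using False Suc by (cases m) auto
  qed (simp add: R_poly_def Let_def poly_hpoly_minus)
qed (simp add: R_poly_def Let_def)

text \<open>Legendre's duplication formula at k + 1/2.\<close>

lemma Gamma_half_double: "Gamma (real k + 1 / 2) * Gamma (real k + 1) = fact (2 * k) * sqrt pi / 4 ^ k"
proof (induction k)
  case 0
  then show ?case by (simp add: Gamma_one_half_real)
next
  case (Suc k)
  have "Gamma (real k + 1 / 2 + 1) = (real k + 1 / 2) * Gamma (real k + 1 / 2)"
    by (rule Gamma_plus1) (auto dest: nonpos_Ints_nonpos)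
  moreover have "Gamma (real k + 1 + 1) = (real k + 1) * Gamma (real k + 1)"
    by (rule Gamma_plus1) (auto dest: nonpos_Ints_nonpos)
  ultimately have "Gamma (real (Suc k) + 1 / 2) * Gamma (real (Suc k) + 1)
    = (real k + 1 / 2) * (real k + 1) * (Gamma (real k + 1 / 2) * Gamma (real k + 1))"
    by (simp add: add_ac)
  then show ?case unfolding Suc by (simp add: field_simps)
qed

text \<open>The shape in which the constant arises in \<open>skewprod_even_odd\<close>: 2s from the
  integration by parts, the value \<open>pk (2 * T) 0 0\<close>, and a Hermite norm times a power of
  the correlation.\<close>

lemma rcoef_eq:
  assumes "s > 0" "T > 0"
  shows "rcoef T s k = 2 * s * (1 / sqrt (2 * pi * (2 * T))) * ((s\<^sup>2 / (2 * T)) ^ (2 * k) * fact (2 * k))"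
proof -
  have "rcoef T s k = fact (2 * k) * sqrt pi / 4 ^ k / pi * (s\<^sup>2 / T) powr (2 * real k + 1 / 2)"
    unfolding rcoef_def Gamma_half_double ..
  also have "(s\<^sup>2 / T) powr (2 * real k + 1 / 2) = (s\<^sup>2 / T) ^ (2 * k) * (s / sqrt T)"
  proof -
    have "(s\<^sup>2 / T) powr (2 * real k + 1 / 2) = (s\<^sup>2 / T) powr real (2 * k) * (s\<^sup>2 / T) powr (1 / 2)"
      by (simp add: powr_add)
    also have "(s\<^sup>2 / T) powr (1 / 2) = s / sqrt T"
      using assms by (simp add: powr_half_sqrt real_sqrt_divide)
    also have "(s\<^sup>2 / T) powr real (2 * k) = (s\<^sup>2 / T) ^ (2 * k)"
      using assms by (subst powr_realpow) auto
    finally show ?thesis .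
  qed
  also have "(s\<^sup>2 / T) ^ (2 * k) = 4 ^ k * (s\<^sup>2 / (2 * T)) ^ (2 * k)"
  proof -
    have "(s\<^sup>2 / T) = 2 * (s\<^sup>2 / (2 * T))" by simp
    then have "(s\<^sup>2 / T) ^ (2 * k) = 2 ^ (2 * k) * (s\<^sup>2 / (2 * T)) ^ (2 * k)"
      by (metis power_mult_distrib)
    then show ?thesis by (simp add: power_mult)
  qed
  also have "fact (2 * k) * sqrt pi / 4 ^ k / pi * (4 ^ k * (s\<^sup>2 / (2 * T)) ^ (2 * k) * (s / sqrt T))
    = (sqrt pi / pi) * (s / sqrt T) * ((s\<^sup>2 / (2 * T)) ^ (2 * k) * fact (2 * k))"
    by (simp add: field_simps)
  also have "(sqrt pi / pi) * (s / sqrt T) = 2 * s * (1 / sqrt (2 * pi * (2 * T)))"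
  proof -
    have "sqrt (2 * pi * (2 * T)) = 2 * (sqrt pi * sqrt T)"
      using real_sqrt_mult[of 4 "pi * T"] by (simp add: real_sqrt_mult mult_ac)
    moreover have "sqrt pi / pi = 1 / sqrt pi"
      using real_sqrt_mult_self[of pi] by (simp add: field_simps)
    ultimately show ?thesis by simp
  qed
  finally show ?thesis .
qed

lemma Fmn_swap: "Fmn T t m n x y = - Fmn T t n m y x"
  by (simp add: Fmn_def)

section \<open>Semigroup identities for the functions \<open>Rm\<close> and
  \<open>Phi\<close>\<close>

locale time_grid =
  fixes M :: nat and T :: real and t :: "nat \<Rightarrow> real"
  assumes T: "T > 0" and M: "M \<ge> 1" and t0: "t 0 = 0"
    and t_step: "\<And>m. m \<le> M \<Longrightarrow> t m < t (m + 1)" and t_last: "t (M + 1) = T"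
begin

abbreviation "gap m n \<equiv> 2 * T - t m - t n"

lemma t_less: "m < n \<Longrightarrow> n \<le> M + 1 \<Longrightarrow> t m < t n"
proof (induction n)
  case (Suc n)
  then show ?case using t_step[of n] by (cases "m = n") auto
qed simp

lemma t_le: "m \<le> n \<Longrightarrow> n \<le> M + 1 \<Longrightarrow> t m \<le> t n"
  using t_less[of m n] by (cases "m = n") auto

lemma t_le_T: "m \<le> M + 1 \<Longrightarrow> t m \<le> T"
  using t_le[of m "M + 1"] t_last by simp

lemma t1_pos: "0 < t 1" and t1_less: "t 1 < T"
  using t_less[of 0 1] t_less[of 1 "M + 1"] t0 t_last M by auto

definition psi :: "nat \<Rightarrow> real \<Rightarrow> real" where
  "psi k y = Rpoly T (t 1) k y * pk (t 1) 0 y"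

lemma psi_poly: "psi k y = poly (R_poly T (t 1) k) y * pk (t 1) 0 y"
  using t1_pos t1_less by (simp add: psi_def Rpoly_eq)

lemma integrable_psi: "integrable lborel (psi k)"
  using integrable_poly_pk[OF t1_pos] by (simp add: psi_poly[abs_def])

lemma measurable_psi[measurable]: "psi k \<in> borel_measurable borel"
  using integrable_psi[of k] by auto

lemma Rm_psi: "Rm T t m k x = (\<integral>u. psi k u \<partial>kern (t m - t 1) x)"
  by (simp add: Rm_def psi_def)

lemma Rm_1: "Rm T t 1 k x = psi k x"
  by (simp add: Rm_psi integral_kern_0)

lemma Fmn_eq: "m \<le> M + 1 \<Longrightarrow> n \<le> M + 1 \<Longrightarrow> Fmn T t m n x y = esgn (gap m n) (y - x)"
  by (intro Fmn_esgn t_le_T)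

lemma integrable_Rm: "1 \<le> m \<Longrightarrow> m \<le> M + 1 \<Longrightarrow> integrable lborel (Rm T t m k)"
  unfolding Rm_psi[abs_def] using t_le[of 1 m] by (intro integrable_kern integrable_psi) auto

text \<open>The heat kernel inside \<open>Rm\<close> moves onto the smoothed sign and adds
  \<open>t m - t 1\<close> to its variance, so the dependence on \<open>m\<close> cancels.\<close>

lemma Fmn_Rm:
  assumes m: "1 \<le> m" "m \<le> M + 1" and n: "n \<le> M + 1"
  shows "(LBINT z. Fmn T t n m y z * Rm T t m k z)
    = - (LBINT u. psi k u * esgn (gap n 1) (y - u))"
proof -
  have e: "2 * T - t n - t m + (t m - t 1) = 2 * T - t n - t 1" by simp
  have s: "0 \<le> 2 * T - t n - t m" and r: "0 \<le> t m - t 1" and s': "0 \<le> 2 * T - t n - t 1"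
    using t_le_T[OF n] t_le_T[OF m(2)] t_le[of 1 m] m t1_less by auto
  have "(LBINT z. Fmn T t n m y z * Rm T t m k z)
    = (LBINT z. esgn (gap n m) (z - y) * (\<integral>u. psi k u \<partial>kern (t m - t 1) z))"
    using m n by (simp add: Fmn_eq Rm_psi)
  also have "\<dots> = (LBINT u. psi k u * (\<integral>z. esgn (gap n m) (z - y) \<partial>kern (t m - t 1) u))"
    by (rule kern_dual[OF r integrable_psi _ esgn_bounded[OF s]]) (use measurable_esgn[OF s, measurable] in measurable)
  also have "\<dots> = (LBINT u. psi k u * esgn (gap n 1) (u - y))"
    unfolding esgn_kern[OF r s] e ..
  also have "\<dots> = (LBINT u. - (psi k u * esgn (gap n 1) (y - u)))"
  proof (intro lint_cong refl)
    fix u show "psi k u * esgn (gap n 1) (u - y) = - (psi k u * esgn (gap n 1) (y - u))"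
      using esgn_minus[OF s', of "y - u"] by simp
  qed
  finally show ?thesis by simp
qed

lemma Phi_eq:
  assumes m: "1 \<le> m" "m \<le> M + 1"
  shows "Phi T t m k x = (LBINT u. psi k u * esgn (gap m 1) (x - u))"
proof -
  have "Phi T t m k x = (LBINT y. - (Fmn T t m m x y * Rm T t m k y))"
    unfolding Phi_def by (intro lint_cong refl) (subst Fmn_swap, simp)
  then show ?thesis using Fmn_Rm[OF m m(2), of x k] by simp
qed

lemma integral_Fmn_Rm:
  assumes "1 \<le> m" "m \<le> M + 1" "1 \<le> n" "n \<le> M + 1"
  shows "(LBINT z. Fmn T t n m y z * Rm T t m k z) = - Phi T t n k y"
  using Fmn_Rm[OF assms(1,2,4)] Phi_eq[OF assms(3,4)] by simp

lemma measurable_Phi: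
  assumes m: "1 \<le> m" "m \<le> M + 1"
  shows "Phi T t m k \<in> borel_measurable borel"
proof -
  have s: "0 \<le> 2 * T - t m - t 1" using t_le_T[OF m(2)] t1_less by simp
  note [measurable] = measurable_esgn[OF s]
  show ?thesis unfolding Phi_eq[OF m, abs_def] by measurable
qed

lemma Phi_bounded:
  assumes m: "1 \<le> m" "m \<le> M + 1"
  shows "\<bar>Phi T t m k x\<bar> \<le> (LBINT u. \<bar>psi k u\<bar>)"
proof -
  have s: "0 \<le> 2 * T - t m - t 1" using t_le_T[OF m(2)] t1_less by simp
  have "\<bar>Phi T t m k x\<bar> \<le> (LBINT u. \<bar>psi k u * esgn (gap m 1) (x - u)\<bar>)"
    unfolding Phi_eq[OF m] by (rule integral_abs_bound)
  also have "\<dots> \<le> (LBINT u. \<bar>psi k u\<bar>)"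
    using esgn_bounded[OF s] mult_left_le[of _ "\<bar>psi k _\<bar>"]
    by (intro integral_mono' integrable_abs integrable_psi) (auto simp: abs_mult)
  finally show ?thesis .
qed

lemma integral_Fmn_pk:
  assumes "l < m" "m \<le> M + 1" "n \<le> M + 1"
  shows "(LBINT z. Fmn T t n m y z * pk (t m - t l) y' z) = Fmn T t n l y y'"
proof -
  have e: "2 * T - t n - t m + (t m - t l) = 2 * T - t n - t l" by simp
  have "0 < t m - t l" "0 \<le> 2 * T - t n - t m"
    using t_less[of l m] t_le_T[of n] t_le_T[of m] assms by auto
  from esgn_heat[OF this, of y y', unfolded e] show ?thesis
    using assms by (simp add: Fmn_eq)
qed

lemma integral_pk_pk:
  assumes "l < m" "m < n" "n \<le> M + 1"
  shows "(LBINT z. pk (t n - t m) z y * pk (t m - t l) y' z) = pk (t n - t l) y' y"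
  using chapman_kolmogorov(2)[of "t m - t l" "t n - t m" y' y] t_less[of l m] t_less[of m n] assms
  by (simp add: mult.commute)

lemma integral_pk_Rm:
  assumes m: "1 \<le> m" "m < n" "n \<le> M + 1"
  shows "(LBINT z. pk (t n - t m) z y * Rm T t m k z) = Rm T t n k y"
proof -
  have r: "0 < t n - t m" "0 \<le> t m - t 1" using t_less[of m n] t_le[of 1 m] m by auto
  have "(LBINT z. pk (t n - t m) z y * Rm T t m k z)
    = (LBINT u. psi k u * (\<integral>z. pk (t n - t m) z y \<partial>kern (t m - t 1) u))"
    unfolding Rm_psi
  proof (rule kern_dual[OF r(2) integrable_psi])
    show "\<bar>pk (t n - t m) z y\<bar> \<le> 1 / sqrt (2 * pi * (t n - t m))" for z
      using pk_bounded[OF r(1), of z y] pk_nonneg[OF r(1), of z y] by simp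
  qed measurable
  also have "(\<lambda>u. \<integral>z. pk (t n - t m) z y \<partial>kern (t m - t 1) u) = (\<lambda>u. pk (t n - t 1) y u)"
  proof
    fix u
    show "(\<integral>z. pk (t n - t m) z y \<partial>kern (t m - t 1) u) = pk (t n - t 1) y u"
    proof (cases "m = 1")
      case True
      then show ?thesis by (simp add: integral_kern_0 pk_sym)
    next
      case False
      then have "0 < t m - t 1" using t_less[of 1 m] m by auto
      then show ?thesis
        using chapman_kolmogorov(2)[of "t m - t 1" "t n - t m" u y] r
        by (simp add: integral_kern_pos pk_sym[of _ u y])
    qed
  qed
  also have "(LBINT u. psi k u * pk (t n - t 1) y u) = Rm T t n k y"
    unfolding Rm_psi using t_less[of 1 n] m by (simp add: integral_kern_pos mult.commute)
  finally show ?thesis .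
qed

lemma integral_Phi_kern:
  assumes l: "1 \<le> l" "l \<le> m" "m \<le> M + 1"
  shows "(\<integral>z. Phi T t m k z \<partial>kern (t m - t l) y) = Phi T t l k y"
proof (cases "l = m")
  case True
  then show ?thesis using measurable_Phi[of m k] l by (simp add: integral_kern_0)
next
  case False
  with l have r: "0 < t m - t l" and s: "0 \<le> 2 * T - t m - t 1" and m: "1 \<le> m"
    using t_less[of l m] t_le_T[of m] t1_less by auto
  have int: "integrable (lborel \<Otimes>\<^sub>M lborel) (\<lambda>(u, z). psi k u * (esgn (gap m 1) (z - u) * pk (t m - t l) y z))"
    by (rule integrable_pair_bounded_mult[OF integrable_psi _ _ esgn_bounded[OF s], where C=1])
       (use r measurable_esgn[OF s, measurable] in \<open>auto simp: integral_abs_pk intro: integrable_pk\<close>)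
  have e: "2 * T - t m - t 1 + (t m - t l) = 2 * T - t l - t 1" by simp
  have "(\<integral>z. Phi T t m k z \<partial>kern (t m - t l) y) = (LBINT z. pk (t m - t l) y z * Phi T t m k z)"
    by (rule integral_kern_pos[OF r measurable_Phi[OF m l(3)]])
  also have "\<dots> = (LBINT z. (LBINT u. psi k u * (esgn (gap m 1) (z - u) * pk (t m - t l) y z)))"
    unfolding Phi_eq[OF m l(3)] integral_mult_right_zero[symmetric] by (simp only: mult_ac)
  also have "\<dots> = (LBINT u. (LBINT z. psi k u * (esgn (gap m 1) (z - u) * pk (t m - t l) y z)))"
    using lborel_pair.Fubini_integral[OF int] by simp
  also have "\<dots> = (LBINT u. psi k u * esgn (gap l 1) (y - u))"
    unfolding integral_mult_right_zero esgn_heat[OF r s, unfolded e] ..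
  also have "\<dots> = Phi T t l k y" using Phi_eq[of l k y] l by simp
  finally show ?thesis .
qed

lemma integral_Phi_pk:
  assumes l: "1 \<le> l" "l < m" "m \<le> M + 1"
  shows "(LBINT z. Phi T t m k z * pk (t m - t l) y z) = Phi T t l k y"
  using integral_Phi_kern[where l=l and m=m and k=k and y=y] l t_less[of l m] measurable_Phi[of m k]
  by (simp add: integral_kern_pos mult.commute)

section \<open>The skew inner product and skew orthogonality\<close>

definition skewprod :: "nat \<Rightarrow> nat \<Rightarrow> real" where
  "skewprod j k = (LBINT u. psi k u * (LBINT v. psi j v * esgn (2 * (T - t 1)) (u - v)))"

text \<open>Moving the kernel from \<open>Rm\<close> to \<open>Phi\<close> takes \<open>Phi\<close>
  back to level 1, which is why a single skew product serves all levels.\<close>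

lemma integral_Phi_Rm:
  assumes m: "1 \<le> m" "m \<le> M + 1"
  shows "(LBINT z. Phi T t m j z * Rm T t m k z) = skewprod j k"
proof -
  have r: "0 \<le> t m - t 1" using t_le[of 1 m] m by auto
  have "(LBINT z. Phi T t m j z * Rm T t m k z) = (LBINT u. psi k u * (\<integral>z. Phi T t m j z \<partial>kern (t m - t 1) u))"
    unfolding Rm_psi by (rule kern_dual[OF r integrable_psi measurable_Phi[OF m] Phi_bounded[OF m]])
  also have "\<dots> = (LBINT u. psi k u * Phi T t 1 j u)"
    using integral_Phi_kern[of 1 m] m by simp
  finally show ?thesis
    using M by (simp add: skewprod_def Phi_eq)
qed

lemma skewprod_antisym: "skewprod j k = - skewprod k j"
proof -
  define \<tau> where "\<tau> = 2 * (T - t 1)"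
  have s: "0 \<le> \<tau>" using t1_less by (simp add: \<tau>_def)
  have "integrable (lborel \<Otimes>\<^sub>M lborel) (\<lambda>(u, v). psi k u * (esgn \<tau> (u - v) * psi j v))"
    by (rule integrable_pair_bounded_mult[OF integrable_psi _ _ esgn_bounded[OF s]])
       (use measurable_esgn[OF s, measurable] in \<open>auto intro: integrable_psi\<close>)
  then have int: "integrable (lborel \<Otimes>\<^sub>M lborel) (\<lambda>(u, v). psi k u * (psi j v * esgn \<tau> (u - v)))"
    by (simp only: mult.commute[of "esgn _ _"])
  have "skewprod j k = (LBINT u. (LBINT v. psi k u * (psi j v * esgn \<tau> (u - v))))"
    by (simp add: skewprod_def \<tau>_def)
  also have "\<dots> = (LBINT v. (LBINT u. psi k u * (psi j v * esgn \<tau> (u - v))))"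
    using lborel_pair.Fubini_integral[OF int] by simp
  also have "\<dots> = (LBINT v. (LBINT u. - (psi j v * (psi k u * esgn \<tau> (v - u)))))"
  proof (intro lint_cong refl)
    fix u v show "psi k u * (psi j v * esgn \<tau> (u - v)) = - (psi j v * (psi k u * esgn \<tau> (v - u)))"
      using esgn_minus[OF s, of "u - v"] by simp
  qed
  also have "\<dots> = - skewprod k j"
    by (simp add: skewprod_def \<tau>_def)
  finally show ?thesis .
qed

text \<open>Reflecting both variables multiplies the integrand by (-1)^(j + k + 1).\<close>

lemma skewprod_same_parity:
  assumes "even (j + k)"
  shows "skewprod j k = 0"
proof -
  define \<tau> where "\<tau> = 2 * (T - t 1)"
  have s: "0 \<le> \<tau>" using t1_less by (simp add: \<tau>_def)
  have psi_m: "psi i (- u) = (-1) ^ i * psi i u" for i u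
    using t1_pos pk_minus[of "t 1" 0 u] by (simp add: psi_poly poly_R_poly_minus)
  have "skewprod j k = (LBINT u. psi k (- u) * (LBINT v. psi j (- v) * esgn \<tau> (- u - - v)))"
  proof -
    have "(LBINT v. psi j v * esgn \<tau> (u - v)) = (LBINT v. psi j (- v) * esgn \<tau> (u - - v))" for u
      by (rule lborel_integral_minus[symmetric])
    moreover have "skewprod j k = (LBINT u. psi k (- u) * (LBINT v. psi j v * esgn \<tau> (- u - v)))"
      unfolding skewprod_def \<tau>_def[symmetric] by (rule lborel_integral_minus[symmetric])
    ultimately show ?thesis by simp
  qed
  also have "\<dots> = (LBINT u. (-1) ^ (j + k + 1) * (psi k u * (LBINT v. psi j v * esgn \<tau> (u - v))))"
  proof (intro lint_cong refl)
    fix u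
    have "(LBINT v. psi j (- v) * esgn \<tau> (- u - - v)) = (LBINT v. (-1) ^ (j + 1) * (psi j v * esgn \<tau> (u - v)))"
    proof (intro lint_cong refl)
      fix v show "psi j (- v) * esgn \<tau> (- u - - v) = (-1) ^ (j + 1) * (psi j v * esgn \<tau> (u - v))"
        using esgn_minus[OF s, of "u - v"] by (simp add: psi_m)
    qed
    then show "psi k (- u) * (LBINT v. psi j (- v) * esgn \<tau> (- u - - v))
      = (-1) ^ (j + k + 1) * (psi k u * (LBINT v. psi j v * esgn \<tau> (u - v)))"
      by (simp add: psi_m power_add)
  qed
  also have "\<dots> = - skewprod j k"
    using assms by (simp add: skewprod_def \<tau>_def)
  finally show ?thesis by simp
qed

text \<open>Integration by parts in the odd function removes the sign, leaving a heat kernel between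
  two even functions. The conditional expectation of \<open>hpoly_conditional\<close> makes the
  inner integral a multiple of a Hermite polynomial, and orthogonality finishes.\<close>

lemma skewprod_even_odd: "skewprod (2 * i) (2 * k + 1) = (if i = k then rcoef T (t 1) k else 0)"
proof -
  define \<tau> where "\<tau> = 2 * (T - t 1)"
  define s where "s = t 1"
  define V where "V = s * (2 * T - s) / (2 * T)"
  \<comment> \<open>The regression coefficient of a Brownian motion at time \<open>s\<close> on its
    value at time \<open>s + \<tau>\<close>.\<close>
  define \<rho> where "\<rho> = s / (s + \<tau>)"
  have \<tau>: "0 < \<tau>" and s: "0 < s" "s < T" using t1_less t1_pos by (simp_all add: \<tau>_def s_def)
  have V: "0 < V" using s by (simp add: V_def)
  have psi_even: "psi (2 * i) u = poly (hpoly V (2 * i)) u * pk s 0 u" for i u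
    unfolding psi_poly s_def[symmetric] by (simp add: R_poly_even V_def)
  have psi_odd: "psi (2 * k + 1) u = - s * (poly (gpoly s 0 (hpoly V (2 * k))) u * pk s 0 u)" for u
    unfolding psi_poly s_def[symmetric] by (simp add: R_poly_def V_def[symmetric])
  have odd: "(LBINT v. psi (2 * k + 1) v * esgn \<tau> (u - v)) = - (2 * s) * (LBINT w. pk \<tau> u w * psi (2 * k) w)" for u
  proof -
    have int: "integrable (lborel \<Otimes>\<^sub>M lborel) (\<lambda>(v, w). psi (2 * k + 1) v * (sgn (w - v) * pk \<tau> u w))"
      by (rule integrable_pair_bounded_mult[OF integrable_psi, where B=1 and C=1])
         (use \<tau> in \<open>auto simp: integral_abs_pk sgn_if intro: integrable_pk\<close>)
    have "(LBINT v. psi (2 * k + 1) v * esgn \<tau> (u - v))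
      = (LBINT v. (LBINT w. psi (2 * k + 1) v * (sgn (w - v) * pk \<tau> u w)))"
      using esgn_heat[OF \<tau>, of 0 _ u] by (simp add: esgn_0)
    also have "\<dots> = (LBINT w. (LBINT v. psi (2 * k + 1) v * (sgn (w - v) * pk \<tau> u w)))"
      using lborel_pair.Fubini_integral[OF int] by simp
    also have "\<dots> = (LBINT w. - (2 * s) * (pk \<tau> u w * psi (2 * k) w))"
    proof (intro lint_cong refl)
      fix w
      have "(LBINT v. psi (2 * k + 1) v * (sgn (w - v) * pk \<tau> u w))
        = (LBINT v. (s * pk \<tau> u w) * (sgn (v - w) * (poly (gpoly s 0 (hpoly V (2 * k))) v * pk s 0 v)))"
      proof (intro lint_cong refl)
        fix v
        have "sgn (w - v) = - sgn (v - w)" by (metis minus_diff_eq sgn_minus)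
        then show "psi (2 * k + 1) v * (sgn (w - v) * pk \<tau> u w)
          = (s * pk \<tau> u w) * (sgn (v - w) * (poly (gpoly s 0 (hpoly V (2 * k))) v * pk s 0 v))"
          unfolding psi_odd by simp
      qed
      then show "(LBINT v. psi (2 * k + 1) v * (sgn (w - v) * pk \<tau> u w)) = - (2 * s) * (pk \<tau> u w * psi (2 * k) w)"
        using integral_sgn_gpoly(1)[OF s(1), of w 0 "hpoly V (2 * k)"] by (simp add: psi_even)
    qed
    finally show ?thesis by simp
  qed
  have s2: "s + (s + \<tau>) = 2 * T" "s + \<tau> = 2 * T - s" by (simp_all add: s_def \<tau>_def)
  have st: "0 < s + \<tau>" using s \<tau> by simp
  have V': "V = s * (s + \<tau>) / (s + (s + \<tau>))" unfolding s2(2) V_def by simp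
  have inner: "(LBINT w. pk \<tau> u w * psi (2 * k) w) = pk (s + \<tau>) 0 u * (\<rho> ^ (2 * k) * poly (hpoly V (2 * k)) u)" for u
  proof -
    have "pk \<tau> u w * psi (2 * k) w
      = pk (s + \<tau>) 0 u * (poly (hpoly V (2 * k)) w * pk (s * \<tau> / (s + \<tau>)) (\<rho> * u) w)" for w
    proof -
      have 1: "pk s 0 w * pk \<tau> u w = pk (s + \<tau>) 0 u * pk (s * \<tau> / (s + \<tau>)) (\<rho> * u) w"
        using pk_prod[OF s(1) \<tau>, of 0 w u] by (simp add: \<rho>_def pk_sym[of \<tau> u w])
      have "pk \<tau> u w * (X * pk s 0 w) = pk (s + \<tau>) 0 u * (X * pk (s * \<tau> / (s + \<tau>)) (\<rho> * u) w)" for X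
        using arg_cong[OF 1, of "\<lambda>y. X * y"] by (simp only: mult_ac)
      then show ?thesis unfolding psi_even .
    qed
    moreover have "s * \<tau> / (s + \<tau>) = V * (1 - \<rho>\<^sup>2)"
    proof -
      have "1 - \<rho>\<^sup>2 = ((s + \<tau>)\<^sup>2 - s\<^sup>2) / (s + \<tau>)\<^sup>2"
        using st by (simp add: \<rho>_def power_divide diff_divide_distrib)
      also have "(s + \<tau>)\<^sup>2 - s\<^sup>2 = \<tau> * (s + (s + \<tau>))" by (simp add: power2_eq_square algebra_simps)
      finally have "V * (1 - \<rho>\<^sup>2) = s * (s + \<tau>) / (s + (s + \<tau>)) * (\<tau> * (s + (s + \<tau>)) / (s + \<tau>)\<^sup>2)"
        unfolding V' by simp
      also have "\<dots> = s * \<tau> / (s + \<tau>)"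
        using st s by (simp add: power2_eq_square)
      finally show ?thesis ..
    qed
    moreover have "0 < s * \<tau> / (s + \<tau>)" using s \<tau> st by simp
    ultimately show ?thesis using hpoly_conditional[of "s * \<tau> / (s + \<tau>)" V \<rho> "2 * k" u] by simp
  qed
  have "skewprod (2 * i) (2 * k + 1) = - skewprod (2 * k + 1) (2 * i)" by (rule skewprod_antisym)
  also have "skewprod (2 * k + 1) (2 * i)
    = (LBINT u. psi (2 * i) u * (- (2 * s) * (pk (s + \<tau>) 0 u * (\<rho> ^ (2 * k) * poly (hpoly V (2 * k)) u))))"
    unfolding skewprod_def \<tau>_def[symmetric] odd inner ..
  also have "\<dots> = (LBINT u. - (2 * s * \<rho> ^ (2 * k) * pk (2 * T) 0 0) * (poly (hpoly V (2 * i) * hpoly V (2 * k)) u * pk V 0 u))"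
  proof (intro lint_cong refl)
    fix u
    \<comment> \<open>The weight of the even function and the density coming from the inner integral
      combine to the Gaussian of variance \<open>V\<close>, for which the Hermite polynomials are
      orthogonal.\<close>
    have "pk s 0 u * pk (s + \<tau>) 0 u = pk (2 * T) 0 0 * pk V 0 u"
      using pk_prod[OF s(1) st, of 0 u 0] unfolding V' s2(1) by (simp add: pk_sym[of _ u 0])
    then have 1: "pk (s + \<tau>) 0 u * pk s 0 u = pk (2 * T) 0 0 * pk V 0 u"
      by (simp add: mult.commute)
    have "(Y * pk s 0 u) * (- (2 * s) * (pk (s + \<tau>) 0 u * (R * X)))
      = - (2 * s * R * pk (2 * T) 0 0) * ((Y * X) * pk V 0 u)" for R X Y
      using arg_cong[OF 1, of "\<lambda>z. - (2 * s) * R * X * Y * z"] by (simp only: mult_ac mult_minus_left mult_minus_right)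
    then show "psi (2 * i) u * (- (2 * s) * (pk (s + \<tau>) 0 u * (\<rho> ^ (2 * k) * poly (hpoly V (2 * k)) u)))
      = - (2 * s * \<rho> ^ (2 * k) * pk (2 * T) 0 0) * (poly (hpoly V (2 * i) * hpoly V (2 * k)) u * pk V 0 u)"
      unfolding psi_even poly_mult .
  qed
  also have "\<dots> = - (2 * s * \<rho> ^ (2 * k) * pk (2 * T) 0 0) * (if i = k then V ^ (2 * k) * fact (2 * k) else 0)"
    using hpoly_orthogonal[OF V, of "2 * i" "2 * k"] by simp
  also have "- \<dots> = (if i = k then rcoef T (t 1) k else 0)"
  proof -
    have "\<rho> * V = s\<^sup>2 / (2 * T)" unfolding \<rho>_def V_def s2 using s T by (simp add: power2_eq_square field_simps)
    then have "\<rho> ^ (2 * k) * V ^ (2 * k) = (s\<^sup>2 / (2 * T)) ^ (2 * k)" by (metis power_mult_distrib)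
    moreover have "pk (2 * T) 0 0 = 1 / sqrt (2 * pi * (2 * T))" by (simp add: pk_def)
    ultimately show ?thesis
      unfolding s_def[symmetric] rcoef_eq[OF s(1) T] by (simp add: mult_ac)
  qed
  finally show ?thesis .
qed

end

section \<open>The bordered Pfaffian\<close>

text \<open>\<open>Up m x\<close> and \<open>Dn m x\<close> are the two rows of a point \<open>x\<close> at time \<open>t m\<close>, \<open>Bd k\<close> is a border row.\<close>
datatype site = Up nat real | Dn nat real | Bd nat

lemma distinct_concat_Pair:
  "distinct L \<Longrightarrow> (\<And>m. distinct (f m)) \<Longrightarrow> distinct (concat (map (\<lambda>m. map (Pair m) (f m)) L))"
  by (induction L) (auto simp: distinct_map inj_on_def)

context time_grid
begin

text \<open>Entries do not involve N; the sums in D, I and S appear only when borders are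
  eliminated. The signs are chosen so that integrating a product of an \<open>Up\<close> row and a
  \<open>Dn\<close> row gives \<open>- skern c d\<close> in all surviving cases, see
  \<open>integral_row_product\<close>.\<close>

fun skern :: "site \<Rightarrow> site \<Rightarrow> real" where
  "skern (Up m x) (Up n y) = - Fmn T t m n x y"
| "skern (Up m x) (Dn n y) = (if m < n then - pk (t n - t m) x y else 0)"
| "skern (Dn m x) (Up n y) = (if n < m then pk (t m - t n) y x else 0)"
| "skern (Dn m x) (Dn n y) = 0"
| "skern (Up m x) (Bd k) = Phi T t m k x"
| "skern (Bd k) (Up m x) = - Phi T t m k x"
| "skern (Dn m x) (Bd k) = Rm T t m k x"
| "skern (Bd k) (Dn m x) = - Rm T t m k x"
| "skern (Bd j) (Bd k) = - skewprod j k"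

lemma skew_skern: "skew skern"
  unfolding skew_def
proof (intro allI)
  fix c d show "skern c d = - skern d c"
  proof (cases c; cases d)
    fix m x n y assume "c = Up m x" "d = Up n y"
    then show ?thesis using Fmn_swap[of T t m n x y] by simp
  next
    fix j k assume "c = Bd j" "d = Bd k"
    then show ?thesis using skewprod_antisym[of j k] by simp
  qed simp_all
qed

definition borders :: "nat \<Rightarrow> site list" where
  "borders n = concat (map (\<lambda>k. [Bd (2 * k), Bd (2 * k + 1)]) [0..<n])"

lemma borders_eq: "borders n = map Bd [0..<2 * n]"
  by (induction n) (simp_all add: borders_def)

definition point_pairs :: "nat \<Rightarrow> real list \<Rightarrow> site list" where
  "point_pairs m L = concat (map (\<lambda>x. [Up m x, Dn m x]) L)"

definition config :: "(nat \<Rightarrow> nat) \<Rightarrow> (nat \<Rightarrow> nat \<Rightarrow> real) \<Rightarrow> site list" where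
  "config Ns x = concat (map (\<lambda>m. point_pairs m (map (x m) [1..<Suc (Ns m)])) [1..<Suc (M + 1)])"

definition bpf :: "nat \<Rightarrow> (nat \<Rightarrow> nat) \<Rightarrow> (nat \<Rightarrow> nat \<Rightarrow> real) \<Rightarrow> real" where
  "bpf n Ns x = pf skern (borders n @ config Ns x)"

lemma rcoef_pos: "0 < rcoef T (t 1) k"
proof -
  have "rcoef T (t 1) k = 2 * t 1 * (1 / sqrt (2 * pi * (2 * T))) * (((t 1)\<^sup>2 / (2 * T)) ^ (2 * k) * fact (2 * k))"
    by (rule rcoef_eq[OF t1_pos T])
  then show ?thesis using t1_pos T by simp
qed

lemma skern_border_pair: "skern (Bd (2 * k)) (Bd (2 * k + 1)) = - rcoef T (t 1) k"
  using skewprod_even_odd[of k k] by simp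

lemma Tdet_bpf:
  assumes N: "N = 2 * n"
  shows "bpf n Ns x = (\<Prod>k<n. - rcoef T (t 1) k) * Tdet (blk_idx M Ns) (Qmat N T t x)"
proof -
  define S where "S = concat (map (\<lambda>m. map (Pair m) [1..<Suc (Ns m)]) [1..<Suc (M + 1)])"
  have setS: "set S = blk_idx M Ns"
    by (auto simp: S_def blk_idx_def image_iff less_Suc_eq_le simp del: upt_Suc)
  have distS: "distinct S"
    unfolding S_def by (rule distinct_concat_Pair) auto
  define f where "f c = (if snd c then Dn (fst (fst c)) (x (fst (fst c)) (snd (fst c)))
    else Up (fst (fst c)) (x (fst (fst c)) (snd (fst c))))" for c
  have config: "config Ns x = map f (dbl S)"
  proof -
    have "map f (dbl (concat LL)) = concat (map (\<lambda>K. map f (dbl K)) LL)" for LL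
      by (induction LL) (simp_all add: dbl_def)
    moreover have "map f (dbl (map (Pair m) K)) = point_pairs m (map (x m) K)" for m K
      by (induction K) (simp_all add: dbl_def point_pairs_def f_def)
    ultimately show ?thesis unfolding config_def S_def by (simp add: o_def del: upt_Suc)
  qed
  define B where "B c d = skern c d + (\<Sum>k<n. (skern c (Bd (2*k+1)) * skern d (Bd (2*k)) - skern c (Bd (2*k)) * skern d (Bd (2*k+1)))
    / skern (Bd (2*k)) (Bd (2*k+1)))" for c d
  have r: "- rcoef T (t 1) k \<noteq> 0" for k using rcoef_pos[of k] by simp
  \<comment> \<open>Eliminating the border pairs adds D, -I and S to the blocks
    \<open>Dn\<close>-\<open>Dn\<close>, \<open>Up\<close>-\<open>Up\<close> and
    \<open>Up\<close>-\<open>Dn\<close>.\<close>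
  have B: "B (f c) (f d) = qkern (Qmat N T t x) c d" for c d
  proof -
    obtain m i b where c: "c = ((m, i), b)" by (metis surj_pair)
    obtain l j e where d: "d = ((l, j), e)" by (metis surj_pair)
    have s: "(\<Sum>k<n. (A k * B' k - C k * D k) / - rcoef T (t 1) k) = (\<Sum>k<n. 1 / rcoef T (t 1) k * (C k * D k - A k * B' k))"
      for A B' C D
      by (intro sum.cong refl) (metis (no_types, opaque_lifting) divide_minus_right minus_diff_eq minus_divide_left mult.commute mult.right_neutral times_divide_eq_left)
    have neg: "- ((u - v) / w) = (v - u) / w" for u v w :: real
      by (simp add: minus_divide_left)
    show ?thesis
      unfolding B_def skern_border_pair s using N
      by (cases b; cases e)
         (simp_all add: c d f_def qkern_def Let_def Qmat_def qmat_def vector_2 It_def Ik_def St_def Sk_def Dk_def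
            mult.commute sum_negf[symmetric] neg)
  qed
  have skewQ: "skew (qkern (Qmat N T t x))"
    unfolding skew_def B[symmetric]
  proof (intro allI)
    fix c d show "B (f c) (f d) = - B (f d) (f c)"
      unfolding B_def using skewD[OF skew_skern, of "f c" "f d"]
      by (simp add: sum_negf[symmetric] mult.commute diff_divide_distrib)
  qed
  have "bpf n Ns x = (\<Prod>k<n. skern (Bd (2*k)) (Bd (2*k+1))) * pf B (config Ns x)"
    unfolding bpf_def borders_def B_def
    by (rule pf_borders[OF skew_skern])
       (use r skewprod_same_parity skewprod_even_odd rcoef_pos in \<open>auto simp: less_imp_neq[symmetric]\<close>)
  also have "pf B (config Ns x) = Tdet (set S) (Qmat N T t x)"
    unfolding config pf_map B Tdet_eq_pf[OF skewQ distS] ..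
  finally show ?thesis unfolding setS skern_border_pair .
qed

section \<open>The Pfaffian of a full configuration\<close>

lemma Rm_det:
  "ldet N (\<lambda>i j. Rm T t 1 (j - 1) (x i)) = hN N x * (\<Prod>i = 1..N. pk (t 1) 0 (x i))"
proof -
  have "ldet N (\<lambda>i j. Rm T t 1 (j - 1) (x i)) = ldet N (\<lambda>i j. poly (R_poly T (t 1) (j - 1)) (x i) * pk (t 1) 0 (x i))"
    by (simp only: Rm_1 psi_poly)
  also have "\<dots> = ldet N (\<lambda>i j. poly (R_poly T (t 1) (j - 1)) (x i)) * (\<Prod>i = 1..N. pk (t 1) 0 (x i))"
    by (rule ldet_scale_rows)
  also have "ldet N (\<lambda>i j. poly (R_poly T (t 1) (j - 1)) (x i)) = hN N x"
    by (rule ldet_monic_polys) (use R_poly_monic[OF t1_pos] in auto)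
  finally show ?thesis .
qed

text \<open>The Gamma factors of \<open>Cconst\<close> with j = 2k + 1 and j = 2k + 2 are the two in
  r_k, and the exponents 2k + 1/2 add up to N(N - 1)/4 for N = 2n.\<close>

lemma prod_rcoef:
  assumes s: "s > 0"
  shows "Cconst (2 * n) T s * (\<Prod>k<n. rcoef T s k) = 1"
proof -
  define G where "G n = (\<Prod>j\<in>{1..2 * n}. Gamma (real j / 2))" for n :: nat
  define E where "E n = real (2 * n * (2 * n - 1)) / 4" for n :: nat
  have G: "G n > 0" for n unfolding G_def by (intro prod_pos) auto
  have 1: "(\<Prod>k<n. rcoef T s k) = G n / pi ^ n * (s\<^sup>2 / T) powr E n"
  proof (induction n)
    case (Suc n)
    have "{1..2 * Suc n} = insert (Suc (Suc (2 * n))) (insert (Suc (2 * n)) {1..2 * n})" by auto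
    then have "G (Suc n) = Gamma (real n + 1 / 2) * Gamma (real n + 1) * G n"
      by (simp add: G_def add_divide_distrib add.commute mult_ac)
    moreover have "E (Suc n) = 2 * real n + 1 / 2 + E n"
      by (cases n) (simp_all add: E_def field_simps)
    ultimately show ?case
      using Suc s T by (simp add: rcoef_def powr_add mult_ac)
  qed (use s T in \<open>simp add: G_def E_def\<close>)
  have 2: "Cconst (2 * n) T s = pi ^ n / G n * T powr E n * s powr (- (2 * E n))"
    by (simp add: Cconst_def G_def E_def powr_realpow)
  have 3: "T powr E n * s powr (- (2 * E n)) * (s\<^sup>2 / T) powr E n = 1"
  proof -
    have "(s\<^sup>2 / T) powr E n = s powr (2 * E n) / T powr E n"
      using s T by (simp add: powr_divide powr_powr[symmetric] powr_numeral)
    then show ?thesis using s T by (simp add: powr_minus field_simps)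
  qed
  have "Cconst (2 * n) T s * (\<Prod>k<n. rcoef T s k)
    = (pi ^ n / G n * (G n / pi ^ n)) * (T powr E n * s powr (- (2 * E n)) * (s\<^sup>2 / T) powr E n)"
    unfolding 1 2 by (simp only: mult_ac)
  also have "\<dots> = 1"
    unfolding 3 using G[of n] by simp
  finally show ?thesis .
qed

text \<open>\<open>Dn\<close> rows of level 1 see only the borders, those of level k + 1 only
  \<open>Up\<close> rows of lower levels and the borders. Peeling levels with
  \<open>pf_triangular\<close>, each time consuming the previous rows, gives the Vandermonde factor,
  then the transition determinants, then a sign Pfaffian. Its factor (-1)^n is matched by the
  product of the \<open>- rcoef T (t 1) k\<close>.\<close>

lemma bpf_full:
  assumes N: "N = 2 * n"
  shows "bpf n (\<lambda>_. N) x = (\<Prod>k<n. - rcoef T (t 1) k) * rho_full N T M t x"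
proof -
  define X where "X m = map (x m) [1..<Suc N]" for m
  have lenX: "length (X m) = N" for m by (simp add: X_def)
  have nthX: "X m ! (i - 1) = x m i" if "i \<in> {1..N}" for m i
  proof -
    have "Suc (i - 1) = i" "i - 1 < Suc N - 1" using that by auto
    then show ?thesis unfolding X_def by (subst nth_map_upt) auto
  qed
  define R where "R k = concat (map (\<lambda>m. point_pairs m (X m)) [k..<Suc (M + 1)])" for k
  have RS: "R k = point_pairs k (X k) @ R (Suc k)" if "k < Suc (M + 1)" for k
    using that by (simp add: R_def upt_conv_Cons del: upt_Suc)
  have dnR: "skern (Dn m y) d = 0" if "d \<in> set (R k)" "m \<le> k" for m y d k
    using that by (auto simp: R_def point_pairs_def simp del: upt_Suc)
  define D where "D m = ldet N (\<lambda>i j. pk (t (m + 1) - t m) (x m i) (x (m + 1) j))" for m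
  have lvl: "pf skern (W @ R k)
    = ldet N (\<lambda>i j. skern (Dn k (x k i)) (W ! (j - 1))) * pf skern (map (Up k) (X k) @ R (Suc k))"
    if k: "k < Suc (M + 1)" and W: "length W = N" for k W
  proof -
    have "pf skern (W @ R k) = ldet (length (X k)) (\<lambda>i j. skern (Dn k (X k ! (i - 1))) (W ! (j - 1)))
      * pf skern (map (Up k) (X k) @ R (Suc k))"
      unfolding RS[OF k] point_pairs_def
      by (rule pf_triangular[OF skew_skern]) (use dnR[of _ "Suc k" k] W lenX in auto)
    also have "ldet (length (X k)) (\<lambda>i j. skern (Dn k (X k ! (i - 1))) (W ! (j - 1)))
      = ldet N (\<lambda>i j. skern (Dn k (x k i)) (W ! (j - 1)))"
      unfolding lenX by (rule ldet_cong) (simp add: nthX del: One_nat_def)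
    finally show ?thesis .
  qed
  have chain: "pf skern (map (Up k) (X k) @ R (Suc k)) = (\<Prod>m\<in>{k..<M+1}. D m) * pf skern (map (Up (M + 1)) (X (M + 1)))"
    if "k \<le> M + 1" for k
    using that
  proof (induction k rule: inc_induct)
    case base
    then show ?case by (simp add: R_def)
  next
    case (step k)
    \<comment> \<open>Rows are indexed here by points of the later level, in \<open>D\<close> by
      those of the earlier one, hence the transpose.\<close>
    have "ldet N (\<lambda>i j. skern (Dn (Suc k) (x (Suc k) i)) (map (Up k) (X k) ! (j - 1)))
      = ldet N (\<lambda>i j. (\<lambda>i j. pk (t (k + 1) - t k) (x k i) (x (k + 1) j)) j i)"
    proof (rule ldet_cong)
      fix i j assume "i \<in> {1..N}" "j \<in> {1..N}"
      then have "map (Up k) (X k) ! (j - 1) = Up k (x k j)"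
        using nthX[of j k] lenX[of k] by (subst nth_map) auto
      then show "skern (Dn (Suc k) (x (Suc k) i)) (map (Up k) (X k) ! (j - 1))
        = (\<lambda>i j. pk (t (k + 1) - t k) (x k i) (x (k + 1) j)) j i"
        by simp
    qed
    also have "\<dots> = D k" unfolding D_def by (rule ldet_transpose)
    finally have D: "ldet N (\<lambda>i j. skern (Dn (Suc k) (x (Suc k) i)) (map (Up k) (X k) ! (j - 1))) = D k" .
    have lv: "pf skern (map (Up k) (X k) @ R (Suc k)) = D k * pf skern (map (Up (Suc k)) (X (Suc k)) @ R (Suc (Suc k)))"
      using lvl[of "Suc k" "map (Up k) (X k)"] step(2) unfolding D by (simp add: lenX)
    have "(\<Prod>m\<in>{k..<M+1}. D m) = D k * (\<Prod>m\<in>{Suc k..<M+1}. D m)"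
      using step(2) by (rule prod.atLeast_Suc_lessThan)
    then show ?case using lv step.IH by (simp only: mult.assoc)
  qed
  have "bpf n (\<lambda>_. N) x = pf skern (borders n @ R 1)"
    by (simp add: bpf_def config_def R_def X_def)
  also have "\<dots> = ldet N (\<lambda>i j. skern (Dn 1 (x 1 i)) (borders n ! (j - 1))) * pf skern (map (Up 1) (X 1) @ R (Suc 1))"
    by (rule lvl) (use N in \<open>auto simp: borders_eq\<close>)
  also have "ldet N (\<lambda>i j. skern (Dn 1 (x 1 i)) (borders n ! (j - 1))) = ldet N (\<lambda>i j. Rm T t 1 (j - 1) (x 1 i))"
    by (rule ldet_cong) (use N in \<open>auto simp: borders_eq\<close>)
  also have "\<dots> = hN N (x 1) * (\<Prod>i = 1..N. pk (t 1) 0 (x 1 i))"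
    by (rule Rm_det)
  also have "pf skern (map (Up 1) (X 1) @ R (Suc 1)) = (\<Prod>m = 1..M. D m) * pf skern (map (Up (M + 1)) (X (M + 1)))"
    using chain[of 1] by (simp add: atLeastLessThanSuc_atLeastAtMost)
  \<comment> \<open>At the final time the variance in \<open>Fmn\<close> is 0, so the smoothed sign
    is the sign itself.\<close>
  also have "pf skern (map (Up (M + 1)) (X (M + 1))) = (-1) ^ n * sgn (hN N (x (M + 1)))"
  proof -
    have "pf skern (map (Up (M + 1)) (X (M + 1))) = pf (\<lambda>a b. (-1) * sgn (b - a)) (X (M + 1))"
      unfolding pf_map using t_last by (simp add: Fmn_eq esgn_0)
    also have "\<dots> = (-1) ^ n * pf (\<lambda>a b. sgn (b - a)) (X (M + 1))"
      using pf_scale[of "X (M + 1)" "-1" "\<lambda>a b. sgn (b - a)"] N by (simp add: lenX)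
    also have "pf (\<lambda>a b. sgn (b - a)) (X (M + 1)) = lsgn (X (M + 1))"
      by (rule pf_sgn) (simp add: lenX N)
    also have "\<dots> = sgn (hN N (x (M + 1)))"
      unfolding X_def by (rule lsgn_hN)
    finally show ?thesis .
  qed
  finally have bpf: "bpf n (\<lambda>_. N) x = hN N (x 1) * (\<Prod>i = 1..N. pk (t 1) 0 (x 1 i))
    * ((\<Prod>m = 1..M. D m) * ((-1) ^ n * sgn (hN N (x (M + 1)))))" .
  have "(\<Prod>k<n. - rcoef T (t 1) k) * Cconst N T (t 1) = (-1) ^ n"
    using prod_rcoef[OF t1_pos, of n] N by (simp add: prod_uminus mult_ac)
  then have "(\<Prod>k<n. - rcoef T (t 1) k) * rho_full N T M t x = (-1) ^ n * (hN N (x 1) * sgn (hN N (x (M + 1)))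
     * (\<Prod>i = 1..N. pk (t 1) 0 (x 1 i)) * (\<Prod>m = 1..M. D m))"
    unfolding rho_full_def D_def by (metis (no_types, lifting) mult.assoc)
  then show ?thesis unfolding bpf by (simp only: mult_ac)
qed

end

section \<open>Integrating out points\<close>

context time_grid
begin

definition good :: "site \<Rightarrow> bool" where
  "good c = (case c of Up n y \<Rightarrow> 1 \<le> n \<and> n \<le> M + 1 | Dn n y \<Rightarrow> 1 \<le> n \<and> n \<le> M + 1 | Bd k \<Rightarrow> True)"

text \<open>The level order forces \<open>skern (Up m z) c\<close> to vanish outside
  \<open>lefts m\<close>, and \<open>skern (Dn m z) d\<close> outside
  \<open>rights m\<close>.\<close>

definition lefts :: "nat \<Rightarrow> site \<Rightarrow> bool" where
  "lefts m c = (case c of Up n y \<Rightarrow> True | Dn n y \<Rightarrow> m < n | Bd k \<Rightarrow> True)"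

definition rights :: "nat \<Rightarrow> site \<Rightarrow> bool" where
  "rights m c = (case c of Up n y \<Rightarrow> n < m | Dn n y \<Rightarrow> False | Bd k \<Rightarrow> True)"

text \<open>Products of the two rows of a point are integrable because \<open>Up\<close> rows are
  bounded in the position while \<open>Dn\<close> rows are integrable.\<close>

lemma Up_row_bounded:
  assumes m: "1 \<le> m" "m \<le> M + 1" and c: "good c"
  shows "(\<lambda>z. skern (Up m z) c) \<in> borel_measurable borel" "\<exists>B. \<forall>z. \<bar>skern (Up m z) c\<bar> \<le> B"
proof -
  have "(\<lambda>z. skern (Up m z) c) \<in> borel_measurable borel \<and> (\<exists>B. \<forall>z. \<bar>skern (Up m z) c\<bar> \<le> B)"
  proof (cases c)
    case (Up n y)
    then have n: "n \<le> M + 1" using c by (simp add: good_def)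
    have s: "0 \<le> 2 * T - t m - t n" using t_le_T[OF n] t_le_T[OF m(2)] by simp
    note [measurable] = measurable_esgn[OF s]
    have "(\<lambda>z. - esgn (gap m n) (y - z)) \<in> borel_measurable borel" by measurable
    then show ?thesis
      using Up n m esgn_bounded[OF s] by (auto simp: Fmn_eq intro!: exI[of _ 1])
  next
    case (Dn n y)
    then have n: "n \<le> M + 1" using c by (simp add: good_def)
    show ?thesis
    proof (cases "m < n")
      case True
      then have r: "0 < t n - t m" using t_less[of m n] n by simp
      have "\<bar>- pk (t n - t m) z y\<bar> \<le> 1 / sqrt (2 * pi * (t n - t m))" for z
        using pk_bounded[OF r, of z y] pk_nonneg[OF r, of z y] by simp
      moreover have "(\<lambda>z. - pk (t n - t m) z y) \<in> borel_measurable borel" by measurable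
      ultimately show ?thesis using Dn True by auto
    qed (use Dn in auto)
  next
    case (Bd k)
    then show ?thesis using measurable_Phi[OF m] Phi_bounded[OF m] by auto
  qed
  then show "(\<lambda>z. skern (Up m z) c) \<in> borel_measurable borel" "\<exists>B. \<forall>z. \<bar>skern (Up m z) c\<bar> \<le> B" by blast+
qed

lemma integrable_Dn_row:
  assumes m: "1 \<le> m" "m \<le> M + 1" and d: "good d"
  shows "integrable lborel (\<lambda>z. skern (Dn m z) d)"
proof (cases d)
  case (Up n y)
  show ?thesis
  proof (cases "n < m")
    case True
    then show ?thesis using Up integrable_pk[of "t m - t n" y] t_less[of n m] m by simp
  qed (use Up in simp)
next
  case (Bd k)
  then show ?thesis using integrable_Rm[OF m, of k] by simp
qed simp

text \<open>In each of the six surviving combinations the intermediate time \<open>t m\<close> drops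
  out by a semigroup identity, leaving the kernel between the two outer sites.\<close>

lemma integral_row_product:
  assumes m: "1 \<le> m" "m \<le> M + 1" and c: "good c" and d: "good d"
  shows "integrable lborel (\<lambda>z. skern (Up m z) c * skern (Dn m z) d)"
    and "(LBINT z. skern (Up m z) c * skern (Dn m z) d) = (if lefts m c \<and> rights m d then - skern c d else 0)"
proof -
  obtain B where B: "\<And>z. \<bar>skern (Up m z) c\<bar> \<le> B" using Up_row_bounded(2)[OF m c] by blast
  show "integrable lborel (\<lambda>z. skern (Up m z) c * skern (Dn m z) d)"
    by (rule integrable_bounded_mult(1)[where B=B])
       (use integrable_Dn_row[OF m d] Up_row_bounded(1)[OF m c] B in auto)
  show "(LBINT z. skern (Up m z) c * skern (Dn m z) d) = (if lefts m c \<and> rights m d then - skern c d else 0)"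
  proof (cases "lefts m c \<and> rights m d")
    case False
    then have z: "skern (Up m z) c * skern (Dn m z) d = 0" for z
      by (cases c; cases d) (auto simp: lefts_def rights_def)
    show ?thesis unfolding z using False by auto
  next
    case True
    have FS: "- Fmn T t m n z y = Fmn T t n m y z" for n z y
      using Fmn_swap[of T t n m y z] by simp
    consider (UU) n y l y' where "c = Up n y" "d = Up l y'" "l < m"
      | (UB) n y k where "c = Up n y" "d = Bd k"
      | (DU) n y l y' where "c = Dn n y" "m < n" "d = Up l y'" "l < m"
      | (DB) n y k where "c = Dn n y" "m < n" "d = Bd k"
      | (BU) j l y' where "c = Bd j" "d = Up l y'" "l < m"
      | (BB) j k where "c = Bd j" "d = Bd k"
      using True by (cases c; cases d) (auto simp: lefts_def rights_def)
    then show ?thesis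
    proof cases
      case UU
      then show ?thesis using c m True integral_Fmn_pk[of l m n y y'] by (simp add: FS good_def)
    next
      case UB
      then show ?thesis using c m True integral_Fmn_Rm[of m n y k] by (simp add: FS good_def)
    next
      case DU
      then show ?thesis using c m True integral_pk_pk[of l m n y y'] by (simp add: good_def)
    next
      case DB
      then show ?thesis using c m True integral_pk_Rm[of m n y k] by (simp add: good_def)
    next
      case BU
      then show ?thesis using d m True integral_Phi_pk[of l m j y'] by (simp add: good_def)
    next
      case BB
      then show ?thesis using m True integral_Phi_Rm[of m j k] by simp
    qed
  qed
qed

text \<open>Integrating out the pair of a point at level \<open>m\<close> reproduces the Pfaffian of the remaining
  sites, because \<open>integral_row_product\<close> turns the pair into a truncated copy of the kernel itself.\<close>
lemma integral_pair:
  assumes m: "1 \<le> m" "m \<le> M + 1" and L: "\<And>c. c \<in> set L \<Longrightarrow> good c"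
  shows "(LBINT z. pf skern (Up m z # Dn m z # L))
    = (real (length (filter (rights m) L)) - real (length (filter (\<lambda>c. \<not> lefts m c) L))) * pf skern L"
proof -
  let ?n = "length L"
  have good: "good (L ! j)" if "j < ?n" for j using L that by simp
  have "(LBINT z. pf skern (Up m z # Dn m z # L))
    = (LBINT z. (\<Sum>j<?n. \<Sum>k<?n. (skern (Up m z) (L ! j) * skern (Dn m z) (L ! k)) * cof skern L j k))"
    unfolding pf_expand_cof by simp
  also have "\<dots> = (\<Sum>j<?n. \<Sum>k<?n. (LBINT z. skern (Up m z) (L ! j) * skern (Dn m z) (L ! k)) * cof skern L j k)"
    using integral_row_product(1)[OF m good good]
    by (subst Bochner_Integration.integral_sum; (intro Bochner_Integration.integrable_sum)?; simp)+
  also have "\<dots> = (\<Sum>j<?n. \<Sum>k<?n. (if lefts m (L ! j) \<and> rights m (L ! k) then - skern (L ! j) (L ! k) else 0) * cof skern L j k)"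
    by (intro sum.cong refl) (simp add: integral_row_product(2)[OF m good good])
  also have "\<dots> = (real (card {b. b < ?n \<and> rights m (L ! b)}) - real (card {c. c < ?n \<and> \<not> lefts m (L ! c)})) * pf skern L"
  proof (rule sum_restricted_cof[OF skew_skern])
    fix c b assume "\<not> lefts m (L ! c)" "\<not> rights m (L ! b)"
    then show "skern (L ! c) (L ! b) = 0"
      by (cases "L ! c"; cases "L ! b") (auto simp: lefts_def rights_def)
  qed
  finally show ?thesis by (simp add: length_filter_conv_card)
qed

section \<open>Counting sites and removing one point\<close>

lemma good_config: "c \<in> set (borders n @ config Ns x) \<Longrightarrow> good c"
  by (auto simp: borders_eq config_def point_pairs_def good_def simp del: upt_Suc)

lemma filter_borders: "filter (rights m) (borders n) = borders n" "filter (\<lambda>c. \<not> lefts m c) (borders n) = []"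
  by (auto simp: borders_eq filter_id_conv filter_empty_conv rights_def lefts_def)

lemma length_filter_point_pairs:
  "length (filter (rights m) (point_pairs l L)) = (if l < m then length L else 0)"
  "length (filter (\<lambda>c. \<not> lefts m c) (point_pairs l L)) = (if l \<le> m then length L else 0)"
  by (induction L) (auto simp: point_pairs_def rights_def lefts_def)

text \<open>A level below \<open>m\<close> contributes its \<open>Up\<close> sites to one count and
  equally many \<open>Dn\<close> sites to the other; level \<open>m\<close> contributes only
  \<open>Dn\<close> sites, and higher levels contribute to neither.\<close>

lemma length_filter_config:
  assumes m: "1 \<le> m" "m \<le> M + 1"
  shows "real (length (filter (rights m) (config Ns x))) - real (length (filter (\<lambda>c. \<not> lefts m c) (config Ns x)))
    = - real (Ns m)"
proof -
  have len: "length (filter P (config Ns x))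
    = (\<Sum>l = 1..M + 1. length (filter P (point_pairs l (map (x l) [1..<Suc (Ns l)]))))" for P
  proof -
    have "length (filter P (config Ns x))
      = sum_list (map (\<lambda>l. length (filter P (point_pairs l (map (x l) [1..<Suc (Ns l)])))) [1..<Suc (M + 1)])"
      unfolding config_def by (simp add: filter_concat length_concat o_def del: upt_Suc)
    also have "\<dots> = (\<Sum>l\<in>set [1..<Suc (M + 1)]. length (filter P (point_pairs l (map (x l) [1..<Suc (Ns l)]))))"
      by (rule sum_list_distinct_conv_sum_set) simp
    finally show ?thesis by (simp add: atLeastLessThanSuc_atLeastAtMost del: upt_Suc)
  qed
  have "real (length (filter (rights m) (config Ns x))) - real (length (filter (\<lambda>c. \<not> lefts m c) (config Ns x)))
    = (\<Sum>l = 1..M + 1. (if l = m then - real (Ns m) else 0))"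
    unfolding len of_nat_sum sum_subtractf[symmetric] length_filter_point_pairs
    by (intro sum.cong refl) auto
  also have "\<dots> = - real (Ns m)" using m by simp
  finally show ?thesis .
qed

text \<open>The two rows of a point are moved to the front together, which costs no sign.\<close>

lemma bpf_insert:
  assumes m: "m \<in> {1..M + 1}"
  shows "bpf n (Ns(m := Suc (Ns m))) (x(m := (x m)(Suc (Ns m) := z))) = pf skern (Up m z # Dn m z # (borders n @ config Ns x))"
proof -
  have m': "1 \<le> m" "m \<le> M + 1" using m by auto
  define lev where "lev Ns x l = point_pairs l (map (x l) [1..<Suc (Ns l)])" for Ns :: "nat \<Rightarrow> nat" and x :: "nat \<Rightarrow> nat \<Rightarrow> real" and l
  define U where "U = concat (map (lev Ns x) [1..<m]) @ lev Ns x m"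
  define V where "V = concat (map (lev Ns x) [Suc m..<Suc (M + 1)])"
  have split: "[1..<Suc (M + 1)] = [1..<m] @ m # [Suc m..<Suc (M + 1)]"
    using m' upt_add_eq_append[of 1 m "Suc (M + 1) - m"] upt_conv_Cons[of m "Suc (M + 1)"]
    by (simp del: upt_Suc)
  have cfg0: "config Ns x = U @ V"
    unfolding config_def lev_def[symmetric] split U_def V_def by simp
  have cfg1: "config (Ns(m := Suc (Ns m))) (x(m := (x m)(Suc (Ns m) := z))) = U @ [Up m z, Dn m z] @ V" for z
  proof -
    let ?Ns = "Ns(m := Suc (Ns m))" and ?x = "x(m := (x m)(Suc (Ns m) := z))"
    have "lev ?Ns ?x l = lev Ns x l" if "l \<noteq> m" for l using that by (simp add: lev_def)
    then have e: "map (lev ?Ns ?x) [1..<m] = map (lev Ns x) [1..<m]"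
      "map (lev ?Ns ?x) [Suc m..<Suc (M + 1)] = map (lev Ns x) [Suc m..<Suc (M + 1)]"
      by (auto simp del: upt_Suc)
    have e': "lev ?Ns ?x m = lev Ns x m @ [Up m z, Dn m z]"
    proof -
      have "map (?x m) [1..<Suc (Suc (Ns m))] = map (x m) [1..<Suc (Ns m)] @ [z]" by simp
      then show ?thesis by (simp add: lev_def point_pairs_def del: upt_Suc)
    qed
    show ?thesis
      unfolding config_def lev_def[symmetric] split U_def V_def map_append list.map e e'
      by (simp del: upt_Suc)
  qed
  show ?thesis
    using pf_swap_blocks[OF skew_skern, of "[]" "borders n @ U" "[Up m z, Dn m z]" V]
    by (simp add: bpf_def cfg1 cfg0)
qed

lemma integral_bpf:
  assumes m: "m \<in> {1..M + 1}"
  shows "(LBINT z. bpf n (Ns(m := Suc (Ns m))) (x(m := (x m)(Suc (Ns m) := z))))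
    = (real (2 * n) - real (Ns m)) * bpf n Ns x"
proof -
  have m': "1 \<le> m" "m \<le> M + 1" using m by auto
  have "(LBINT z. bpf n (Ns(m := Suc (Ns m))) (x(m := (x m)(Suc (Ns m) := z))))
     = (LBINT z. pf skern (Up m z # Dn m z # (borders n @ config Ns x)))"
    by (simp only: bpf_insert[OF m])
  also have "\<dots> = (real (length (filter (rights m) (borders n @ config Ns x)))
    - real (length (filter (\<lambda>c. \<not> lefts m c) (borders n @ config Ns x)))) * bpf n Ns x"
    unfolding bpf_def by (rule integral_pair[OF m' good_config])
  also have "real (length (filter (rights m) (borders n @ config Ns x)))
    - real (length (filter (\<lambda>c. \<not> lefts m c) (borders n @ config Ns x))) = real (2 * n) - real (Ns m)"
    using length_filter_config[OF m', of Ns x] unfolding filter_append filter_borders by (simp add: borders_eq)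
  finally show ?thesis .
qed

lemma bpf_cong:
  assumes "\<And>m i. m \<in> {1..M + 1} \<Longrightarrow> i \<in> {1..Ns m} \<Longrightarrow> x m i = y m i"
    and "\<And>m. m \<in> {1..M + 1} \<Longrightarrow> Ns m = Ns' m"
  shows "bpf n Ns x = bpf n Ns' y"
proof -
  have "map (x m) [1..<Suc (Ns m)] = map (y m) [1..<Suc (Ns' m)]" if "m \<in> {1..M + 1}" for m
    using assms(1)[OF that] assms(2)[OF that] by (auto simp del: upt_Suc)
  then have "config Ns x = config Ns' y"
    unfolding config_def by (intro arg_cong[of _ _ concat] map_cong refl) (auto simp del: upt_Suc)
  then show ?thesis by (simp add: bpf_def)
qed

end

section \<open>Integrability and Fubini\<close>

lemma hN_bound: "\<bar>hN N v\<bar> \<le> (\<Prod>i = 1..N. (1 + \<bar>v i\<bar>) ^ (2 * N))"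
proof -
  have f: "\<bar>v j - v i\<bar> \<le> (1 + \<bar>v i\<bar>) * (1 + \<bar>v j\<bar>)" for i j
  proof -
    have "\<bar>v j - v i\<bar> \<le> \<bar>v j\<bar> + \<bar>v i\<bar>" by simp
    also have "\<dots> \<le> (1 + \<bar>v i\<bar>) * (1 + \<bar>v j\<bar>)" by (simp add: algebra_simps)
    finally show ?thesis .
  qed
  have ge1: "1 \<le> (1 + \<bar>v i\<bar>) * (1 + \<bar>v j\<bar>)" for i j
    using mult_mono[of 1 "1 + \<bar>v i\<bar>" 1 "1 + \<bar>v j\<bar>"] by simp
  have "\<bar>hN N v\<bar> = (\<Prod>i = 1..N. \<Prod>j\<in>{i<..N}. \<bar>v j - v i\<bar>)"
    by (simp add: hN_def abs_prod)
  also have "\<dots> \<le> (\<Prod>i = 1..N. \<Prod>j\<in>{i<..N}. (1 + \<bar>v i\<bar>) * (1 + \<bar>v j\<bar>))"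
    by (intro prod_mono conjI prod_nonneg f) auto
  also have "\<dots> \<le> (\<Prod>i = 1..N. \<Prod>j = 1..N. (1 + \<bar>v i\<bar>) * (1 + \<bar>v j\<bar>))"
    by (intro prod_mono conjI prod_nonneg prod_mono2) (auto intro: order_trans[OF zero_le_one ge1] ge1)
  also have "\<dots> = (\<Prod>i = 1..N. (1 + \<bar>v i\<bar>) ^ (2 * N))"
    by (simp add: prod.distrib mult_2 power_add prod_power_distrib)
  finally show ?thesis .
qed

lemma polynomial_gaussian_bound:
  assumes "b > 0"
  shows "(1 + \<bar>u\<bar>) ^ k \<le> (2 + real k / b) ^ k * exp (b * u\<^sup>2)"
proof (cases "k = 0")
  case False
  \<comment> \<open>The rate is shared equally among the \<open>k\<close> factors, each of which is
    bounded separately.\<close>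
  define b' where "b' = b / real k"
  have b': "b' > 0" and k: "real k * b' = b" using assms False by (simp_all add: b'_def)
  have "1 + \<bar>u\<bar> \<le> 2 + u\<^sup>2"
    using zero_le_power2[of "\<bar>u\<bar> - 1"] zero_le_power2[of u] by (simp add: power2_eq_square algebra_simps)
  also have "\<dots> \<le> (2 + 1 / b') * (1 + b' * u\<^sup>2)"
    using b' by (simp add: algebra_simps)
  also have "\<dots> \<le> (2 + 1 / b') * exp (b' * u\<^sup>2)"
    using b' by (intro mult_left_mono exp_ge_add_one_self) auto
  finally have "(1 + \<bar>u\<bar>) ^ k \<le> ((2 + 1 / b') * exp (b' * u\<^sup>2)) ^ k"
    by (intro power_mono) auto
  also have "\<dots> = (2 + real k / b) ^ k * exp (b * u\<^sup>2)"
    using k[symmetric] False by (simp add: power_mult_distrib b'_def flip: exp_of_nat_mult)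
  finally show ?thesis .
qed (use assms in simp)

text \<open>From v^2 <= 2u^2 + 2(u - v)^2: decay at rate \<open>b\<close> in the new variable is
  bought with growth at rate \<open>2 * b\<close> in the old one. Separating the variables makes the
  bound compatible with all permutations in a determinant.\<close>

lemma pk_separated:
  assumes s: "s > 0" and b: "0 \<le> b" "4 * b * s \<le> 1"
  shows "pk s u v \<le> 1 / sqrt (2 * pi * s) * (exp (2 * b * u\<^sup>2) * exp (- b * v\<^sup>2))"
proof -
  have "b * v\<^sup>2 - 2 * b * u\<^sup>2 \<le> 2 * b * (u - v)\<^sup>2"
  proof -
    have "0 \<le> b * (2 * u - v)\<^sup>2" using b by simp
    then show ?thesis by (simp add: power2_eq_square algebra_simps)
  qed
  also have "\<dots> \<le> (u - v)\<^sup>2 / (2 * s)"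
    using mult_right_mono[OF b(2), of "(u - v)\<^sup>2"] s by (simp add: field_simps)
  finally have "exp (- (u - v)\<^sup>2 / (2 * s)) \<le> exp (2 * b * u\<^sup>2) * exp (- b * v\<^sup>2)"
    by (simp flip: exp_add)
  then show ?thesis unfolding pk_def using s by (simp add: divide_right_mono)
qed

lemma ldet_bound:
  assumes "\<And>i j. i \<in> {1..N} \<Longrightarrow> j \<in> {1..N} \<Longrightarrow> \<bar>A i j\<bar> \<le> K * (f i * g j)"
  shows "\<bar>ldet N A\<bar> \<le> fact N * K ^ N * ((\<Prod>i = 1..N. f i) * (\<Prod>i = 1..N. g i))"
proof -
  have "\<bar>ldet N A\<bar> \<le> (\<Sum>p | p permutes {1..N}. \<bar>of_int (sign p) * (\<Prod>i = 1..N. A i (p i))\<bar>)"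
    unfolding ldet_def by (rule sum_abs)
  also have "\<dots> \<le> (\<Sum>p | p permutes {1..N}. K ^ N * ((\<Prod>i = 1..N. f i) * (\<Prod>i = 1..N. g i)))"
  proof (rule sum_mono)
    fix p assume "p \<in> {p. p permutes {1..N}}"
    then have p: "p permutes {1..N}" by simp
    have "\<bar>of_int (sign p) * (\<Prod>i = 1..N. A i (p i))\<bar> = (\<Prod>i = 1..N. \<bar>A i (p i)\<bar>)"
      by (simp add: abs_mult abs_prod sign_def)
    also have "\<dots> \<le> (\<Prod>i = 1..N. K * (f i * g (p i)))"
      using assms permutes_in_image[OF p] by (intro prod_mono) auto
    also have "\<dots> = K ^ N * ((\<Prod>i = 1..N. f i) * (\<Prod>i = 1..N. g (p i)))"
      by (simp add: prod.distrib)
    also have "(\<Prod>i = 1..N. g (p i)) = (\<Prod>i = 1..N. g i)"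
      using prod.permute[OF p, of g] by (simp add: o_def)
    finally show "\<bar>of_int (sign p) * (\<Prod>i = 1..N. A i (p i))\<bar> \<le> K ^ N * ((\<Prod>i = 1..N. f i) * (\<Prod>i = 1..N. g i))" .
  qed
  also have "\<dots> = fact N * K ^ N * ((\<Prod>i = 1..N. f i) * (\<Prod>i = 1..N. g i))"
    using card_permutations[of "{1..N}" N] by simp
  finally show ?thesis .
qed

section \<open>A Gaussian majorant for the full density\<close>

context time_grid
begin

text \<open>The rate falls by a factor 4 per level: the growth \<open>2 * decay m\<close> demanded
  by the determinant leaving level \<open>m\<close> is then half of \<open>decay (m - 1)\<close>,
  the decay that level has received. The start 1/(4T) satisfies \<open>decay_small\<close> for all
  time steps.\<close>

definition decay :: "nat \<Rightarrow> real" where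
  "decay m = 1 / (4 * T) / 4 ^ m"

lemma decay_pos: "0 < decay m"
  using T by (simp add: decay_def)

lemma decay_small: "0 < s \<Longrightarrow> s \<le> T \<Longrightarrow> 4 * decay m * s \<le> 1"
proof -
  assume s: "0 < s" "s \<le> T"
  have "4 * decay m * s = (s / T) / 4 ^ m" by (simp add: decay_def)
  also have "\<dots> \<le> 1 / 1" using s by (intro frac_le) auto
  finally show ?thesis by simp
qed

definition gprod :: "nat \<Rightarrow> real \<Rightarrow> nat \<Rightarrow> (nat \<Rightarrow> nat \<Rightarrow> real) \<Rightarrow> real" where
  "gprod N c m X = (\<Prod>i = 1..N. exp (c * (X m i)\<^sup>2))"

lemma gprod_pos: "0 < gprod N c m X"
  by (simp add: gprod_def prod_pos)

lemma gprod_mult: "gprod N a m X * gprod N b m X = gprod N (a + b) m X"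
  by (simp add: gprod_def prod.distrib[symmetric] exp_add[symmetric] algebra_simps)

text \<open>At each level up to \<open>k\<close>, the received rate \<open>decay (m - 1)\<close>
  minus the outgoing \<open>2 * decay m\<close> leaves \<open>decay (m - 1) / 2\<close>.\<close>

lemma gprod_telescope:
  "gprod N (- decay 0) 1 X * (\<Prod>m = 1..k. gprod N (2 * decay m) m X * gprod N (- decay m) (m + 1) X)
    = (\<Prod>m = 1..k. gprod N (- decay (m - 1) / 2) m X) * gprod N (- decay k) (k + 1) X"
proof (induction k)
  case (Suc k)
  have e: "- decay k + 2 * decay (Suc k) = - decay k / 2" by (simp add: decay_def)
  have "gprod N (- decay k) (k + 1) X * gprod N (2 * decay (Suc k)) (Suc k) X = gprod N (- decay k / 2) (Suc k) X"
    unfolding Suc_eq_plus1[symmetric] gprod_mult e ..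
  note g = this
  have "gprod N (- decay 0) 1 X * (\<Prod>m = 1..Suc k. gprod N (2 * decay m) m X * gprod N (- decay m) (m + 1) X)
    = (gprod N (- decay 0) 1 X * (\<Prod>m = 1..k. gprod N (2 * decay m) m X * gprod N (- decay m) (m + 1) X))
    * (gprod N (2 * decay (Suc k)) (Suc k) X * gprod N (- decay (Suc k)) (Suc k + 1) X)"
    by (simp add: mult.assoc)
  also have "\<dots> = (\<Prod>m = 1..k. gprod N (- decay (m - 1) / 2) m X)
    * (gprod N (- decay k) (k + 1) X * gprod N (2 * decay (Suc k)) (Suc k) X) * gprod N (- decay (Suc k)) (Suc k + 1) X"
    unfolding Suc by (simp only: mult.assoc)
  also have "\<dots> = (\<Prod>m = 1..Suc k. gprod N (- decay (m - 1) / 2) m X) * gprod N (- decay (Suc k)) (Suc k + 1) X"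
    unfolding g by (simp add: mult.assoc)
  finally show ?case .
qed simp

text \<open>The initial Gaussian supplies decay at rate \<open>2 * decay 0\<close>; half of it pays
  for the polynomial growth of the Vandermonde factor, and the rest starts the passage through the
  levels.\<close>

lemma rho_bound:
  "\<exists>K. \<forall>X. \<bar>rho_full N T M t X\<bar> \<le> K * (\<Prod>m = 1..M + 1. \<Prod>i = 1..N. exp (- decay (m - 1) / 2 * (X m i)\<^sup>2))"
proof -
  define K0 where "K0 = ((2 + real (2 * N) / decay 0) ^ (2 * N)) ^ N"
  define K1 where "K1 = (1 / sqrt (2 * pi * t 1)) ^ N"
  define Km where "Km m = fact N * (1 / sqrt (2 * pi * (t (m + 1) - t m))) ^ N" for m
  have d: "0 < t (m + 1) - t m" "t (m + 1) - t m \<le> T" if "m \<in> {1..M}" for m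
    using that t_step[of m] t_le_T[of "m + 1"] t_le[of 0 m] t0 by auto
  have "\<bar>rho_full N T M t X\<bar> \<le> (\<bar>Cconst N T (t 1)\<bar> * K0 * K1 * (\<Prod>m = 1..M. Km m))
    * (\<Prod>m = 1..M + 1. \<Prod>i = 1..N. exp (- decay (m - 1) / 2 * (X m i)\<^sup>2))" for X
  proof -
    have h: "\<bar>hN N (X 1)\<bar> \<le> K0 * gprod N (decay 0) 1 X"
    proof -
      have "\<bar>hN N (X 1)\<bar> \<le> (\<Prod>i = 1..N. (1 + \<bar>X 1 i\<bar>) ^ (2 * N))" by (rule hN_bound)
      also have "\<dots> \<le> (\<Prod>i = 1..N. (2 + real (2 * N) / decay 0) ^ (2 * N) * exp (decay 0 * (X 1 i)\<^sup>2))"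
        by (intro prod_mono conjI polynomial_gaussian_bound decay_pos) auto
      finally show ?thesis by (simp add: K0_def gprod_def prod.distrib)
    qed
    have p: "\<bar>\<Prod>i = 1..N. pk (t 1) 0 (X 1 i)\<bar> \<le> K1 * gprod N (- 2 * decay 0) 1 X"
    proof -
      have "pk (t 1) 0 u \<le> 1 / sqrt (2 * pi * t 1) * exp (- 2 * decay 0 * u\<^sup>2)" for u
      proof -
        have "2 * decay 0 * u\<^sup>2 \<le> u\<^sup>2 / (2 * t 1)"
          using mult_right_mono[OF decay_small[OF t1_pos less_imp_le[OF t1_less], of 0], of "u\<^sup>2"] t1_pos
          by (simp add: field_simps)
        then show ?thesis unfolding pk_def using t1_pos by (simp add: divide_right_mono)
      qed
      then have "\<bar>\<Prod>i = 1..N. pk (t 1) 0 (X 1 i)\<bar> \<le> (\<Prod>i = 1..N. 1 / sqrt (2 * pi * t 1) * exp (- 2 * decay 0 * (X 1 i)\<^sup>2))"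
        unfolding abs_prod using pk_nonneg[OF t1_pos] by (intro prod_mono) auto
      also have "\<dots> = K1 * gprod N (- 2 * decay 0) 1 X"
        unfolding K1_def gprod_def prod.distrib by simp
      finally show ?thesis .
    qed
    have l: "\<bar>\<Prod>m = 1..M. ldet N (\<lambda>i j. pk (t (m + 1) - t m) (X m i) (X (m + 1) j))\<bar>
      \<le> (\<Prod>m = 1..M. Km m * (gprod N (2 * decay m) m X * gprod N (- decay m) (m + 1) X))"
      unfolding abs_prod
    proof (intro prod_mono conjI)
      fix m assume m: "m \<in> {1..M}"
      show "\<bar>ldet N (\<lambda>i j. pk (t (m + 1) - t m) (X m i) (X (m + 1) j))\<bar> \<le> Km m * (gprod N (2 * decay m) m X * gprod N (- decay m) (m + 1) X)"
        unfolding Km_def gprod_def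
        by (rule ldet_bound) (use pk_separated[OF d(1)[OF m] less_imp_le[OF decay_pos] decay_small[OF d[OF m]]] pk_nonneg[OF d(1)[OF m]] in auto)
    qed auto
    have K01: "0 \<le> K0" "0 \<le> K1"
      using decay_pos[of 0] t1_pos unfolding K0_def K1_def
      by (intro zero_le_power; simp)+
    have sg: "\<bar>sgn (hN N (X (M + 1)))\<bar> \<le> 1" by (simp add: sgn_if)
    have "\<bar>rho_full N T M t X\<bar> \<le> \<bar>Cconst N T (t 1)\<bar> * (K0 * gprod N (decay 0) 1 X) * 1 * (K1 * gprod N (- 2 * decay 0) 1 X)
      * (\<Prod>m = 1..M. Km m * (gprod N (2 * decay m) m X * gprod N (- decay m) (m + 1) X))"
      unfolding rho_full_def abs_mult using h p l sg
      by (intro mult_mono mult_nonneg_nonneg order_refl)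
         (use K01 in \<open>auto intro!: mult_nonneg_nonneg less_imp_le[OF gprod_pos]\<close>)
    also have "\<dots> = (\<bar>Cconst N T (t 1)\<bar> * K0 * K1 * (\<Prod>m = 1..M. Km m)) * ((gprod N (decay 0) 1 X * gprod N (- 2 * decay 0) 1 X)
      * (\<Prod>m = 1..M. gprod N (2 * decay m) m X * gprod N (- decay m) (m + 1) X))"
      by (simp only: prod.distrib mult_ac mult_1_right)
    also have "gprod N (decay 0) 1 X * gprod N (- 2 * decay 0) 1 X = gprod N (- decay 0) 1 X"
      by (simp add: gprod_mult)
    also have "gprod N (- decay 0) 1 X * (\<Prod>m = 1..M. gprod N (2 * decay m) m X * gprod N (- decay m) (m + 1) X)
      = (\<Prod>m = 1..M. gprod N (- decay (m - 1) / 2) m X) * gprod N (- decay M) (M + 1) X"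
      by (rule gprod_telescope)
    also have "(\<bar>Cconst N T (t 1)\<bar> * K0 * K1 * (\<Prod>m = 1..M. Km m)) * \<dots>
      \<le> (\<bar>Cconst N T (t 1)\<bar> * K0 * K1 * (\<Prod>m = 1..M. Km m)) * (\<Prod>m = 1..M + 1. gprod N (- decay (m - 1) / 2) m X)"
    proof (rule mult_left_mono)
      \<comment> \<open>No determinant leaves the last level, so the full rate is still available;
        it is halved only to match the other levels.\<close>
      have "gprod N (- decay M) (M + 1) X \<le> gprod N (- decay M / 2) (M + 1) X"
        unfolding gprod_def using decay_pos[of M] by (intro prod_mono) (auto simp: mult_right_mono)
      then show "(\<Prod>m = 1..M. gprod N (- decay (m - 1) / 2) m X) * gprod N (- decay M) (M + 1) X
        \<le> (\<Prod>m = 1..M + 1. gprod N (- decay (m - 1) / 2) m X)"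
        by (simp add: mult_left_mono prod_nonneg less_imp_le[OF gprod_pos] del: mult_minus_left)
      show "0 \<le> \<bar>Cconst N T (t 1)\<bar> * K0 * K1 * (\<Prod>m = 1..M. Km m)"
        using decay_pos[of 0] d t1_pos unfolding K0_def K1_def Km_def
        by (intro mult_nonneg_nonneg prod_nonneg zero_le_power) (auto intro!: add_nonneg_nonneg less_imp_le)
    qed
    finally show ?thesis unfolding gprod_def .
  qed
  then show ?thesis by blast
qed

definition fill_in :: "(nat \<Rightarrow> nat) \<Rightarrow> (nat \<Rightarrow> nat \<Rightarrow> real) \<Rightarrow> (nat \<times> nat \<Rightarrow> real) \<Rightarrow> nat \<Rightarrow> nat \<Rightarrow> real" where
  "fill_in Ns x y = (\<lambda>m i. if i \<le> Ns m then x m i else y (m, i))"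

lemma finite_free_idx: "finite (free_idx N M Ns)"
proof -
  have "free_idx N M Ns \<subseteq> {1..M + 1} \<times> {..N}" by (auto simp: free_idx_def)
  then show ?thesis by (rule finite_subset) auto
qed

lemma measurable_fill_in:
  assumes "m \<in> {1..M + 1}" "i \<in> {1..N}"
  shows "(\<lambda>y. fill_in Ns x y m i) \<in> borel_measurable (PiM (free_idx N M Ns) (\<lambda>_. lborel))"
proof (cases "i \<le> Ns m")
  case False
  then have "(m, i) \<in> free_idx N M Ns" using assms by (auto simp: free_idx_def)
  from measurable_component_singleton[OF this, of "\<lambda>_. lborel"] False show ?thesis by (simp add: fill_in_def)
qed (simp add: fill_in_def)

lemma integrable_rho:
  "integrable (PiM (free_idx N M Ns) (\<lambda>_. lborel)) (\<lambda>y. rho_full N T M t (fill_in Ns x y))"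
proof -
  interpret product_sigma_finite "\<lambda>_ :: nat \<times> nat. lborel :: real measure" ..
  let ?I = "free_idx N M Ns" and ?J = "{1..M + 1} \<times> {1..N}"
  define g where "g mi u = exp (- decay (fst mi - 1) / 2 * u\<^sup>2)" for mi :: "nat \<times> nat" and u
  have g: "0 < g mi u" "g mi u \<le> 1" for mi u by (auto simp: g_def intro!: mult_nonneg_nonneg less_imp_le[OF decay_pos])
  have int_g: "integrable lborel (g mi)" for mi
  proof -
    define s where "s = 1 / decay (fst mi - 1)"
    have s: "s > 0" using decay_pos by (simp add: s_def)
    have "g mi u = sqrt (2 * pi * s) * pk s 0 u" for u
      using s unfolding g_def pk_def by (simp add: s_def)
    then show ?thesis using integrable_pk[OF s, of 0] by (simp add: integrable_mult_right cong: Bochner_Integration.integrable_cong)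
  qed
  obtain K where K: "\<And>X. \<bar>rho_full N T M t X\<bar> \<le> K * (\<Prod>m = 1..M + 1. \<Prod>i = 1..N. exp (- decay (m - 1) / 2 * (X m i)\<^sup>2))"
    using rho_bound by blast
  have bound: "\<bar>rho_full N T M t (fill_in Ns x y)\<bar> \<le> \<bar>K\<bar> * (\<Prod>mi\<in>?I. g mi (y mi))" for y
  proof -
    let ?P = "\<Prod>mi\<in>?J. g mi (fill_in Ns x y (fst mi) (snd mi))"
    have "\<bar>rho_full N T M t (fill_in Ns x y)\<bar> \<le> K * ?P"
      using K[of "fill_in Ns x y"] by (simp add: prod.cartesian_product g_def split_beta)
    also have "\<dots> \<le> \<bar>K\<bar> * ?P"
      using g(1) by (intro mult_right_mono prod_nonneg) (auto intro: less_imp_le)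
    \<comment> \<open>The factors at the fixed points are at most 1, which leaves a product of
      integrable functions of the free coordinates.\<close>
    also have "?P \<le> (\<Prod>mi\<in>?I. g mi (y mi))"
    proof -
      have sub: "?I \<subseteq> ?J" by (auto simp: free_idx_def)
      have "?P = (\<Prod>mi\<in>?J - ?I. g mi (fill_in Ns x y (fst mi) (snd mi))) * (\<Prod>mi\<in>?I. g mi (fill_in Ns x y (fst mi) (snd mi)))"
        by (rule prod.subset_diff[OF sub]) simp
      also have "(\<Prod>mi\<in>?I. g mi (fill_in Ns x y (fst mi) (snd mi))) = (\<Prod>mi\<in>?I. g mi (y mi))"
        by (rule prod.cong) (auto simp: free_idx_def fill_in_def)
      also have "(\<Prod>mi\<in>?J - ?I. g mi (fill_in Ns x y (fst mi) (snd mi))) * (\<Prod>mi\<in>?I. g mi (y mi)) \<le> 1 * (\<Prod>mi\<in>?I. g mi (y mi))"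
        using g by (intro mult_right_mono prod_le_1 prod_nonneg) (auto intro: less_imp_le)
      finally show ?thesis by simp
    qed
    finally show ?thesis by (simp add: mult_left_mono)
  qed
  have meas: "(\<lambda>y. rho_full N T M t (fill_in Ns x y)) \<in> borel_measurable (PiM ?I (\<lambda>_. lborel))"
  proof -
    have [measurable]: "(\<lambda>y. fill_in Ns x y m i) \<in> borel_measurable (PiM ?I (\<lambda>_. lborel))"
      if "m \<in> {1..M + 1}" "i \<in> {1..N}" for m i
      using measurable_fill_in[OF that] .
    have hm: "(\<lambda>y. hN N (fill_in Ns x y m)) \<in> borel_measurable (PiM ?I (\<lambda>_. lborel))" if "m \<in> {1..M + 1}" for m
      unfolding hN_def using that by (intro borel_measurable_prod borel_measurable_diff measurable_fill_in) auto
    have lm: "(\<lambda>y. ldet N (\<lambda>i j. pk (t (m + 1) - t m) (fill_in Ns x y m i) (fill_in Ns x y (m + 1) j)))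
      \<in> borel_measurable (PiM ?I (\<lambda>_. lborel))" if "m \<in> {1..M}" for m
      unfolding ldet_def
    proof (intro borel_measurable_sum borel_measurable_times borel_measurable_const borel_measurable_prod borel_measurable_pk measurable_fill_in)
      fix p i assume "p \<in> {p. p permutes {1..N}}" "i \<in> {1..N}"
      then show "p i \<in> {1..N}" using permutes_in_image[of p "{1..N}" i] by simp
    qed (use that in auto)
    have sg: "(\<lambda>y. sgn (hN N (fill_in Ns x y (M + 1)))) \<in> borel_measurable (PiM ?I (\<lambda>_. lborel))"
      using hm[of "M + 1"] by (intro measurable_compose[OF _ borel_measurable_sgn]) auto
    show ?thesis
      unfolding rho_full_def
      by (intro borel_measurable_times borel_measurable_const borel_measurable_prod borel_measurable_pk hm lm sg measurable_fill_in) auto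
  qed
  have "integrable (PiM ?I (\<lambda>_. lborel)) (\<lambda>y. \<Prod>mi\<in>?I. g mi (y mi))"
    by (rule product_integrable_prod[OF finite_free_idx]) (rule int_g)
  then have "integrable (PiM ?I (\<lambda>_. lborel)) (\<lambda>y. \<bar>K\<bar> * (\<Prod>mi\<in>?I. g mi (y mi)))" by simp
  moreover have "norm (rho_full N T M t (fill_in Ns x y)) \<le> norm (\<bar>K\<bar> * (\<Prod>mi\<in>?I. g mi (y mi)))" for y
  proof -
    have "0 \<le> \<bar>K\<bar> * (\<Prod>mi\<in>?I. g mi (y mi))"
      by (intro mult_nonneg_nonneg prod_nonneg abs_ge_zero less_imp_le[OF g(1)])
    then show ?thesis using bound[of y] by (simp only: real_norm_def abs_of_nonneg)
  qed
  ultimately show ?thesis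
    by (intro Bochner_Integration.integrable_bound[OF _ meas AE_I2])
qed

end

section \<open>Iterated integration of the bordered Pfaffian\<close>

context time_grid
begin

lemma measurable_bpf:
  assumes m: "m \<in> {1..M + 1}"
  shows "(\<lambda>z. bpf n (Ns(m := Suc (Ns m))) (x(m := (x m)(Suc (Ns m) := z)))) \<in> borel_measurable borel"
proof -
  have m': "1 \<le> m" "m \<le> M + 1" using m by auto
  let ?L = "borders n @ config Ns x"
  have good: "good (?L ! j)" if "j < length ?L" for j using good_config[of "?L ! j"] nth_mem[OF that] by blast
  have "(\<lambda>z. skern (Dn m z) d) \<in> borel_measurable borel" if "good d" for d
    using borel_measurable_integrable[OF integrable_Dn_row[OF m' that]] by simp
  then show ?thesis
    unfolding bpf_insert[OF m] pf_expand_cof using Up_row_bounded(1)[OF m'] good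
    by (intro borel_measurable_add borel_measurable_sum borel_measurable_times borel_measurable_const)
       (auto simp del: length_append)
qed

text \<open>Induction on the number of free coordinates. Fubini singles out one of them: the
  induction hypothesis integrates the others with it held fixed, and \<open>integral_bpf\<close>
  does the last integral. Its factors, met in turn, build the factorials.\<close>

lemma integral_bpf_full:
  assumes "\<And>m. m \<in> {1..M + 1} \<Longrightarrow> Ns m \<le> 2 * n"
  shows "(\<integral>y. bpf n (\<lambda>_. 2 * n) (fill_in Ns x y) \<partial>PiM (free_idx (2 * n) M Ns) (\<lambda>_. lborel))
    = (\<Prod>m = 1..M + 1. fact (2 * n - Ns m)) * bpf n Ns x"
  using assms
proof (induction "card (free_idx (2 * n) M Ns)" arbitrary: Ns x)
  case 0
  then have e: "free_idx (2 * n) M Ns = {}" using finite_free_idx by simp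
  have N: "Ns m = 2 * n" if "m \<in> {1..M + 1}" for m
  proof (rule ccontr)
    assume "Ns m \<noteq> 2 * n"
    then have "(m, 2 * n) \<in> free_idx (2 * n) M Ns" using 0(2)[OF that] that by (auto simp: free_idx_def)
    then show False using e by simp
  qed
  have "bpf n (\<lambda>_. 2 * n) (fill_in Ns x y) = bpf n Ns x" for y
    by (rule bpf_cong) (auto simp: fill_in_def N)
  then show ?case
    unfolding e by (simp add: PiM_empty N lebesgue_integral_count_space_finite)
next
  case (Suc k)
  define N where "N = 2 * n"
  interpret product_sigma_finite "\<lambda>_ :: nat \<times> nat. lborel :: real measure" ..
  have "free_idx N M Ns \<noteq> {}" using Suc(2) by (auto simp: N_def)
  then obtain m where m: "m \<in> {1..M + 1}" "Ns m < N" by (auto simp: free_idx_def)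
  define Ns' where "Ns' = Ns(m := Suc (Ns m))"
  \<comment> \<open>The first free index of level \<open>m\<close>; fixing it leaves a set that is
    again of the form \<open>free_idx\<close>, now for \<open>Ns'\<close>.\<close>
  define p where "p = (m, Suc (Ns m))"
  define I where "I = free_idx N M Ns'"
  have ins: "free_idx N M Ns = {p} \<union> I" and notin: "{p} \<inter> I = {}"
    using m by (auto simp: free_idx_def I_def Ns'_def p_def split: if_splits)
  have finI: "finite I" unfolding I_def by (rule finite_free_idx)
  have k: "k = card (free_idx (2 * n) M Ns')"
    using Suc(2) ins notin finI by (simp add: N_def[symmetric] I_def)
  have le': "Ns' l \<le> 2 * n" if "l \<in> {1..M + 1}" for l
    using Suc(3)[OF that] m by (auto simp: Ns'_def N_def)
  define P where "P = (\<Prod>l = 1..M + 1. fact (N - Ns' l) :: real)"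
  have r: "(\<Prod>k<n. - rcoef T (t 1) k) \<noteq> 0"
    using rcoef_pos by (simp add: less_imp_neq[symmetric])
  \<comment> \<open>Up to a constant the integrand is the full density, so Fubini is justified by
    its Gaussian majorant.\<close>
  have int: "integrable (PiM ({p} \<union> I) (\<lambda>_. lborel)) (\<lambda>y. bpf n (\<lambda>_. N) (fill_in Ns x y))"
    unfolding ins[symmetric] bpf_full[OF N_def] by (intro integrable_mult_right integrable_rho)
  have inner: "(\<integral>y. bpf n (\<lambda>_. N) (fill_in Ns x (merge {p} I (w, y))) \<partial>PiM I (\<lambda>_. lborel))
    = P * bpf n Ns' (x(m := (x m)(Suc (Ns m) := w p)))" for w
  proof -
    let ?x = "x(m := (x m)(Suc (Ns m) := w p))"
    have "bpf n (\<lambda>_. N) (fill_in Ns x (merge {p} I (w, y))) = bpf n (\<lambda>_. N) (fill_in Ns' ?x y)" for y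
    proof (rule bpf_cong)
      fix l i assume li: "l \<in> {1..M + 1}" "i \<in> {1..N}"
      consider "i \<le> Ns l" | "(l, i) = p" | "(l, i) \<in> I" "\<not> i \<le> Ns l" "(l, i) \<noteq> p"
      proof -
        have "\<not> i \<le> Ns l \<Longrightarrow> (l, i) \<in> {p} \<union> I"
          using li unfolding ins[symmetric] by (simp add: free_idx_def)
        then show ?thesis using that by blast
      qed
      then show "fill_in Ns x (merge {p} I (w, y)) l i = fill_in Ns' ?x y l i"
      proof cases
        case 1
        then show ?thesis by (auto simp: fill_in_def Ns'_def)
      next
        case 2
        then show ?thesis by (auto simp: fill_in_def Ns'_def p_def merge_def)
      next
        case 3
        then have "\<not> i \<le> Ns' l" by (auto simp: I_def free_idx_def)
        with 3 show ?thesis by (auto simp: fill_in_def merge_def)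
      qed
    qed simp
    then have "(\<integral>y. bpf n (\<lambda>_. N) (fill_in Ns x (merge {p} I (w, y))) \<partial>PiM I (\<lambda>_. lborel))
      = (\<integral>y. bpf n (\<lambda>_. 2 * n) (fill_in Ns' ?x y) \<partial>PiM (free_idx (2 * n) M Ns') (\<lambda>_. lborel))"
      by (simp add: N_def I_def)
    also have "\<dots> = P * bpf n Ns' ?x"
      unfolding P_def N_def by (rule Suc(1)[OF k le'])
    finally show ?thesis .
  qed
  have "(\<integral>y. bpf n (\<lambda>_. N) (fill_in Ns x y) \<partial>PiM (free_idx N M Ns) (\<lambda>_. lborel))
    = (\<integral>w. (\<integral>y. bpf n (\<lambda>_. N) (fill_in Ns x (merge {p} I (w, y))) \<partial>PiM I (\<lambda>_. lborel)) \<partial>PiM {p} (\<lambda>_. lborel))"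
    unfolding ins by (rule product_integral_fold[OF notin _ finI int]) simp
  also have "\<dots> = (\<integral>w. (\<lambda>z. P * bpf n Ns' (x(m := (x m)(Suc (Ns m) := z)))) (w p) \<partial>PiM {p} (\<lambda>_. lborel))"
    unfolding inner ..
  also have "\<dots> = (LBINT z. P * bpf n Ns' (x(m := (x m)(Suc (Ns m) := z))))"
    by (rule product_integral_singleton) (use measurable_bpf[OF m(1), of n Ns x] in \<open>simp add: Ns'_def\<close>)
  also have "\<dots> = P * ((real (2 * n) - real (Ns m)) * bpf n Ns x)"
    unfolding Ns'_def using integral_bpf[OF m(1), of n Ns x] by simp
  also have "P * ((real (2 * n) - real (Ns m)) * bpf n Ns x) = (\<Prod>l = 1..M + 1. fact (N - Ns l)) * bpf n Ns x"
  proof -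
    have "(\<Prod>l = 1..M + 1. fact (N - Ns l) :: real) = fact (N - Ns m) * (\<Prod>l\<in>{1..M + 1} - {m}. fact (N - Ns l))"
      by (rule prod.remove[OF _ m(1)]) simp
    moreover have "P = fact (N - Suc (Ns m)) * (\<Prod>l\<in>{1..M + 1} - {m}. fact (N - Ns l))"
      unfolding P_def by (subst prod.remove[OF _ m(1)]) (simp_all add: Ns'_def)
    moreover have "fact (N - Ns m) = (real (2 * n) - real (Ns m)) * fact (N - Suc (Ns m))"
    proof -
      have "N - Ns m = Suc (N - Suc (Ns m))" using m(2) by simp
      then show ?thesis using m(2) unfolding N_def by (simp add: of_nat_diff)
    qed
    ultimately show ?thesis by simp
  qed
  finally show ?case by (simp add: N_def)
qed

end

theorem theorem3:
  fixes N M :: nat and T :: real and t :: "nat \<Rightarrow> real"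
    and Ns :: "nat \<Rightarrow> nat" and x :: "nat \<Rightarrow> nat \<Rightarrow> real"
  assumes "even N" and "N > 0" and "T > 0" and "M \<ge> 1"
    and "t 0 = 0" and "\<And>m. m \<le> M \<Longrightarrow> t m < t (m + 1)" and "t (M + 1) = T"
    and "\<And>m. m \<in> {1..M + 1} \<Longrightarrow> 1 \<le> Ns m \<and> Ns m \<le> N"
  shows "corr N T M t Ns x = Tdet (blk_idx M Ns) (Qmat N T t x)"
proof -
  interpret time_grid M T t by unfold_locales (use assms in auto)
  obtain n where N: "N = 2 * n" using \<open>even N\<close> by (elim evenE)
  let ?c = "\<Prod>k<n. - rcoef T (t 1) k" and ?f = "\<Prod>m = 1..M + 1. fact (N - Ns m) :: real"
  have c: "?c \<noteq> 0" using rcoef_pos by (simp add: less_imp_neq[symmetric])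
  have f: "?f \<noteq> 0" by simp
  have "(\<integral>y. ?c * rho_full N T M t (fill_in Ns x y) \<partial>PiM (free_idx N M Ns) (\<lambda>_. lborel)) = ?f * bpf n Ns x"
    using integral_bpf_full[of Ns n x] assms(8) unfolding N[symmetric] bpf_full[OF N] by simp
  then have "?c * (\<integral>y. rho_full N T M t (fill_in Ns x y) \<partial>PiM (free_idx N M Ns) (\<lambda>_. lborel))
    = ?c * (?f * Tdet (blk_idx M Ns) (Qmat N T t x))"
    unfolding Tdet_bpf[OF N] integral_mult_right_zero by (simp only: mult.left_commute)
  then have "(\<integral>y. rho_full N T M t (fill_in Ns x y) \<partial>PiM (free_idx N M Ns) (\<lambda>_. lborel))
    = ?f * Tdet (blk_idx M Ns) (Qmat N T t x)"
    using c by (simp only: mult_left_cancel simp_thms)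
  moreover have "(\<Prod>m = 1..M + 1. 1 / fact (N - Ns m) :: real) = 1 / ?f"
    by (simp add: prod_dividef)
  ultimately show ?thesis
    unfolding corr_def fill_in_def using f by simp
qed

end
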